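(* Let $X:T^2-\{P\}\to\mathbb{R}^4_1$ be a complete immersed regular algebraic stationary surface defined on a torus with one end $P$ and with total curvature $-\int_M K\,\mathrm{d}M=8\pi$, where $M=T^2-\{P\}$. If its Gauss maps $\phi,\psi$ have order $2$ at the end $P$, then this surface is not embedded.
   Context: $\mathbb{R}^4_1$ is $\mathbb{R}^4$ with the Lorentz inner product $x_1y_1+x_2y_2+x_3y_3-x_4y_4$. A stationary surface is an immersed spacelike surface in $\mathbb{R}^4_1$ with zero mean curvature; complete means that the induced metric is complete, and $K$ is its Gaussian curvature. Every conformal stationary immersion of a Riemann surface $M$ is, up to translation, $$X=2\,\mathrm{Re}\int\big(\phi+\psi,\,-\mathrm{i}(\phi-\psi),\,1-\phi\psi,\,1+\phi\psi\big)\,\mathrm{d}h,$$ with meromorphic functions $\phi,\psi$ (Gauss maps) and a holomorphic 1-form $\mathrm{d}h$ on $M$ satisfying: $\phi\ne\bar\psi$ on $M$ and the poles of $\phi,\psi$ do not coincide; zeros of $\mathrm{d}h$ coincide with poles of $\phi$ or $\psi$ with the same order; $\oint_\gamma\phi\,\mathrm{d}h=-\overline{\oint_\gamma\psi\,\mathrm{d}h}$ and $\mathrm{Re}\oint_\gamma\mathrm{d}h=\mathrm{Re}\oint_\gamma\phi\psi\,\mathrm{d}h=0$ for all closed paths $\gamma$. The surface $X:T^2-\{P\}\to\mathbb{R}^4_1$ is called algebraic if $\phi,\psi,\mathrm{d}h$ extend meromorphically to $T^2$, and regular if moreover the end is regular, i.e. $\phi(P)\ne\overline{\psi(P)}$ (so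 $\phi\neq\bar\psi$ on all of $T^2$). The order of $\phi$ (or $\psi$) at $P$ is its local multiplicity at $P$ as a map to $\mathbb{C}\cup\{\infty\}$; if, after a Lorentz rotation, $\phi(P)=0$ and $\psi(P)=\infty$, order $2$ means that $\phi$ has a double zero and $\psi$ a double pole at $P$. *)

theory Defs
  imports "HOL-Complex_Analysis.Complex_Analysis"
begin

section \<open>The punctured torus\<close>

text \<open>
  The torus, a compact Riemann surface of genus one, is presented as the quotient of the complex
  plane by a period lattice \<open>L\<close>, with basis \<open>w1\<close>, \<open>w2\<close>. Objects on the torus minus a point are
  objects on the preimage \<open>punctured L P\<close> in the plane that are invariant under \<open>L\<close>, and two
  points of the plane give the same point of the torus iff their difference lies in \<open>L\<close>.
  A holomorphic or meromorphic 1-form is written \<open>h dz\<close>.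
\<close>

definition period_lattice :: "complex \<Rightarrow> complex \<Rightarrow> complex set" where
  "period_lattice w1 w2 = {of_int m * w1 + of_int n * w2 | m n. True}"

definition punctured :: "complex set \<Rightarrow> complex \<Rightarrow> complex set" where
  "punctured L P = {z. z - P \<notin> L}"

definition periodic_on :: "complex set \<Rightarrow> complex set \<Rightarrow> (complex \<Rightarrow> 'a) \<Rightarrow> bool" where
  "periodic_on L S f \<longleftrightarrow> (\<forall>z\<in>S. \<forall>w\<in>L. f (z + w) = f z)"

definition fundamental_parallelogram :: "complex \<Rightarrow> complex \<Rightarrow> complex set" where
  "fundamental_parallelogram w1 w2 =
     {of_real s * w1 + of_real t * w2 | s t. 0 \<le> s \<and> s < 1 \<and> 0 \<le> t \<and> t < 1}"

text \<open>A path in the plane that projects to a closed path on the punctured torus.\<close>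

definition closed_torus_path :: "complex set \<Rightarrow> complex set \<Rightarrow> (real \<Rightarrow> complex) \<Rightarrow> bool" where
  "closed_torus_path L M \<gamma> \<longleftrightarrow>
     valid_path \<gamma> \<and> path_image \<gamma> \<subseteq> M \<and> pathfinish \<gamma> - pathstart \<gamma> \<in> L"


section \<open>Spacelike surfaces in Lorentz space\<close>

definition lorentz :: "real ^ 4 \<Rightarrow> real ^ 4 \<Rightarrow> real" where
  "lorentz x y = x $ 1 * y $ 1 + x $ 2 * y $ 2 + x $ 3 * y $ 3 - x $ 4 * y $ 4"

text \<open>The partial derivatives with respect to the real coordinates \<open>(u, v)\<close>, where \<open>z = u + \<i> v\<close>.\<close>

definition pd :: "2 \<Rightarrow> (complex \<Rightarrow> 'a::real_normed_vector) \<Rightarrow> complex \<Rightarrow> 'a" where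
  "pd i f z = frechet_derivative f (at z) (if i = 1 then 1 else \<i>)"

primrec Ck_on :: "nat \<Rightarrow> (complex \<Rightarrow> 'a::real_normed_vector) \<Rightarrow> complex set \<Rightarrow> bool" where
  "Ck_on 0 f S \<longleftrightarrow> continuous_on S f"
| "Ck_on (Suc k) f S \<longleftrightarrow> (\<forall>z\<in>S. f differentiable (at z)) \<and> (\<forall>i. Ck_on k (pd i f) S)"

definition first_form :: "(complex \<Rightarrow> real ^ 4) \<Rightarrow> complex \<Rightarrow> real ^ 2 ^ 2" where
  "first_form X z = (\<chi> i j. lorentz (pd i X z) (pd j X z))"

text \<open>Positive definiteness of the first fundamental form includes the immersion property.\<close>

definition spacelike_immersion_on :: "complex set \<Rightarrow> (complex \<Rightarrow> real ^ 4) \<Rightarrow> bool" where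
  "spacelike_immersion_on M X \<longleftrightarrow>
     (\<forall>k. Ck_on k X M) \<and> (\<forall>z\<in>M. \<forall>v. v \<noteq> 0 \<longrightarrow> v \<bullet> (first_form X z *v v) > 0)"

definition conformal_on :: "complex set \<Rightarrow> (complex \<Rightarrow> real ^ 4) \<Rightarrow> bool" where
  "conformal_on M X \<longleftrightarrow>
     (\<forall>z\<in>M. first_form X z $ 1 $ 1 = first_form X z $ 2 $ 2 \<and> first_form X z $ 1 $ 2 = 0)"

definition christoffel :: "(complex \<Rightarrow> real ^ 4) \<Rightarrow> 2 \<Rightarrow> 2 \<Rightarrow> 2 \<Rightarrow> complex \<Rightarrow> real" where
  "christoffel X k i j z =
     (1 / 2) * (\<Sum>l\<in>UNIV. matrix_inv (first_form X z) $ k $ l *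
       (pd i (\<lambda>w. first_form X w $ j $ l) z + pd j (\<lambda>w. first_form X w $ i $ l) z
        - pd l (\<lambda>w. first_form X w $ i $ j) z))"

text \<open>
  The \<open>l\<close>-th coordinate of \<open>R(\<partial>\<^sub>i, \<partial>\<^sub>j) \<partial>\<^sub>k\<close>, with
  \<open>R(U, V) = \<nabla>\<^sub>U \<nabla>\<^sub>V - \<nabla>\<^sub>V \<nabla>\<^sub>U - \<nabla>\<^bsub>[U, V]\<^esub>\<close>. With this sign the round
  sphere has positive curvature in \<open>gauss_curvature\<close>.
\<close>

definition riemann :: "(complex \<Rightarrow> real ^ 4) \<Rightarrow> 2 \<Rightarrow> 2 \<Rightarrow> 2 \<Rightarrow> 2 \<Rightarrow> complex \<Rightarrow> real" where
  "riemann X l i j k z =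
     pd i (christoffel X l j k) z - pd j (christoffel X l i k) z
     + (\<Sum>m\<in>UNIV. christoffel X l i m z * christoffel X m j k z
                - christoffel X l j m z * christoffel X m i k z)"

definition gauss_curvature :: "(complex \<Rightarrow> real ^ 4) \<Rightarrow> complex \<Rightarrow> real" where
  "gauss_curvature X z =
     (\<Sum>l\<in>UNIV. first_form X z $ 1 $ l * riemann X l 1 2 2 z) / det (first_form X z)"

text \<open>
  By the Gauss formula, \<open>second_form X i j z\<close> is the normal component of \<open>\<partial>\<^sub>i \<partial>\<^sub>j X\<close>.
\<close>

definition second_form :: "(complex \<Rightarrow> real ^ 4) \<Rightarrow> 2 \<Rightarrow> 2 \<Rightarrow> complex \<Rightarrow> real ^ 4" where
  "second_form X i j z =
     pd i (pd j X) z - (\<Sum>k\<in>UNIV. christoffel X k i j z *\<^sub>R pd k X z)"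

definition mean_curvature :: "(complex \<Rightarrow> real ^ 4) \<Rightarrow> complex \<Rightarrow> real ^ 4" where
  "mean_curvature X z =
     (1 / 2) *\<^sub>R (\<Sum>i\<in>UNIV. \<Sum>j\<in>UNIV. matrix_inv (first_form X z) $ i $ j *\<^sub>R second_form X i j z)"

text \<open>
  The complex structure of the torus is the one induced by the metric, so the parametrisation of a
  stationary surface is conformal.
\<close>

definition stationary_surface :: "complex set \<Rightarrow> complex set \<Rightarrow> (complex \<Rightarrow> real ^ 4) \<Rightarrow> bool" where
  "stationary_surface L M X \<longleftrightarrow>
     periodic_on L M X \<and> spacelike_immersion_on M X \<and> conformal_on M X \<and>
     (\<forall>z\<in>M. mean_curvature X z = 0)"

definition curve_length :: "(complex \<Rightarrow> real ^ 4) \<Rightarrow> (real \<Rightarrow> complex) \<Rightarrow> real" where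
  "curve_length X \<gamma> =
     integral {0..1} (\<lambda>t.
       let v = frechet_derivative X (at (\<gamma> t)) (vector_derivative \<gamma> (at t))
       in sqrt (lorentz v v))"

text \<open>The distance on the quotient: paths may end at any representative of the second point.\<close>

definition induced_dist ::
  "complex set \<Rightarrow> complex set \<Rightarrow> (complex \<Rightarrow> real ^ 4) \<Rightarrow> complex \<Rightarrow> complex \<Rightarrow> real" where
  "induced_dist L M X z w =
     Inf {curve_length X \<gamma> | \<gamma>. valid_path \<gamma> \<and> path_image \<gamma> \<subseteq> M \<and>
                              pathstart \<gamma> = z \<and> pathfinish \<gamma> - w \<in> L}"

definition complete_surface :: "complex set \<Rightarrow> complex set \<Rightarrow> (complex \<Rightarrow> real ^ 4) \<Rightarrow> bool" where
  "complete_surface L M X \<longleftrightarrow>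
     (\<forall>s :: nat \<Rightarrow> complex. range s \<subseteq> M \<longrightarrow>
        (\<forall>e>0. \<exists>N. \<forall>m\<ge>N. \<forall>n\<ge>N. induced_dist L M X (s m) (s n) < e) \<longrightarrow>
        (\<exists>l\<in>M. (\<lambda>n. induced_dist L M X (s n) l) \<longlonglongrightarrow> 0))"

text \<open>
  The integral is taken over one representative of each point of the surface. A non-integrable
  integrand would give the value 0.
\<close>

definition total_curvature ::
  "complex \<Rightarrow> complex \<Rightarrow> complex set \<Rightarrow> (complex \<Rightarrow> real ^ 4) \<Rightarrow> real" where
  "total_curvature w1 w2 M X =
     (LINT z : fundamental_parallelogram w1 w2 \<inter> M | lborel.
        gauss_curvature X z * sqrt (det (first_form X z)))"

text \<open>Embedded means free of self-intersections; the immersion property is kept separate.\<close>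

definition embedded_surface :: "complex set \<Rightarrow> complex set \<Rightarrow> (complex \<Rightarrow> real ^ 4) \<Rightarrow> bool" where
  "embedded_surface L M X \<longleftrightarrow> (\<forall>z\<in>M. \<forall>w\<in>M. X z = X w \<longrightarrow> z - w \<in> L)"


section \<open>Weierstrass data\<close>

text \<open>
  \<open>\<phi>(z) \<noteq> cnj (\<psi>(z))\<close> in the extended plane: the value of a function that is nicely meromorphic is
  0 at a pole, so poles are treated separately.
\<close>

definition gauss_maps_distinct_at ::
  "(complex \<Rightarrow> complex) \<Rightarrow> (complex \<Rightarrow> complex) \<Rightarrow> complex \<Rightarrow> bool" where
  "gauss_maps_distinct_at \<phi> \<psi> z \<longleftrightarrow>
     \<not> (is_pole \<phi> z \<and> is_pole \<psi> z) \<and>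
     (\<not> is_pole \<phi> z \<and> \<not> is_pole \<psi> z \<longrightarrow> \<phi> z \<noteq> cnj (\<psi> z))"

text \<open>
  The coefficients of the four holomorphic 1-forms; \<open>remove_sings\<close> gives them their limits at the
  poles of \<open>\<phi>\<close> and \<open>\<psi>\<close>, which are cancelled by the zeros of \<open>h\<close>.
\<close>

definition weierstrass_form ::
  "(complex \<Rightarrow> complex) \<Rightarrow> (complex \<Rightarrow> complex) \<Rightarrow> (complex \<Rightarrow> complex) \<Rightarrow> 4 \<Rightarrow> complex \<Rightarrow> complex" where
  "weierstrass_form \<phi> \<psi> h j =
     remove_sings (\<lambda>z. (vector [\<phi> z + \<psi> z, - \<i> * (\<phi> z - \<psi> z), 1 - \<phi> z * \<psi> z, 1 + \<phi> z * \<psi> z]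
                        :: complex ^ 4) $ j * h z)"

definition weierstrass_data ::
  "complex set \<Rightarrow> complex set \<Rightarrow> (complex \<Rightarrow> complex) \<Rightarrow> (complex \<Rightarrow> complex) \<Rightarrow> (complex \<Rightarrow> complex) \<Rightarrow> bool"
where
  "weierstrass_data L M \<phi> \<psi> h \<longleftrightarrow>
     \<phi> nicely_meromorphic_on M \<and> \<psi> nicely_meromorphic_on M \<and> h analytic_on M \<and>
     periodic_on L M \<phi> \<and> periodic_on L M \<psi> \<and> periodic_on L M h \<and>
     (\<forall>z\<in>M. gauss_maps_distinct_at \<phi> \<psi> z) \<and>
     (\<forall>z\<in>M. h z = 0 \<longleftrightarrow> is_pole \<phi> z \<or> is_pole \<psi> z) \<and>
     (\<forall>z\<in>M. is_pole \<phi> z \<longrightarrow> zorder h z = - zorder \<phi> z) \<and>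
     (\<forall>z\<in>M. is_pole \<psi> z \<longrightarrow> zorder h z = - zorder \<psi> z) \<and>
     (\<forall>\<gamma>. closed_torus_path L M \<gamma> \<longrightarrow>
        contour_integral \<gamma> (remove_sings (\<lambda>z. \<phi> z * h z))
          = - cnj (contour_integral \<gamma> (remove_sings (\<lambda>z. \<psi> z * h z))) \<and>
        Re (contour_integral \<gamma> h) = 0 \<and>
        Re (contour_integral \<gamma> (remove_sings (\<lambda>z. \<phi> z * \<psi> z * h z))) = 0)"

text \<open>
  \<open>X = 2 Re \<integral> (\<dots>) dh\<close> up to translation; in particular \<open>\<phi>\<close> and \<open>\<psi>\<close> are the Gauss maps of \<open>X\<close>.
\<close>

definition weierstrass_represents ::
  "complex set \<Rightarrow> (complex \<Rightarrow> complex) \<Rightarrow> (complex \<Rightarrow> complex) \<Rightarrow> (complex \<Rightarrow> complex)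
   \<Rightarrow> (complex \<Rightarrow> real ^ 4) \<Rightarrow> bool" where
  "weierstrass_represents M \<phi> \<psi> h X \<longleftrightarrow>
     (\<forall>\<gamma> j. valid_path \<gamma> \<and> path_image \<gamma> \<subseteq> M \<longrightarrow>
        X (pathfinish \<gamma>) $ j - X (pathstart \<gamma>) $ j
          = 2 * Re (contour_integral \<gamma> (weierstrass_form \<phi> \<psi> h j)))"

text \<open>
  Meromorphy on the whole plane, for data already periodic on the preimage of the punctured torus,
  is meromorphy of the extension to the torus; the values at the puncture are those of the extension.
\<close>

definition algebraic_data ::
  "(complex \<Rightarrow> complex) \<Rightarrow> (complex \<Rightarrow> complex) \<Rightarrow> (complex \<Rightarrow> complex) \<Rightarrow> bool" where
  "algebraic_data \<phi> \<psi> h \<longleftrightarrow>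
     \<phi> nicely_meromorphic_on UNIV \<and> \<psi> nicely_meromorphic_on UNIV \<and> h nicely_meromorphic_on UNIV"

text \<open>
  The local multiplicity at \<open>z\<close> of \<open>f\<close> as a map to the Riemann sphere; it is only defined where \<open>f\<close>
  is not locally constant.
\<close>

definition has_multiplicity_at :: "(complex \<Rightarrow> complex) \<Rightarrow> complex \<Rightarrow> nat \<Rightarrow> bool" where
  "has_multiplicity_at f z n \<longleftrightarrow>
     (if is_pole f z then zorder f z = - int n
      else (\<exists>\<^sub>F w in at z. f w \<noteq> f z) \<and> zorder (\<lambda>w. f w - f z) z = int n)"

end

theory Submission
  imports Defs
begin

text \<open>
  The curvature density \<open>K dM\<close> of the surface is \<open>- 4 Re (\<partial>A/\<partial>z\<^sup>*)\<close> for the periodic function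
  \<open>A = \<phi>' / (\<phi> - \<psi>\<^sup>*)\<close>, whose only singularities are the poles of \<open>\<phi>\<close>, with residues the negative
  pole orders. Green's theorem on a period parallelogram therefore turns the total curvature into
  \<open>- 4 \<pi>\<close> times the degree of \<open>\<phi>\<close>, and by symmetry also of \<open>\<psi>\<close>; so both Gauss maps have degree 2.
  As each has multiplicity 2 at \<open>P\<close>, the function \<open>\<phi>\<close> (or \<open>1 / (\<phi> - \<phi>(P))\<close>) has a double pole at \<open>P\<close>
  and no other pole, which makes it symmetric under the reflection \<open>z \<mapsto> 2 P - z\<close>, and likewise for
  \<open>\<psi>\<close>. The zeros of \<open>h\<close> are the poles of \<open>\<phi>\<close> and \<open>\<psi>\<close>, so \<open>h(2 P - z) / h(z)\<close> is an elliptic function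
  without zeros and poles, a constant, and the constant is \<open>1\<close> or \<open>- 1\<close>. In the first case
  \<open>X(z) + X(2 P - z)\<close> is constant, so \<open>X\<close> takes the same value at the half periods \<open>P + w1 / 2\<close> and
  \<open>P + w2 / 2\<close>; in the second case \<open>X(z) = X(2 P - z)\<close>.
\<close>

section \<open>A residue theorem for non-holomorphic functions on a torus\<close>

text \<open>The metric has conformal factor \<open>4 * |\<phi> - cnj \<psi>|^2 * |h|^2\<close>; its
  logarithm splits, and the harmonic part \<open>ln |h|^2\<close> has no curvature. So the total
  curvature sees only the Gauss maps, and as the end is regular these behave at \<open>P\<close> as
  at any other point: a pole of \<open>h\<close> there does no harm. The obstacle is that
  \<open>A\<close> is not meromorphic. The residue theorem is therefore proved for functions that
  are, up to principal parts, continuously differentiable in the real sense. A second obstacle is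
  that poles may lie on the sides of the given parallelogram, which forces a generic corner and a
  return to the given one by periodicity. The number 2 arises from \<open>8 * pi\<close> by dividing
  by the 4 of the density and by the \<open>pi\<close> that each pole contributes per order.
  Multiplicity 2 then means that the fibre through \<open>P\<close> consists of \<open>P\<close>
  alone, and since this holds for both Gauss maps, they share the centre of symmetry. The half
  periods are the points of the punctured torus fixed by the reflection.\<close>

text \<open>\<open>C\<close> is continuously differentiable in the real sense and \<open>b = \<partial>C/\<partial>z\<^sup>*\<close>.\<close>

definition wirtinger_on :: "complex set \<Rightarrow> (complex \<Rightarrow> complex) \<Rightarrow> (complex \<Rightarrow> complex) \<Rightarrow> bool" where
  "wirtinger_on U C b \<longleftrightarrow> continuous_on U b \<and> (\<exists>a. continuous_on U a \<and>
     (\<forall>z\<in>U. (C has_derivative (\<lambda>v. a z * v + b z * cnj v)) (at z)))"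

lemma wirtinger_on_subset: "wirtinger_on U C b \<Longrightarrow> V \<subseteq> U \<Longrightarrow> wirtinger_on V C b"
  unfolding wirtinger_on_def by (meson continuous_on_subset subsetD)

lemma wirtinger_on_continuous_dbar: "wirtinger_on U C b \<Longrightarrow> continuous_on U b"
  by (simp add: wirtinger_on_def)

lemma wirtinger_on_continuous: "wirtinger_on U C b \<Longrightarrow> continuous_on U C"
  unfolding wirtinger_on_def
  by (meson continuous_at_imp_continuous_on has_derivative_continuous)

lemma wirtinger_on_cong:
  assumes "wirtinger_on U C b" "open U" "\<And>z. z \<in> U \<Longrightarrow> C z = D z" "\<And>z. z \<in> U \<Longrightarrow> b z = d z"
  shows "wirtinger_on U D d"
proof -
  obtain a where a: "continuous_on U b" "continuous_on U a"
    "\<And>z. z \<in> U \<Longrightarrow> (C has_derivative (\<lambda>v. a z * v + b z * cnj v)) (at z)"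
    using assms(1) by (auto simp: wirtinger_on_def)
  have "(D has_derivative (\<lambda>v. a z * v + d z * cnj v)) (at z)" if "z \<in> U" for z
    using has_derivative_transform_within_open[OF a(3) assms(2) that] assms(3,4) that by auto
  moreover have "continuous_on U d"
    using a(1) assms(4) by (simp cong: continuous_on_cong)
  ultimately show ?thesis
    using a(2) by (auto simp: wirtinger_on_def)
qed

lemma wirtinger_on_holomorphic:
  assumes "f holomorphic_on U" "open U"
  shows "wirtinger_on U f (\<lambda>_. 0)"
proof -
  have "continuous_on U (deriv f)"
    using assms holomorphic_deriv holomorphic_on_imp_continuous_on by blast
  moreover have "(f has_derivative (\<lambda>v. deriv f z * v + 0 * cnj v)) (at z)" if "z \<in> U" for z
    using holomorphic_derivI[OF assms that, of UNIV] by (simp add: has_field_derivative_def)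
  ultimately show ?thesis by (auto simp: wirtinger_on_def)
qed

lemma wirtinger_on_cnj_holomorphic:
  assumes "f holomorphic_on U" "open U"
  shows "wirtinger_on U (\<lambda>z. cnj (f z)) (\<lambda>z. cnj (deriv f z))"
proof -
  have "continuous_on U (\<lambda>z. cnj (deriv f z))"
    using assms holomorphic_deriv holomorphic_on_imp_continuous_on by (intro continuous_intros) blast
  moreover have "((\<lambda>z. cnj (f z)) has_derivative (\<lambda>v. 0 * v + cnj (deriv f z) * cnj v)) (at z)"
    if "z \<in> U" for z
  proof -
    have "(f has_derivative (\<lambda>v. deriv f z * v)) (at z)"
      using holomorphic_derivI[OF assms that, of UNIV] by (simp add: has_field_derivative_def)
    from has_derivative_cnj[OF this] show ?thesis by simp
  qed
  ultimately show ?thesis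
    unfolding wirtinger_on_def by (intro conjI exI[of _ "\<lambda>_. 0"]) auto
qed

lemma wirtinger_on_add:
  assumes "wirtinger_on U f b" "wirtinger_on U g c"
  shows "wirtinger_on U (\<lambda>z. f z + g z) (\<lambda>z. b z + c z)"
proof -
  obtain a a' where a: "continuous_on U a" "continuous_on U a'"
    "\<And>z. z \<in> U \<Longrightarrow> (f has_derivative (\<lambda>v. a z * v + b z * cnj v)) (at z)"
    "\<And>z. z \<in> U \<Longrightarrow> (g has_derivative (\<lambda>v. a' z * v + c z * cnj v)) (at z)"
    using assms by (auto simp: wirtinger_on_def)
  have "((\<lambda>z. f z + g z) has_derivative (\<lambda>v. (a z + a' z) * v + (b z + c z) * cnj v)) (at z)"
    if "z \<in> U" for z
    using has_derivative_add[OF a(3)[OF that] a(4)[OF that]] by (simp add: algebra_simps)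
  then show ?thesis
    using a(1,2) assms unfolding wirtinger_on_def
    by (intro conjI exI[of _ "\<lambda>z. a z + a' z"]) (auto intro!: continuous_intros)
qed

lemma wirtinger_on_mult:
  assumes "wirtinger_on U f b" "wirtinger_on U g c"
  shows "wirtinger_on U (\<lambda>z. f z * g z) (\<lambda>z. f z * c z + b z * g z)"
proof -
  obtain a a' where a: "continuous_on U a" "continuous_on U a'"
    "\<And>z. z \<in> U \<Longrightarrow> (f has_derivative (\<lambda>v. a z * v + b z * cnj v)) (at z)"
    "\<And>z. z \<in> U \<Longrightarrow> (g has_derivative (\<lambda>v. a' z * v + c z * cnj v)) (at z)"
    using assms by (auto simp: wirtinger_on_def)
  have "((\<lambda>z. f z * g z) has_derivative
      (\<lambda>v. (f z * a' z + a z * g z) * v + (f z * c z + b z * g z) * cnj v)) (at z)"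
    if "z \<in> U" for z
    using has_derivative_mult[OF a(3)[OF that] a(4)[OF that]] by (simp add: algebra_simps)
  moreover have "continuous_on U f" "continuous_on U g"
    using assms wirtinger_on_continuous by auto
  ultimately show ?thesis
    using a(1,2) assms unfolding wirtinger_on_def
    by (intro conjI exI[of _ "\<lambda>z. f z * a' z + a z * g z"]) (auto intro!: continuous_intros)
qed

lemma wirtinger_on_inverse:
  assumes "wirtinger_on U f b" "\<And>z. z \<in> U \<Longrightarrow> f z \<noteq> 0"
  shows "wirtinger_on U (\<lambda>z. inverse (f z)) (\<lambda>z. - b z / f z ^ 2)"
proof -
  obtain a where a: "continuous_on U a"
    "\<And>z. z \<in> U \<Longrightarrow> (f has_derivative (\<lambda>v. a z * v + b z * cnj v)) (at z)"
    using assms by (auto simp: wirtinger_on_def)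
  have "((\<lambda>z. inverse (f z)) has_derivative
      (\<lambda>v. (- a z / f z ^ 2) * v + (- b z / f z ^ 2) * cnj v)) (at z)"
    if "z \<in> U" for z
    by (rule has_derivative_eq_rhs[OF Deriv.has_derivative_inverse[OF assms(2)[OF that] a(2)[OF that]]])
      (use assms(2)[OF that] in \<open>simp add: fun_eq_iff field_simps power2_eq_square\<close>)
  moreover have "continuous_on U f"
    using assms wirtinger_on_continuous by auto
  ultimately show ?thesis
    using a(1) assms unfolding wirtinger_on_def
    by (intro conjI exI[of _ "\<lambda>z. - a z / f z ^ 2"]) (auto intro!: continuous_intros)
qed

text \<open>The witness \<open>a\<close> in \<open>wirtinger_on\<close> is only given locally. It is
  nevertheless unique, since the real derivative determines it as
  \<open>\<partial>C/\<partial>z\<close>, so the local witnesses fit together.\<close>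

lemma wirtinger_on_glue:
  assumes "\<And>z. z \<in> U \<Longrightarrow> \<exists>V. open V \<and> z \<in> V \<and> wirtinger_on V C b"
  shows "wirtinger_on U C b"
proof -
  define a where "a = (\<lambda>z. (frechet_derivative C (at z) 1 - \<i> * frechet_derivative C (at z) \<i>) / 2)"
  have loc: "(C has_derivative (\<lambda>v. a z * v + b z * cnj v)) (at z) \<and> isCont a z \<and> isCont b z"
    if z: "z \<in> U" for z
  proof -
    obtain V a' where V: "open V" "z \<in> V" "continuous_on V b" "continuous_on V a'"
      "\<And>z. z \<in> V \<Longrightarrow> (C has_derivative (\<lambda>v. a' z * v + b z * cnj v)) (at z)"
      using assms[OF z] unfolding wirtinger_on_def by blast
    have eq: "a w = a' w" if "w \<in> V" for w
    proof -
      have "frechet_derivative C (at w) = (\<lambda>v. a' w * v + b w * cnj v)"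
        using frechet_derivative_at[OF V(5)[OF that]] by simp
      then show ?thesis by (simp add: a_def algebra_simps)
    qed
    then have "continuous_on V a"
      using V(4) by (simp cong: continuous_on_cong)
    then show ?thesis
      using V(1-3) V(5)[OF V(2)] eq[OF V(2)] by (simp add: continuous_on_eq_continuous_at)
  qed
  then show ?thesis
    unfolding wirtinger_on_def
    by (intro conjI exI[of _ a]) (auto intro!: continuous_at_imp_continuous_on)
qed

section \<open>Green's theorem on a parallelogram and the winding of its boundary\<close>

definition para :: "complex \<Rightarrow> complex \<Rightarrow> complex \<Rightarrow> real \<Rightarrow> real \<Rightarrow> complex" where
  "para p w1 w2 s t = p + of_real s * w1 + of_real t * w2"

lemma continuous_on_para [continuous_intros]:
  "continuous_on S f \<Longrightarrow> continuous_on S g \<Longrightarrow> continuous_on S (\<lambda>x. para p w1 w2 (f x) (g x))"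
  unfolding para_def by (intro continuous_intros)

text \<open>Let \<open>D w\<close> be the derivative of \<open>C\<close> in direction
  \<open>w\<close>. The combination \<open>w1 * D w2 - w2 * D w1\<close> cancels the
  \<open>z\<close>-derivative \<open>a\<close> and leaves \<open>b\<close> times
  \<open>w1 * cnj w2 - w2 * cnj w1\<close>. Integrating each directional derivative along its own
  variable first, after exchanging the order of integration in one of the two terms, gives the
  boundary values.\<close>

lemma Green_parallelogram:
  assumes "wirtinger_on U C b"
    and sub: "\<And>s t. s \<in> {0..1} \<Longrightarrow> t \<in> {0..1} \<Longrightarrow> para p w1 w2 s t \<in> U"
  shows "(w1 * cnj w2 - w2 * cnj w1) * integral {0..1} (\<lambda>s. integral {0..1} (\<lambda>t. b (para p w1 w2 s t)))
    = w1 * integral {0..1} (\<lambda>s. C (para p w1 w2 s 1) - C (para p w1 w2 s 0))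
    - w2 * integral {0..1} (\<lambda>t. C (para p w1 w2 1 t) - C (para p w1 w2 0 t))"
proof -
  obtain a where ca: "continuous_on U a" and cb: "continuous_on U b"
    and der: "\<And>z. z \<in> U \<Longrightarrow> (C has_derivative (\<lambda>v. a z * v + b z * cnj v)) (at z)"
    using assms(1) by (auto simp: wirtinger_on_def)
  let ?Z = "para p w1 w2"
  define D where "D w s t = a (?Z s t) * w + b (?Z s t) * cnj w" for w s t
  have cont: "continuous_on (cbox (0,0) (1,1)) (\<lambda>(s,t). f (?Z s t))" if "continuous_on U f" for f :: "complex \<Rightarrow> complex"
    unfolding case_prod_unfold
    by (rule continuous_on_compose2[OF that]) (auto intro!: continuous_intros sub)
  have cD: "continuous_on (cbox (0,0) (1,1)) (\<lambda>(s,t). D w s t)" for w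
    using cont[of "\<lambda>z. a z * w + b z * cnj w"] ca cb unfolding D_def
    by (simp add: continuous_on_add continuous_on_mult_right)
  have D2: "integral {0..1} (D w2 s) = C (?Z s 1) - C (?Z s 0)" if s: "s \<in> {0..1}" for s
  proof (rule integral_unique, rule fundamental_theorem_of_calculus)
    fix t :: real assume t: "t \<in> {0..1}"
    have "((\<lambda>t. ?Z s t) has_derivative (\<lambda>h. of_real h * w2)) (at t within {0..1})"
      unfolding para_def by (auto intro!: derivative_eq_intros)
    from has_derivative_compose[OF this der[OF sub[OF s t]]]
    show "((\<lambda>t. C (?Z s t)) has_vector_derivative D w2 s t) (at t within {0..1})"
      by (simp add: has_vector_derivative_def D_def scaleR_conv_of_real algebra_simps)
  qed simp
  have D1: "integral {0..1} (\<lambda>s. D w1 s t) = C (?Z 1 t) - C (?Z 0 t)" if t: "t \<in> {0..1}" for t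
  proof (rule integral_unique, rule fundamental_theorem_of_calculus)
    fix s :: real assume s: "s \<in> {0..1}"
    have "((\<lambda>s. ?Z s t) has_derivative (\<lambda>h. of_real h * w1)) (at s within {0..1})"
      unfolding para_def by (auto intro!: derivative_eq_intros)
    from has_derivative_compose[OF this der[OF sub[OF s t]]]
    show "((\<lambda>s. C (?Z s t)) has_vector_derivative D w1 s t) (at s within {0..1})"
      by (simp add: has_vector_derivative_def D_def scaleR_conv_of_real algebra_simps)
  qed simp
  have int1: "D w s integrable_on {0..1}" if "s \<in> {0..1}" for w s
    using continuous_on_imp_integrable_on_Pair1[OF cD[of w], of s] that by simp
  have int2: "(\<lambda>s. integral {0..1} (D w s)) integrable_on {0..1}" for w
    using integral_integrable_2dim[OF cD[of w]] by simp
  have "(w1 * cnj w2 - w2 * cnj w1) * integral {0..1} (\<lambda>s. integral {0..1} (\<lambda>t. b (?Z s t)))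
     = integral {0..1} (\<lambda>s. integral {0..1} (\<lambda>t. (w1 * cnj w2 - w2 * cnj w1) * b (?Z s t)))"
    by (simp only: integral_mult_right)
  also have "\<dots> = integral {0..1} (\<lambda>s. integral {0..1} (\<lambda>t. w1 * D w2 s t - w2 * D w1 s t))"
    by (simp add: D_def algebra_simps)
  also have "\<dots> = integral {0..1} (\<lambda>s. w1 * integral {0..1} (D w2 s) - w2 * integral {0..1} (D w1 s))"
    by (intro integral_cong) (simp add: integral_diff int1 integrable_on_mult_right)
  also have "\<dots> = w1 * integral {0..1} (\<lambda>s. integral {0..1} (D w2 s))
                - w2 * integral {0..1} (\<lambda>s. integral {0..1} (D w1 s))"
    by (simp add: integral_diff int2 integrable_on_mult_right)
  also have "integral {0..1} (\<lambda>s. integral {0..1} (D w1 s))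
    = integral {0..1} (\<lambda>t. integral {0..1} (\<lambda>s. D w1 s t))"
    using integral_swap_continuous[OF cD[of w1]] by simp
  also have "\<dots> = integral {0..1} (\<lambda>t. C (?Z 1 t) - C (?Z 0 t))"
    by (intro integral_cong D1)
  also have "integral {0..1} (\<lambda>s. integral {0..1} (D w2 s)) = integral {0..1} (\<lambda>s. C (?Z s 1) - C (?Z s 0))"
    by (intro integral_cong D2)
  finally show ?thesis .
qed

text \<open>Pairing with \<open>cnj w1\<close> or \<open>cnj w2\<close> and taking imaginary parts
  removes one of the two coordinates; the other one appears multiplied by the oriented area
  \<open>Im (cnj w1 * w2)\<close>, up to sign.\<close>

lemma para_coords_eq:
  assumes "Im (cnj w1 * w2) > 0" "para p w1 w2 s t = para p w1 w2 s' t'"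
  shows "s = s'" "t = t'"
proof -
  have e: "of_real (s - s') * w1 + of_real (t - t') * w2 = 0" 
    using assms(2) by (simp add: para_def algebra_simps)
  have "Im (cnj w1 * (of_real (s - s') * w1 + of_real (t - t') * w2)) = (t - t') * Im (cnj w1 * w2)"
       "Im (cnj w2 * (of_real (s - s') * w1 + of_real (t - t') * w2)) = - (s - s') * Im (cnj w1 * w2)"
    by (simp_all add: algebra_simps)
  with e assms(1) show "s = s'" "t = t'" by auto
qed

lemma contour_integral_linepath_integral:
  "contour_integral (linepath a b) f = (b - a) * integral {0..1} (\<lambda>x. f (a + of_real x * (b - a)))"
proof -
  have "contour_integral (linepath a b) f = integral {0..1} (\<lambda>x. f (linepath a b x) * (b - a))"
    by (simp add: contour_integral_integral)
  also have "\<dots> = integral {0..1} (\<lambda>x. f (a + of_real x * (b - a)) * (b - a))"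
    by (simp add: linepath_def scaleR_conv_of_real algebra_simps)
  finally show ?thesis by (simp add: mult.commute)
qed

text \<open>The left side is minus the integral of \<open>1 / (z - q)\<close> along the boundary,
  traversed counterclockwise. Since \<open>q\<close> lies strictly to the left of every side, each
  side contributes a winding number with real part between 0 and 1/2; the sum is an integer strictly
  between 0 and 2, hence 1.\<close>

lemma integral_boundary_parallelogram:
  assumes J: "Im (cnj w1 * w2) > 0" and st: "0 < s" "s < 1" "0 < t" "t < 1"
    and q: "q = para p w1 w2 s t"
  shows "w1 * integral {0..1} (\<lambda>s. 1 / (para p w1 w2 s 1 - q) - 1 / (para p w1 w2 s 0 - q))
       - w2 * integral {0..1} (\<lambda>t. 1 / (para p w1 w2 1 t - q) - 1 / (para p w1 w2 0 t - q)) = - (2 * pi * \<i>)"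
proof -
  let ?a = p and ?b = "p + w1" and ?c = "p + w1 + w2" and ?d = "p + w2"
  let ?J = "Im (cnj w1 * w2)"
  \<comment> \<open>Twice the signed areas of the triangles spanned by \<open>q\<close> and the four
    sides, as shares of the area of the parallelogram.\<close>
  have im: "Im ((?b - ?a) * cnj (?b - q)) = t * ?J" "Im ((?c - ?b) * cnj (?c - q)) = (1 - s) * ?J"
    "Im ((?d - ?c) * cnj (?d - q)) = (1 - t) * ?J" "Im ((?a - ?d) * cnj (?a - q)) = s * ?J"
    by (simp_all add: q para_def algebra_simps)
  have pos: "0 < Im ((?b - ?a) * cnj (?b - q))" "0 < Im ((?c - ?b) * cnj (?c - q))"
    "0 < Im ((?d - ?c) * cnj (?d - q))" "0 < Im ((?a - ?d) * cnj (?a - q))"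
    unfolding im using st J by auto
  note seg = pos[THEN winding_number_linepath_pos_lt]
  have nin: "q \<notin> closed_segment ?a ?b" "q \<notin> closed_segment ?b ?c" "q \<notin> closed_segment ?c ?d"
    "q \<notin> closed_segment ?d ?a"
    using pos by (auto simp: closed_segment_def) (force simp: algebra_simps)+
  let ?\<gamma> = "linepath ?a ?b +++ linepath ?b ?c +++ linepath ?c ?d +++ linepath ?d ?a"
  have wn: "winding_number ?\<gamma> q = winding_number (linepath ?a ?b) q + winding_number (linepath ?b ?c) q
     + winding_number (linepath ?c ?d) q + winding_number (linepath ?d ?a) q"
    using nin by (simp add: winding_number_join path_image_join)
  have "winding_number ?\<gamma> q = 1"
  proof (rule winding_number_eq_1)
    show "Re (winding_number ?\<gamma> q) < 2" "0 < Re (winding_number ?\<gamma> q)"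
      unfolding wn using seg nin[THEN winding_number_lt_half_linepath] by auto
  qed (use nin in \<open>auto simp: path_image_join\<close>)
  with wn have "2 * pi * \<i> = 2 * pi * \<i> * (winding_number (linepath ?a ?b) q + winding_number (linepath ?b ?c) q
     + winding_number (linepath ?c ?d) q + winding_number (linepath ?d ?a) q)" by simp
  also have "\<dots> = contour_integral (linepath ?a ?b) (\<lambda>w. 1/(w - q)) + contour_integral (linepath ?b ?c) (\<lambda>w. 1/(w - q))
     + contour_integral (linepath ?c ?d) (\<lambda>w. 1/(w - q)) + contour_integral (linepath ?d ?a) (\<lambda>w. 1/(w - q))"
    using nin by (simp add: winding_number_valid_path field_simps)
  also have "contour_integral (linepath ?c ?d) (\<lambda>w. 1/(w - q)) = - contour_integral (linepath ?d ?c) (\<lambda>w. 1/(w - q))"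
    using nin by (intro contour_integral_reverse_linepath continuous_intros) (auto simp: closed_segment_commute)
  also have "contour_integral (linepath ?d ?a) (\<lambda>w. 1/(w - q)) = - contour_integral (linepath ?a ?d) (\<lambda>w. 1/(w - q))"
    using nin by (intro contour_integral_reverse_linepath continuous_intros) (auto simp: closed_segment_commute)
  finally have eq: "2 * pi * \<i> = w1 * integral {0..1} (\<lambda>x. 1 / (para p w1 w2 x 0 - q))
     + w2 * integral {0..1} (\<lambda>x. 1 / (para p w1 w2 1 x - q))
     - w1 * integral {0..1} (\<lambda>x. 1 / (para p w1 w2 x 1 - q))
     - w2 * integral {0..1} (\<lambda>x. 1 / (para p w1 w2 0 x - q))"
    by (simp add: contour_integral_linepath_integral para_def algebra_simps)
  have ints: "(\<lambda>x. 1 / (para p w1 w2 x 0 - q)) integrable_on {0..1}" "(\<lambda>x. 1 / (para p w1 w2 1 x - q)) integrable_on {0..1}"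
     "(\<lambda>x. 1 / (para p w1 w2 x 1 - q)) integrable_on {0..1}" "(\<lambda>x. 1 / (para p w1 w2 0 x - q)) integrable_on {0..1}"
  proof -
    have ne: "para p w1 w2 x y \<noteq> q" if "x = 0 \<or> x = 1 \<or> y = 0 \<or> y = 1" for x y
    proof
      assume "para p w1 w2 x y = q"
      then have "x = s" "y = t" using para_coords_eq[OF J, of p x y s t] by (auto simp: q)
      with that st show False by auto
    qed
    show "(\<lambda>x. 1 / (para p w1 w2 x 0 - q)) integrable_on {0..1}" "(\<lambda>x. 1 / (para p w1 w2 1 x - q)) integrable_on {0..1}"
     "(\<lambda>x. 1 / (para p w1 w2 x 1 - q)) integrable_on {0..1}" "(\<lambda>x. 1 / (para p w1 w2 0 x - q)) integrable_on {0..1}"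
      by (intro integrable_continuous_interval continuous_intros; use ne in simp)+
  qed
  show ?thesis
    using eq by (simp add: integral_diff ints algebra_simps)
qed

text \<open>The corner \<open>p\<close> is free and the set is closed, hence compact: a sparse set
  meets it in finitely many points.\<close>

definition closed_para :: "complex \<Rightarrow> complex \<Rightarrow> complex \<Rightarrow> complex set" where
  "closed_para p w1 w2 = (\<lambda>(s, t). para p w1 w2 s t) ` ({0..1} \<times> {0..1})"

lemma compact_closed_para: "compact (closed_para p w1 w2)"
  unfolding closed_para_def case_prod_unfold
  by (intro compact_continuous_image continuous_intros compact_Times compact_Icc)

text \<open>Subtracting the principal parts \<open>\<rho> q / (z - q)\<close> of the singularities
  in the parallelogram turns \<open>A\<close> into a function \<open>C\<close> with the same
  conjugate derivative \<open>b\<close>, to which Green's formula applies. On the boundary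
  \<open>A\<close> cancels between opposite sides, and each principal part contributes its winding
  integral. For \<open>b = 0\<close> this is the vanishing of the sum of residues.\<close>

theorem torus_residue:
  fixes \<rho> :: "complex \<Rightarrow> complex"
  assumes J: "Im (cnj w1 * w2) > 0"
    and S: "S sparse_in UNIV"
    and sing: "\<And>q. q \<in> S \<Longrightarrow> \<exists>r>0. \<exists>C. wirtinger_on (ball q r) C b \<and>
                 (\<forall>z\<in>ball q r - {q}. A z = C z + \<rho> q / (z - q))"
    and reg: "\<And>q. q \<notin> S \<Longrightarrow> \<exists>r>0. wirtinger_on (ball q r) A b"
    and per: "\<And>z. z \<notin> S \<Longrightarrow> A (z + w1) = A z" "\<And>z. z \<notin> S \<Longrightarrow> A (z + w2) = A z"
    and bd: "\<And>s t. para p w1 w2 s t \<in> S \<Longrightarrow> s \<notin> {0, 1} \<and> t \<notin> {0, 1}"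
  shows "of_real (Im (cnj w1 * w2)) * integral {0..1} (\<lambda>s. integral {0..1} (\<lambda>t. b (para p w1 w2 s t)))
    = - (pi * (\<Sum>q\<in>S \<inter> closed_para p w1 w2. \<rho> q))"
proof -
  let ?Z = "para p w1 w2"
  define K where "K = S \<inter> closed_para p w1 w2"
  have fin: "finite K"
    using sparse_in_compact_finite[of S "closed_para p w1 w2"] S compact_closed_para sparse_in_subset
    unfolding K_def by (metis inf_commute subset_UNIV)
  define U where "U = - (S - K)"
  have "closed (S - K)"
    by (rule sparse_in_UNIV_imp_closed) (meson Diff_subset S sparse_in_subset2)
  then have oU: "open U" unfolding U_def by (rule open_Compl)
  have "\<exists>r C. r > 0 \<and> wirtinger_on (ball q r) C b \<and>
                 (\<forall>z\<in>ball q r - {q}. A z = C z + \<rho> q / (z - q))" if "q \<in> S" for q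
    using sing[OF that] by blast
  then obtain r D where D: "\<And>q. q \<in> S \<Longrightarrow> r q > 0" "\<And>q. q \<in> S \<Longrightarrow> wirtinger_on (ball q (r q)) (D q) b"
    "\<And>q z. q \<in> S \<Longrightarrow> z \<in> ball q (r q) - {q} \<Longrightarrow> A z = D q z + \<rho> q / (z - q)"
    by metis
  \<comment> \<open>At \<open>z\<close> in \<open>K\<close> the value of \<open>A\<close> is
    meaningless; \<open>D z\<close> already is \<open>A\<close> without the principal part at
    \<open>z\<close>, so exactly that summand is left out there.\<close>
  define C where "C z = (if z \<in> K then D z z else A z) - (\<Sum>q\<in>K-{z}. \<rho> q / (z - q))" for z
  have wsum: "wirtinger_on V (\<lambda>z. - (\<Sum>q\<in>K'. \<rho> q / (z - q))) (\<lambda>_. 0)" if "open V" "V \<inter> K' = {}" for V K'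
    by (rule wirtinger_on_holomorphic[OF _ that(1)]) (use that(2) in \<open>auto intro!: holomorphic_intros\<close>)
  have wC: "wirtinger_on U C b"
  proof (rule wirtinger_on_glue)
    fix z assume z: "z \<in> U"
    show "\<exists>V. open V \<and> z \<in> V \<and> wirtinger_on V C b"
    proof (cases "z \<in> K")
      case True
      then have zS: "z \<in> S" by (simp add: K_def)
      define V where "V = ball z (r z) - (K - {z})"
      have V: "open V" "z \<in> V"
        using fin D(1)[OF zS] by (auto simp: V_def intro!: open_Diff finite_imp_closed)
      have "wirtinger_on V (\<lambda>w. D z w + - (\<Sum>q\<in>K-{z}. \<rho> q / (w - q))) (\<lambda>w. b w + 0)"
        by (intro wirtinger_on_add wirtinger_on_subset[OF D(2)[OF zS]] wsum V) (auto simp: V_def)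
      then have "wirtinger_on V C b"
      proof (rule wirtinger_on_cong)
        fix w assume w: "w \<in> V"
        show "D z w + - (\<Sum>q\<in>K-{z}. \<rho> q / (w - q)) = C w"
        proof (cases "w = z")
          case True
          then show ?thesis using \<open>z \<in> K\<close> by (simp add: C_def)
        next
          case False
          then have "w \<notin> K" "w \<in> ball z (r z) - {z}" using w by (auto simp: V_def)
          then show ?thesis
            using D(3)[OF zS] \<open>z \<in> K\<close> fin by (simp add: C_def sum.remove[of K z])
        qed
      qed (use V in auto)
      with V show ?thesis by blast
    next
      case False
      then have zS: "z \<notin> S" using z by (auto simp: U_def)
      from reg[OF zS] obtain r' where r': "r' > 0" "wirtinger_on (ball z r') A b" by auto
      define V where "V = ball z r' - K"
      have V: "open V" "z \<in> V"
        using fin r' False by (auto simp: V_def intro!: open_Diff finite_imp_closed)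
      have "wirtinger_on V (\<lambda>w. A w + - (\<Sum>q\<in>K. \<rho> q / (w - q))) (\<lambda>w. b w + 0)"
        by (intro wirtinger_on_add wirtinger_on_subset[OF r'(2)] wsum V) (auto simp: V_def)
      then have "wirtinger_on V C b"
        by (rule wirtinger_on_cong) (use V in \<open>auto simp: C_def V_def\<close>)
      with V show ?thesis by blast
    qed
  qed
  have sub: "?Z s t \<in> U" if "s \<in> {0..1}" "t \<in> {0..1}" for s t
    using that by (auto simp: U_def K_def closed_para_def)
  have Cbd: "C (?Z s t) = A (?Z s t) - (\<Sum>q\<in>K. \<rho> q / (?Z s t - q))" if "s \<in> {0,1} \<or> t \<in> {0,1}" for s t
  proof -
    have "?Z s t \<notin> K" using bd[of s t] that by (auto simp: K_def)
    then show ?thesis by (simp add: C_def)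
  qed
  have A1: "A (?Z s 1) = A (?Z s 0)" for s
    using per(2)[of "?Z s 0"] bd[of s 0] by (auto simp: para_def algebra_simps)
  have A2: "A (?Z 1 t) = A (?Z 0 t)" for t
    using per(1)[of "?Z 0 t"] bd[of 0 t] by (auto simp: para_def algebra_simps)
  have int: "(\<lambda>x. 1 / (?Z x 1 - q) - 1 / (?Z x 0 - q)) integrable_on {0..1}"
            "(\<lambda>x. 1 / (?Z 1 x - q) - 1 / (?Z 0 x - q)) integrable_on {0..1}" if "q \<in> K" for q
  proof -
    have ne: "?Z s t \<noteq> q" if "s \<in> {0,1} \<or> t \<in> {0,1}" for s t
      using bd[of s t] that \<open>q \<in> K\<close> by (auto simp: K_def)
    show "(\<lambda>x. 1 / (?Z x 1 - q) - 1 / (?Z x 0 - q)) integrable_on {0..1}"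
            "(\<lambda>x. 1 / (?Z 1 x - q) - 1 / (?Z 0 x - q)) integrable_on {0..1}"
      by (intro integrable_continuous_interval continuous_intros; use ne in simp)+
  qed
  have I1: "integral {0..1} (\<lambda>s. C (?Z s 1) - C (?Z s 0))
      = - (\<Sum>q\<in>K. \<rho> q * integral {0..1} (\<lambda>s. 1 / (?Z s 1 - q) - 1 / (?Z s 0 - q)))"
  proof -
    have "(\<lambda>s. C (?Z s 1) - C (?Z s 0)) = (\<lambda>s. - (\<Sum>q\<in>K. \<rho> q * (1 / (?Z s 1 - q) - 1 / (?Z s 0 - q))))"
      by (simp add: fun_eq_iff Cbd A1 right_diff_distrib sum_subtractf)
    then show ?thesis
      using int fin by (simp add: integral_sum integrable_on_mult_right)
  qed
  have I2: "integral {0..1} (\<lambda>t. C (?Z 1 t) - C (?Z 0 t))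
      = - (\<Sum>q\<in>K. \<rho> q * integral {0..1} (\<lambda>t. 1 / (?Z 1 t - q) - 1 / (?Z 0 t - q)))"
  proof -
    have "(\<lambda>t. C (?Z 1 t) - C (?Z 0 t)) = (\<lambda>t. - (\<Sum>q\<in>K. \<rho> q * (1 / (?Z 1 t - q) - 1 / (?Z 0 t - q))))"
      by (simp add: fun_eq_iff Cbd A2 right_diff_distrib sum_subtractf)
    then show ?thesis
      using int fin by (simp add: integral_sum integrable_on_mult_right)
  qed
  have bdry: "w1 * integral {0..1} (\<lambda>s. 1 / (?Z s 1 - q) - 1 / (?Z s 0 - q))
       - w2 * integral {0..1} (\<lambda>t. 1 / (?Z 1 t - q) - 1 / (?Z 0 t - q)) = - (2 * pi * \<i>)" if "q \<in> K" for q
  proof -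
    obtain s t where st: "s \<in> {0..1}" "t \<in> {0..1}" "q = ?Z s t"
      using \<open>q \<in> K\<close> by (auto simp: K_def closed_para_def)
    moreover have "s \<notin> {0,1}" "t \<notin> {0,1}"
      using bd[of s t] st \<open>q \<in> K\<close> by (auto simp: K_def)
    ultimately show ?thesis
      using integral_boundary_parallelogram[OF J, of s t q p] by force
  qed
  have "(w1 * cnj w2 - w2 * cnj w1) * integral {0..1} (\<lambda>s. integral {0..1} (\<lambda>t. b (?Z s t)))
    = - (\<Sum>q\<in>K. \<rho> q * (w1 * integral {0..1} (\<lambda>s. 1 / (?Z s 1 - q) - 1 / (?Z s 0 - q))
       - w2 * integral {0..1} (\<lambda>t. 1 / (?Z 1 t - q) - 1 / (?Z 0 t - q))))"
    by (subst Green_parallelogram[OF wC], rule sub, assumption, assumption, unfold I1 I2)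
      (simp add: sum_distrib_left sum_subtractf right_diff_distrib mult_ac)
  also have "\<dots> = (\<Sum>q\<in>K. \<rho> q) * (2 * pi * \<i>)"
    by (simp add: bdry sum_distrib_right sum_negf)
  also have "w1 * cnj w2 - w2 * cnj w1 = - 2 * \<i> * of_real (Im (cnj w1 * w2))"
    by (simp add: complex_eq_iff)
  finally have "- 2 * \<i> * (of_real (Im (cnj w1 * w2)) * integral {0..1} (\<lambda>s. integral {0..1} (\<lambda>t. b (?Z s t))))
     = - 2 * \<i> * (- (pi * (\<Sum>q\<in>K. \<rho> q)))"
    by (simp add: mult_ac del: times_complex.simps)
  then show ?thesis
    unfolding K_def by (subst (asm) mult_left_cancel) auto
qed

section \<open>Integrals over the fundamental parallelogram\<close>

text \<open>Applied in each coordinate separately, this moves the corner of the period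
  parallelogram, so that a generic corner may replace 0.\<close>

lemma integral_shift_periodic:
  fixes f :: "real \<Rightarrow> real"
  assumes cont: "continuous_on UNIV f" and per: "\<And>x. f (x + 1) = f x" and a: "0 \<le> a" "a \<le> 1"
  shows "integral {0..1} (\<lambda>x. f (a + x)) = integral {0..1} f"
proof -
  have c: "continuous_on A f" for A using cont continuous_on_subset by blast
  have int: "f integrable_on {x..y}" for x y by (rule integrable_continuous_interval[OF c])
  have "integral {0..1} (\<lambda>x. f (a + x)) = integral {a..1+a} f"
    using Henstock_Kurzweil_Integration.integral_shift[where a = 0 and b = 1 and c = a, OF c] by (simp add: o_def add.commute)
  also have "\<dots> = integral {a..1} f + integral {1..1+a} f"
    using a Henstock_Kurzweil_Integration.integral_combine[OF _ _ int, of a 1 "1+a"] by simp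
  also have "integral {1..1+a} f = integral {0..a} f"
    using Henstock_Kurzweil_Integration.integral_shift[where a = 0 and b = a and c = 1, OF c] per by (simp add: o_def add.commute)
  also have "integral {a..1} f + integral {0..a} f = integral {0..1} f"
    using a Henstock_Kurzweil_Integration.integral_combine[OF _ _ int, of 0 a 1] by simp
  finally show ?thesis .
qed

text \<open>The linear change of variables is carried out in \<open>real^2\<close> and the iterated
  integral is taken over pairs of reals, so the measure of the complex plane is identified with
  both, here and in \<open>distr_lborel_Complex_prod\<close>.\<close>

lemma distr_lborel_Complex_vec:
  "distr lborel borel (\<lambda>v::real^2. Complex (v $ 1) (v $ 2)) = lborel"
proof (rule lborel_eqI[symmetric])
  fix l u :: complex
  assume le: "\<And>b. b \<in> Basis \<Longrightarrow> l \<bullet> b \<le> u \<bullet> b"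
  have [measurable]: "(\<lambda>v::real^2. Complex (v $ 1) (v $ 2)) \<in> borel_measurable borel"
    by (intro borel_measurable_continuous_onI) (auto intro!: continuous_intros simp: Complex_eq)
  let ?l = "vector [Re l, Im l] :: real^2" and ?u = "vector [Re u, Im u] :: real^2"
  have B: "(Basis :: (real^2) set) = {axis 1 1, axis 2 1}"
    by (auto simp: Basis_vec_def) (metis exhaust_2)
  have ne: "axis 1 1 \<noteq> (axis 2 1 :: real^2)" by (simp add: axis_eq_axis)
  have "(\<lambda>v::real^2. Complex (v $ 1) (v $ 2)) -` box l u = box ?l ?u"
    by (auto simp: box_def Basis_complex_def B inner_axis)
  then have "emeasure (distr lborel borel (\<lambda>v::real^2. Complex (v $ 1) (v $ 2))) (box l u)
     = emeasure lborel (box ?l ?u)"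
    by (simp add: emeasure_distr)
  also have "\<dots> = (\<Prod>b\<in>Basis. (?u - ?l) \<bullet> b)"
    by (rule emeasure_lborel_box) (use le[of 1] le[of \<i>] in \<open>auto simp: B inner_axis Basis_complex_def\<close>)
  also have "(\<Prod>b\<in>Basis. (?u - ?l) \<bullet> b) = (\<Prod>b\<in>Basis. (u - l) \<bullet> b)"
    using ne by (simp add: B inner_axis Basis_complex_def)
  finally show "emeasure (distr lborel borel (\<lambda>v::real^2. Complex (v $ 1) (v $ 2))) (box l u)
     = (\<Prod>b\<in>Basis. (u - l) \<bullet> b)" .
qed simp

lemma distr_lborel_Complex_prod:
  "distr lborel borel (\<lambda>(x, y). Complex x y) = lborel"
proof (rule lborel_eqI[symmetric])
  fix l u :: complex
  assume le: "\<And>b. b \<in> Basis \<Longrightarrow> l \<bullet> b \<le> u \<bullet> b"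
  have [measurable]: "(\<lambda>(x, y). Complex x y) \<in> borel_measurable borel"
    unfolding case_prod_unfold
    by (intro borel_measurable_continuous_onI) (auto intro!: continuous_intros simp: Complex_eq)
  let ?l = "(Re l, Im l)" and ?u = "(Re u, Im u)"
  have B: "(Basis :: (real \<times> real) set) = {(1, 0), (0, 1)}"
    by (auto simp: Basis_prod_def)
  have "(\<lambda>(x, y). Complex x y) -` box l u = box ?l ?u"
    by (auto simp: box_def Basis_complex_def B)
  then have "emeasure (distr lborel borel (\<lambda>(x, y). Complex x y)) (box l u)
     = emeasure lborel (box ?l ?u)"
    by (simp add: emeasure_distr)
  also have "\<dots> = (\<Prod>b\<in>Basis. (?u - ?l) \<bullet> b)"
    by (rule emeasure_lborel_box) (use le[of 1] le[of \<i>] in \<open>auto simp: B Basis_complex_def\<close>)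
  also have "(\<Prod>b\<in>Basis. (?u - ?l) \<bullet> b) = (\<Prod>b\<in>Basis. (u - l) \<bullet> b)"
    by (simp add: B Basis_complex_def)
  finally show "emeasure (distr lborel borel (\<lambda>(x, y). Complex x y)) (box l u)
     = (\<Prod>b\<in>Basis. (u - l) \<bullet> b)" .
qed simp

text \<open>Common transport for both identifications of the plane; continuity of \<open>f\<close>
  and boundedness of \<open>A\<close> supply the integrability that the change of variables
  needs.\<close>

lemma set_integral_distr_lborel:
  fixes f :: "complex \<Rightarrow> real" and C :: "'a::euclidean_space \<Rightarrow> complex"
  assumes C: "C \<in> borel_measurable borel" "distr lborel borel C = lborel"
    and f: "continuous_on UNIV f" and A: "bounded A" "A \<in> sets borel"
  shows "(\<lambda>v. f (C v)) absolutely_integrable_on {v. C v \<in> A}"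
    and "(LINT z:A|lborel. f z) = integral {v. C v \<in> A} (\<lambda>v. f (C v))"
proof -
  note C(1)[measurable] A(2)[measurable]
  have [measurable]: "f \<in> borel_measurable borel" using f by (rule borel_measurable_continuous_onI)
  have int: "set_integrable lborel A f"
  proof (rule set_integrable_subset)
    show "set_integrable lborel (closure A) f"
      by (rule borel_integrable_compact[unfolded set_integrable_def[symmetric]])
        (use A f in \<open>auto intro: continuous_on_subset\<close>)
    show "A \<subseteq> closure A" by (rule closure_subset)
  qed (use A in simp)
  then have "integrable (distr lborel borel C) (\<lambda>z. indicator A z *\<^sub>R f z)"
    by (simp add: C(2) set_integrable_def)
  then have "integrable lborel (\<lambda>v. indicator A (C v) *\<^sub>R f (C v))"
    by (subst (asm) integrable_distr_eq) auto
  also have "(\<lambda>v. indicator A (C v) *\<^sub>R f (C v)) = (\<lambda>v. indicator {v. C v \<in> A} v *\<^sub>R f (C v))"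
    by (auto simp: indicator_def)
  finally have int': "set_integrable lborel {v. C v \<in> A} (\<lambda>v. f (C v))"
    by (simp add: set_integrable_def)
  then show "(\<lambda>v. f (C v)) absolutely_integrable_on {v. C v \<in> A}"
    by (simp add: set_integrable_def integrable_completion)
  have "(LINT z:A|lborel. f z) = (LINT z|distr lborel borel C. indicator A z *\<^sub>R f z)"
    by (simp add: C(2) set_lebesgue_integral_def)
  also have "\<dots> = (LINT v|lborel. indicator A (C v) *\<^sub>R f (C v))"
    by (subst integral_distr) auto
  also have "\<dots> = (LINT v:{v. C v \<in> A}|lborel. f (C v))"
    unfolding set_lebesgue_integral_def by (intro Bochner_Integration.integral_cong) (auto simp: indicator_def)
  also have "\<dots> = integral {v. C v \<in> A} (\<lambda>v. f (C v))"
    using int' by (rule set_borel_integral_eq_integral)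
  finally show "(LINT z:A|lborel. f z) = integral {v. C v \<in> A} (\<lambda>v. f (C v))" .
qed

lemma borel_measurable_Complex_vec: "(\<lambda>v::real^2. Complex (v $ 1) (v $ 2)) \<in> borel_measurable borel"
  by (intro borel_measurable_continuous_onI) (auto intro!: continuous_intros simp: Complex_eq)

lemma borel_measurable_Complex_prod: "(\<lambda>(x, y). Complex x y) \<in> borel_measurable borel"
  unfolding case_prod_unfold
  by (intro borel_measurable_continuous_onI) (auto intro!: continuous_intros simp: Complex_eq)

lemmas set_integral_complex_vec = set_integral_distr_lborel[OF borel_measurable_Complex_vec distr_lborel_Complex_vec]
lemmas set_integral_complex_prod = set_integral_distr_lborel[OF borel_measurable_Complex_prod distr_lborel_Complex_prod]

text \<open>Cramer's rule expresses both coordinates as linear functionals; written with these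
  inequalities the half-open parallelogram is visibly a Borel set.\<close>

lemma fundamental_parallelogram_alt:
  assumes J: "Im (cnj w1 * w2) > 0"
  shows "fundamental_parallelogram w1 w2 = {z. 0 \<le> - Im (cnj w2 * z) \<and> - Im (cnj w2 * z) < Im (cnj w1 * w2)
      \<and> 0 \<le> Im (cnj w1 * z) \<and> Im (cnj w1 * z) < Im (cnj w1 * w2)}"
  (is "?F = ?F'")
proof (intro set_eqI iffI)
  fix z assume "z \<in> ?F"
  then obtain s t where st: "z = of_real s * w1 + of_real t * w2" "0 \<le> s" "s < 1" "0 \<le> t" "t < 1"
    by (auto simp: fundamental_parallelogram_def)
  have "- Im (cnj w2 * z) = s * (Im (cnj w1 * w2))" "Im (cnj w1 * z) = t * (Im (cnj w1 * w2))"
    by (simp_all add: st algebra_simps)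
  moreover have "0 \<le> s * (Im (cnj w1 * w2))" "s * (Im (cnj w1 * w2)) < (Im (cnj w1 * w2))" "0 \<le> t * (Im (cnj w1 * w2))" "t * (Im (cnj w1 * w2)) < (Im (cnj w1 * w2))"
    using mult_strict_right_mono[OF _ J, of _ 1] mult_nonneg_nonneg[OF _ less_imp_le[OF J]] st by auto
  ultimately show "z \<in> ?F'" by (simp del: times_complex.simps)
next
  fix z assume z: "z \<in> ?F'"
  have "z * of_real (Im (cnj w1 * w2)) = of_real (- Im (cnj w2 * z)) * w1 + of_real (Im (cnj w1 * z)) * w2"
    by (simp add: complex_eq_iff algebra_simps)
  then have zeq: "z = of_real (- Im (cnj w2 * z) / (Im (cnj w1 * w2))) * w1 + of_real (Im (cnj w1 * z) / (Im (cnj w1 * w2))) * w2"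
    using J by (simp add: field_simps del: times_complex.simps)
  show "z \<in> ?F"
    unfolding fundamental_parallelogram_def mem_Collect_eq
    by (rule exI[of _ "- Im (cnj w2 * z) / (Im (cnj w1 * w2))"], rule exI[of _ "Im (cnj w1 * z) / (Im (cnj w1 * w2))"], intro conjI, rule zeq)
      (use z J in \<open>simp_all only: mem_Collect_eq divide_nonneg_pos pos_divide_less_eq mult_1\<close>)
qed

lemma borel_fundamental_parallelogram:
  assumes J: "Im (cnj w1 * w2) > 0"
  shows "fundamental_parallelogram w1 w2 \<in> sets borel"
  unfolding fundamental_parallelogram_alt[OF J] by measurable

lemma set_integral_fundamental_parallelogram:
  fixes f :: "complex \<Rightarrow> real"
  assumes J: "Im (cnj w1 * w2) > 0" and f: "continuous_on UNIV f"
  shows "(LINT z:fundamental_parallelogram w1 w2|lborel. f z)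
    = Im (cnj w1 * w2) * integral {0..1} (\<lambda>s. integral {0..1} (\<lambda>t. f (para 0 w1 w2 s t)))"
proof -
  let ?J = "Im (cnj w1 * w2)"
  let ?C = "\<lambda>v::real^2. Complex (v $ 1) (v $ 2)"
  let ?F = "fundamental_parallelogram w1 w2"
  define Q where "Q = {z. 0 \<le> Re z \<and> Re z < 1 \<and> 0 \<le> Im z \<and> Im z < 1}"
  have Q: "bounded Q" "Q \<in> sets borel"
  proof -
    have "Q \<subseteq> cbox 0 (Complex 1 1)" by (auto simp: Q_def in_cbox_complex_iff)
    then show "bounded Q" using bounded_cbox bounded_subset by blast
    show "Q \<in> sets borel" unfolding Q_def by measurable
  qed
  have Fb: "bounded ?F" "?F \<in> sets borel"
  proof -
    have "?F \<subseteq> closed_para 0 w1 w2"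
      by (force simp: fundamental_parallelogram_def closed_para_def para_def)
    then show "bounded ?F" using compact_closed_para compact_imp_bounded bounded_subset by blast
    show "?F \<in> sets borel" using J by (rule borel_fundamental_parallelogram)
  qed
  \<comment> \<open>The linear map that carries the half-open unit square \<open>Q\<close> onto the
    fundamental parallelogram; its determinant is the oriented area.\<close>
  define T :: "real^2 \<Rightarrow> real^2" where "T v = (\<chi> i. if i = 1 then v $ 1 * Re w1 + v $ 2 * Re w2 else v $ 1 * Im w1 + v $ 2 * Im w2)" for v
  have T: "linear T"
    by (rule linearI) (auto simp: T_def vec_eq_iff algebra_simps)
  have CT: "?C (T v) = of_real (v $ 1) * w1 + of_real (v $ 2) * w2" for v
    by (simp add: T_def complex_eq_iff)
  have det: "det (matrix T) = ?J"
    by (simp add: det_2 matrix_def T_def axis_def)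
  have img: "T ` {v. ?C v \<in> Q} = {v. ?C v \<in> ?F}"
  proof (intro set_eqI iffI)
    fix v assume "v \<in> T ` {v. ?C v \<in> Q}"
    then show "v \<in> {v. ?C v \<in> ?F}"
      unfolding fundamental_parallelogram_def by (auto simp: CT Q_def) blast
  next
    fix v assume "v \<in> {v. ?C v \<in> ?F}"
    then obtain s t where st: "?C v = of_real s * w1 + of_real t * w2" "0 \<le> s" "s < 1" "0 \<le> t" "t < 1"
      by (auto simp: fundamental_parallelogram_def)
    have "v = T (vector [s, t])"
      using st(1) by (simp add: vec_eq_iff forall_2 T_def complex_eq_iff)
    then show "v \<in> T ` {v. ?C v \<in> Q}" using st by (auto simp: Q_def)
  qed
  define g where "g v = f (?C v)" for v
  \<comment> \<open>The change of variables is used for vector-valued functions, so \<open>g\<close>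
    is wrapped as a map into \<open>real^1\<close> and its only component is read off
    afterwards.\<close>
  define gv :: "real^2 \<Rightarrow> real^1" where "gv v = vec (g v)" for v
  have g: "g absolutely_integrable_on {v. ?C v \<in> ?F}"
    "(LINT z:?F|lborel. f z) = integral {v. ?C v \<in> ?F} g"
    using set_integral_complex_vec[OF f Fb] by (simp_all add: g_def[abs_def])
  have gv: "gv absolutely_integrable_on (T ` {v. ?C v \<in> Q})"
    unfolding img by (rule absolutely_integrable_componentwise) 
      (use g(1) in \<open>auto simp: gv_def Basis_vec_def inner_axis\<close>)
  then have gvT: "(gv \<circ> T) absolutely_integrable_on {v. ?C v \<in> Q}"
    using absolutely_integrable_on_linear_image[OF T, where f = gv and S = "{v. ?C v \<in> Q}"] det J by auto
  have "integral {v. ?C v \<in> ?F} g = integral (T ` {v. ?C v \<in> Q}) (\<lambda>v. gv v $ 1)"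
    unfolding img by (simp add: gv_def)
  also have "\<dots> = integral (T ` {v. ?C v \<in> Q}) gv $ 1"
    by (rule integral_component_eq_cart) (rule set_lebesgue_integral_eq_integral(1)[OF gv])
  also have "\<dots> = ?J * integral {v. ?C v \<in> Q} (gv \<circ> T) $ 1"
    using integral_change_of_variables_linear[OF T, where f = gv and S = "{v. ?C v \<in> Q}"] gv det J by simp
  also have "integral {v. ?C v \<in> Q} (gv \<circ> T) $ 1 = integral {v. ?C v \<in> Q} (\<lambda>v. (gv \<circ> T) v $ 1)"
    by (rule integral_component_eq_cart[symmetric]) (rule set_lebesgue_integral_eq_integral(1)[OF gvT])
  also have "\<dots> = integral {v. ?C v \<in> Q} (\<lambda>v. f (para 0 w1 w2 (Re (?C v)) (Im (?C v))))"
    by (simp add: gv_def g_def CT para_def)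
  also have "\<dots> = (LINT z:Q|lborel. f (para 0 w1 w2 (Re z) (Im z)))"
    by (rule set_integral_complex_vec(2)[OF _ Q, symmetric])
      (rule continuous_on_compose2[OF f], auto intro!: continuous_intros)
  also have "\<dots> = integral {(x, y). Complex x y \<in> Q} (\<lambda>(x, y). f (para 0 w1 w2 x y))"
    using set_integral_complex_prod(2)[OF _ Q, of "\<lambda>z. f (para 0 w1 w2 (Re z) (Im z))"]
    by (simp add: continuous_on_compose2[OF f] continuous_intros case_prod_unfold)
  also have "\<dots> = integral (cbox (0,0) (1,1)) (\<lambda>(x, y). f (para 0 w1 w2 x y))"
  proof (rule integral_spike_set)
    \<comment> \<open>The half-open square and the closed one differ only in points of the lines
      \<open>x = 1\<close> and \<open>y = 1\<close>.\<close>
    have n: "negligible ({p::real\<times>real. p \<bullet> (1,0) = 1} \<union> {p. p \<bullet> (0,1) = 1})"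
      by (intro negligible_Un negligible_standard_hyperplane) (auto simp: Basis_prod_def)
    show "negligible {p \<in> {(x, y). Complex x y \<in> Q} - cbox (0, 0) (1, 1). (case p of (x, y) \<Rightarrow> f (para 0 w1 w2 x y)) \<noteq> 0}"
      by (rule negligible_subset[OF n]) (auto simp: Q_def)
    show "negligible {p \<in> cbox (0, 0) (1, 1) - {(x, y). Complex x y \<in> Q}. (case p of (x, y) \<Rightarrow> f (para 0 w1 w2 x y)) \<noteq> 0}"
      by (rule negligible_subset[OF n]) (auto simp: Q_def)
  qed
  also have "\<dots> = integral {0..1} (\<lambda>s. integral {0..1} (\<lambda>t. f (para 0 w1 w2 s t)))"
    using integral_prod_continuous[of 0 0 1 1 "\<lambda>(x, y). f (para 0 w1 w2 x y)"]
    by (simp add: case_prod_unfold continuous_on_compose2[OF f] continuous_intros)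
  finally show ?thesis using g(2) by simp
qed

section \<open>Local analysis at poles\<close>

text \<open>With \<open>f = g * (z - q) powi n\<close> and \<open>g q \<noteq> 0\<close>, the
  logarithmic derivative splits into that of \<open>g\<close>, which is holomorphic near
  \<open>q\<close>, and \<open>n / (z - q)\<close>.\<close>

lemma log_deriv_singularity:
  assumes "isolated_singularity_at f q" "not_essential f q" "\<exists>\<^sub>F w in at q. f w \<noteq> 0"
  obtains r H where "r > 0" "H holomorphic_on ball q r"
    "\<And>z. z \<in> ball q r - {q} \<Longrightarrow> f z \<noteq> 0 \<and> deriv f z / f z = H z + of_int (zorder f q) / (z - q)"
proof -
  define n where "n = zorder f q"
  obtain g r where g: "r > 0" "g holomorphic_on cball q r" "g q \<noteq> 0"
    "\<And>w. w \<in> cball q r - {q} \<Longrightarrow> f w = g w * (w - q) powi n \<and> g w \<noteq> 0"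
    using zorder_exist[OF assms] unfolding n_def by blast
  have hol: "g holomorphic_on ball q r" using g(2) by (rule holomorphic_on_subset) auto
  have gne: "g w \<noteq> 0" if "w \<in> ball q r" for w using g(3) g(4)[of w] that by (cases "w = q") auto
  show ?thesis
  proof (rule that[of r "\<lambda>z. deriv g z / g z"])
    show "(\<lambda>z. deriv g z / g z) holomorphic_on ball q r"
      using hol gne by (intro holomorphic_intros) auto
    fix z assume z: "z \<in> ball q r - {q}"
    then have fz: "f z = g z * (z - q) powi n" "g z \<noteq> 0" using g(4)[of z] by auto
    have dg: "(g has_field_derivative deriv g z) (at z)"
      using z hol by (intro holomorphic_derivI[of _ "ball q r"]) auto
    have "((\<lambda>w. g w * (w - q) powi n) has_field_derivative
        deriv g z * (z - q) powi n + g z * (of_int n * (z - q) powi (n - 1))) (at z)"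
      using z by (auto intro!: derivative_eq_intros dg simp: algebra_simps)
    then have "(f has_field_derivative
        deriv g z * (z - q) powi n + g z * (of_int n * (z - q) powi (n - 1))) (at z)"
      by (rule has_field_derivative_transform_within_open[of _ _ _ "ball q r - {q}"])
        (use z g(4) in \<open>auto simp: open_delete\<close>)
    then have "deriv f z = deriv g z * (z - q) powi n + g z * (of_int n * (z - q) powi (n - 1))"
      by (rule DERIV_imp_deriv)
    then show "f z \<noteq> 0 \<and> deriv f z / f z = deriv g z / g z + of_int (zorder f q) / (z - q)"
      using z fz by (simp add: fz power_int_diff add_divide_distrib flip: n_def)
  qed (fact g(1))
qed

text \<open>The reciprocal is the coordinate of the Riemann sphere at infinity. Expressing
  \<open>f\<close> and \<open>deriv f\<close> through it makes the cancellations at a pole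
  explicit.\<close>

lemma pole_reciprocal:
  assumes "is_pole f q" "isolated_singularity_at f q"
  obtains r Q where "r > 0" "Q holomorphic_on ball q r" "Q q = 0"
    "\<And>z. z \<in> ball q r - {q} \<Longrightarrow> Q z \<noteq> 0 \<and> f z = inverse (Q z)
        \<and> deriv f z = - deriv Q z / (Q z)\<^sup>2"
proof -
  obtain r1 where r1: "r1 > 0" "f holomorphic_on ball q r1 - {q}"
    using assms(2) analytic_imp_holomorphic by (auto simp: isolated_singularity_at_def)
  have "eventually (\<lambda>z. f z \<noteq> 0) (at q)"
    using assms(1) non_zero_neighbour_pole by blast
  then obtain r2 where r2: "r2 > 0" "\<And>z. z \<in> ball q r2 - {q} \<Longrightarrow> f z \<noteq> 0"
    by (auto simp: eventually_at dist_commute)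
  define r where "r = min r1 r2"
  define Q where "Q z = (if z = q then 0 else inverse (f z))" for z
  have hol: "Q holomorphic_on ball q r"
    unfolding Q_def[abs_def]
    by (rule is_pole_inverse_holomorphic[OF _ _ assms(1)])
      (use r1 r2 in \<open>auto simp: r_def intro: holomorphic_on_subset\<close>)
  show ?thesis
  proof (rule that[OF _ hol])
    fix z assume z: "z \<in> ball q r - {q}"
    then have Qz: "Q z \<noteq> 0" "f z = inverse (Q z)" using r2 by (auto simp: Q_def r_def)
    have "(Q has_field_derivative deriv Q z) (at z)"
      using z hol by (intro holomorphic_derivI[of _ "ball q r"]) auto
    then have "((\<lambda>w. inverse (Q w)) has_field_derivative - deriv Q z / (Q z)\<^sup>2) (at z)"
      using Qz by (auto intro!: derivative_eq_intros simp: field_simps power2_eq_square)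
    then have "(f has_field_derivative - deriv Q z / (Q z)\<^sup>2) (at z)"
      by (rule has_field_derivative_transform_within_open[of _ _ _ "ball q r - {q}"])
        (use z in \<open>auto simp: open_delete Q_def\<close>)
    then show "Q z \<noteq> 0 \<and> f z = inverse (Q z) \<and> deriv f z = - deriv Q z / (Q z)\<^sup>2"
      using Qz by (auto intro: DERIV_imp_deriv)
  qed (use r1 r2 in \<open>auto simp: r_def Q_def\<close>)
qed

lemma analytic_atE:
  assumes "f analytic_on {q}"
  obtains r where "r > 0" "f holomorphic_on ball q r"
  using assms by (auto simp: analytic_on_def)

lemma continuous_ne_ball:
  fixes u :: "complex \<Rightarrow> complex"
  assumes "continuous_on (ball q r) u" "r > 0" "u q \<noteq> 0"
  obtains r' where "r' > 0" "r' \<le> r" "\<And>z. z \<in> ball q r' \<Longrightarrow> u z \<noteq> 0"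
proof -
  have "isCont u q" using assms by (simp add: continuous_on_eq_continuous_at)
  from continuous_at_avoid[OF this assms(3)] obtain e where "e > 0" "\<And>y. dist q y < e \<Longrightarrow> u y \<noteq> 0"
    by blast
  then show ?thesis using assms(2) by (intro that[of "min e r"]) auto
qed

text \<open>
  The curvature density of the surface is \<open>- 4 Re\<close> of the following function, which is the
  \<open>\<partial>/\<partial>z\<^sup>*\<close> derivative of \<open>\<phi>' / (\<phi> - \<psi>\<^sup>*)\<close>, where \<open>*\<close> denotes conjugation.
\<close>

definition gauss_density :: "(complex \<Rightarrow> complex) \<Rightarrow> (complex \<Rightarrow> complex) \<Rightarrow> complex \<Rightarrow> complex" where
  "gauss_density f g z = deriv f z * cnj (deriv g z) / (f z - cnj (g z))\<^sup>2"

definition gauss_primitive :: "(complex \<Rightarrow> complex) \<Rightarrow> (complex \<Rightarrow> complex) \<Rightarrow> complex \<Rightarrow> complex" where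
  "gauss_primitive f g z = deriv f z / (f z - cnj (g z))"

lemma gauss_primitive_regular:
  assumes f: "f analytic_on {q}" and g: "g analytic_on {q}" and ne: "f q \<noteq> cnj (g q)"
  obtains r where "r > 0" "f holomorphic_on ball q r" "g holomorphic_on ball q r"
    "\<And>z. z \<in> ball q r \<Longrightarrow> f z \<noteq> cnj (g z)"
    "wirtinger_on (ball q r) (gauss_primitive f g) (gauss_density f g)"
proof -
  obtain r1 r2 where r1: "r1 > 0" "f holomorphic_on ball q r1" and r2: "r2 > 0" "g holomorphic_on ball q r2"
    using f g by (auto elim!: analytic_atE)
  have "continuous_on (ball q (min r1 r2)) (\<lambda>z. f z - cnj (g z))"
    using r1 r2 by (intro continuous_intros holomorphic_on_imp_continuous_on) (auto intro: holomorphic_on_subset)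
  then obtain r where r: "r > 0" "r \<le> min r1 r2" "\<And>z. z \<in> ball q r \<Longrightarrow> f z - cnj (g z) \<noteq> 0"
    using r1 r2 ne by (auto elim!: continuous_ne_ball)
  have hf: "f holomorphic_on ball q r" and hg: "g holomorphic_on ball q r"
    using r r1 r2 by (auto intro: holomorphic_on_subset)
  \<comment> \<open>\<open>deriv f\<close> is holomorphic, so only the denominator contributes to
    the conjugate derivative. The second function is written in the raw shape produced by the
    product and inverse rules and is simplified afterwards.\<close>
  have "wirtinger_on (ball q r) (\<lambda>z. deriv f z * inverse (f z + - cnj (g z)))
    (\<lambda>z. deriv f z * (- (0 + (-1) * cnj (deriv g z)) / (f z + - cnj (g z))\<^sup>2) + 0 * inverse (f z + - cnj (g z)))"
  proof (intro wirtinger_on_mult wirtinger_on_inverse wirtinger_on_add)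
    show "wirtinger_on (ball q r) (deriv f) (\<lambda>_. 0)" "wirtinger_on (ball q r) f (\<lambda>_. 0)"
      using hf by (auto intro!: wirtinger_on_holomorphic holomorphic_deriv)
    have "wirtinger_on (ball q r) (\<lambda>z. (-1) * cnj (g z)) (\<lambda>z. (-1) * cnj (deriv g z) + 0 * cnj (g z))"
      by (intro wirtinger_on_mult wirtinger_on_cnj_holomorphic wirtinger_on_holomorphic hg) auto
    then show "wirtinger_on (ball q r) (\<lambda>z. - cnj (g z)) (\<lambda>z. (-1) * cnj (deriv g z))"
      by simp
  qed (use r in auto)
  then have "wirtinger_on (ball q r) (gauss_primitive f g) (gauss_density f g)"
    by (rule wirtinger_on_cong) (auto simp: gauss_primitive_def gauss_density_def field_simps)
  then show ?thesis using that r hf hg by auto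
qed

text \<open>With \<open>Q = 1 / f\<close> the primitive becomes
  \<open>- Q' / (Q * (1 - Q * cnj g))\<close>, which splits into \<open>f' / f\<close> and
  \<open>- Q' * cnj g / (1 - Q * cnj g)\<close>. The first has residue \<open>zorder f q\<close>;
  the second is smooth at \<open>q\<close> because \<open>Q q = 0\<close>, and its conjugate
  derivative \<open>b\<close> extends the density over the pole.\<close>

lemma gauss_primitive_pole1:
  assumes pole: "is_pole f q" "isolated_singularity_at f q" and g: "g analytic_on {q}"
  obtains r C b where "r > 0" "wirtinger_on (ball q r) C b"
    "\<And>z. z \<in> ball q r - {q} \<Longrightarrow> gauss_primitive f g z = C z + of_int (zorder f q) / (z - q)"
    "\<And>z. z \<in> ball q r - {q} \<Longrightarrow> gauss_density f g z = b z"
proof -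
  obtain r1 Q where Q: "r1 > 0" "Q holomorphic_on ball q r1" "Q q = 0"
    "\<And>z. z \<in> ball q r1 - {q} \<Longrightarrow> Q z \<noteq> 0 \<and> f z = inverse (Q z) \<and> deriv f z = - deriv Q z / (Q z)\<^sup>2"
    using pole_reciprocal[OF pole] by blast
  obtain r2 where r2: "r2 > 0" "g holomorphic_on ball q r2"
    using g by (auto elim!: analytic_atE)
  have "not_essential f q" "\<exists>\<^sub>F w in at q. f w \<noteq> 0"
    using pole(1) non_zero_neighbour_pole[of f q] by (auto intro: eventually_frequently)
  then obtain r3 H where H: "r3 > 0" "H holomorphic_on ball q r3"
    "\<And>z. z \<in> ball q r3 - {q} \<Longrightarrow> f z \<noteq> 0 \<and> deriv f z / f z = H z + of_int (zorder f q) / (z - q)"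
    using log_deriv_singularity[OF pole(2)] by metis
  define r4 where "r4 = min r1 (min r2 r3)"
  have "continuous_on (ball q r4) (\<lambda>z. 1 - Q z * cnj (g z))"
    using Q r2 by (intro continuous_intros holomorphic_on_imp_continuous_on)
      (auto intro: holomorphic_on_subset simp: r4_def)
  then obtain r where r: "r > 0" "r \<le> r4" "\<And>z. z \<in> ball q r \<Longrightarrow> 1 - Q z * cnj (g z) \<noteq> 0"
    using Q r2 H by (auto elim!: continuous_ne_ball simp: r4_def)
  have hol: "Q holomorphic_on ball q r" "g holomorphic_on ball q r" "H holomorphic_on ball q r"
    using r Q r2 H by (auto intro: holomorphic_on_subset simp: r4_def)
  let ?u = "\<lambda>z. 1 + - Q z * cnj (g z)"
  let ?C = "\<lambda>z. H z + - deriv Q z * (cnj (g z) * inverse (?u z))"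
  have "wirtinger_on (ball q r) ?C (\<lambda>z. 0 + (- deriv Q z * (cnj (g z) * (- (0 + (- Q z * cnj (deriv g z) + 0 * cnj (g z))) / (?u z)\<^sup>2)
      + cnj (deriv g z) * inverse (?u z)) + 0 * (cnj (g z) * inverse (?u z))))"
    by (intro wirtinger_on_add wirtinger_on_mult wirtinger_on_inverse wirtinger_on_cnj_holomorphic
         wirtinger_on_holomorphic holomorphic_intros hol)
      (use r in auto)
  then show ?thesis
  proof (rule that[OF r(1)])
    fix z assume z: "z \<in> ball q r - {q}"
    then have z1: "Q z \<noteq> 0" "f z = inverse (Q z)" "deriv f z = - deriv Q z / (Q z)\<^sup>2"
      "1 - Q z * cnj (g z) \<noteq> 0"
      using Q(4)[of z] r by (auto simp: r4_def)
    have d: "f z - cnj (g z) = (1 - Q z * cnj (g z)) / Q z"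
      using z1 by (simp add: field_simps)
    have "gauss_primitive f g z = - deriv Q z / (Q z * (1 - Q z * cnj (g z)))"
      unfolding gauss_primitive_def d z1(3) using z1 by (simp add: power2_eq_square)
    also have "\<dots> = - deriv Q z / Q z - deriv Q z * cnj (g z) / (1 - Q z * cnj (g z))"
      using z1(1,4) by (simp add: divide_simps) (simp add: algebra_simps)
    also have "- deriv Q z / Q z = deriv f z / f z"
      using z1 by (simp add: power2_eq_square)
    also have "\<dots> = H z + of_int (zorder f q) / (z - q)"
      using H(3)[of z] z r by (auto simp: r4_def)
    finally show "gauss_primitive f g z = ?C z + of_int (zorder f q) / (z - q)"
      by (simp add: divide_inverse mult_ac)
    have "gauss_density f g z = - deriv Q z * cnj (deriv g z) / (1 - Q z * cnj (g z))\<^sup>2"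
      unfolding gauss_density_def d z1(3) using z1(1) by (simp add: power_divide)
    also have "\<dots> = 0 + (- deriv Q z * (cnj (g z) * (- (0 + (- Q z * cnj (deriv g z) + 0 * cnj (g z))) / (?u z)\<^sup>2)
      + cnj (deriv g z) * inverse (?u z)) + 0 * (cnj (g z) * inverse (?u z)))"
    proof -
      define u where "u = ?u z"
      have u: "u \<noteq> 0" "1 - Q z * cnj (g z) = u" using z1(4) by (auto simp: u_def)
      have "Q z * (cnj (g z) * cnj (deriv g z)) + cnj (deriv g z) * u = cnj (deriv g z)"
        by (simp add: u_def algebra_simps)
      then have "cnj (deriv g z) / u\<^sup>2 = Q z * (cnj (g z) * cnj (deriv g z)) / u\<^sup>2 + cnj (deriv g z) / u"
        using u(1) by (simp add: divide_simps power2_eq_square)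
      then show ?thesis
        unfolding u(2) u_def[symmetric] by (simp add: divide_inverse mult_ac)
    qed
    finally show "gauss_density f g z = \<dots>" .
  qed
qed

text \<open>With \<open>R = 1 / g\<close> the primitive is
  \<open>f' * cnj R / (f * cnj R - 1)\<close>, smooth at \<open>q\<close> since
  \<open>R q = 0\<close>. So poles of the second function carry no residue, and only the degree of
  the first one will be counted.\<close>

lemma gauss_primitive_pole2:
  assumes pole: "is_pole g q" "isolated_singularity_at g q" and f: "f analytic_on {q}"
  obtains r C b where "r > 0" "wirtinger_on (ball q r) C b"
    "\<And>z. z \<in> ball q r - {q} \<Longrightarrow> gauss_primitive f g z = C z"
    "\<And>z. z \<in> ball q r - {q} \<Longrightarrow> gauss_density f g z = b z"
proof -
  obtain r1 R where R: "r1 > 0" "R holomorphic_on ball q r1" "R q = 0"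
    "\<And>z. z \<in> ball q r1 - {q} \<Longrightarrow> R z \<noteq> 0 \<and> g z = inverse (R z) \<and> deriv g z = - deriv R z / (R z)\<^sup>2"
    using pole_reciprocal[OF pole] by blast
  obtain r2 where r2: "r2 > 0" "f holomorphic_on ball q r2"
    using f by (auto elim!: analytic_atE)
  define r4 where "r4 = min r1 r2"
  have "continuous_on (ball q r4) (\<lambda>z. f z * cnj (R z) - 1)"
    using R r2 by (intro continuous_intros holomorphic_on_imp_continuous_on)
      (auto intro: holomorphic_on_subset simp: r4_def)
  then obtain r where r: "r > 0" "r \<le> r4" "\<And>z. z \<in> ball q r \<Longrightarrow> f z * cnj (R z) - 1 \<noteq> 0"
    using R r2 by (auto elim!: continuous_ne_ball simp: r4_def)
  have hol: "R holomorphic_on ball q r" "f holomorphic_on ball q r"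
    using r R r2 by (auto intro: holomorphic_on_subset simp: r4_def)
  let ?u = "\<lambda>z. f z * cnj (R z) + - 1"
  let ?C = "\<lambda>z. deriv f z * (cnj (R z) * inverse (?u z))"
  let ?b = "\<lambda>z. deriv f z * (cnj (R z) * (- ((f z * cnj (deriv R z) + 0 * cnj (R z)) + 0) / (?u z)\<^sup>2)
      + cnj (deriv R z) * inverse (?u z)) + 0 * (cnj (R z) * inverse (?u z))"
  have "wirtinger_on (ball q r) ?C ?b"
    by (intro wirtinger_on_add wirtinger_on_mult wirtinger_on_inverse wirtinger_on_cnj_holomorphic
         wirtinger_on_holomorphic holomorphic_intros hol)
      (use r in auto)
  then show ?thesis
  proof (rule that[OF r(1)])
    fix z assume z: "z \<in> ball q r - {q}"
    then have z1: "R z \<noteq> 0" "g z = inverse (R z)" "deriv g z = - deriv R z / (R z)\<^sup>2"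
      "f z * cnj (R z) - 1 \<noteq> 0"
      using R(4)[of z] r by (auto simp: r4_def)
    have d: "f z - cnj (g z) = (f z * cnj (R z) - 1) / cnj (R z)"
      using z1(1) unfolding z1(2) by (simp add: field_simps)
    show "gauss_primitive f g z = ?C z"
      unfolding gauss_primitive_def d using z1 by (simp add: field_simps)
    have "gauss_density f g z = - deriv f z * cnj (deriv R z) / (f z * cnj (R z) - 1)\<^sup>2"
      unfolding gauss_density_def d z1(3) using z1(1) by (simp add: power_divide)
    also have "\<dots> = ?b z"
    proof -
      define u where "u = ?u z"
      have u: "u \<noteq> 0" "f z * cnj (R z) - 1 = u" using z1(4) by (auto simp: u_def)
      have "- (f z * (cnj (R z) * cnj (deriv R z))) + cnj (deriv R z) * u = - cnj (deriv R z)"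
        by (simp add: u_def algebra_simps)
      then have "- cnj (deriv R z) / u\<^sup>2 = - (f z * (cnj (R z) * cnj (deriv R z))) / u\<^sup>2 + cnj (deriv R z) / u"
        using u(1) by (simp add: divide_simps power2_eq_square)
      then have "deriv f z * (- cnj (deriv R z) / u\<^sup>2)
        = deriv f z * (- (f z * (cnj (R z) * cnj (deriv R z))) / u\<^sup>2 + cnj (deriv R z) / u)"
        by simp
      then show ?thesis
        unfolding u(2) u_def[symmetric] by (simp add: divide_inverse mult_ac)
    qed
    finally show "gauss_density f g z = ?b z" .
  qed
qed

section \<open>Counting poles and zeros\<close>

lemma sparse_poles: "f meromorphic_on UNIV \<Longrightarrow> {z. is_pole f z} sparse_in UNIV"
  using meromorphic_on_imp_not_pole_cosparse[of f UNIV] by (simp add: eventually_cosparse)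

lemma deriv_periodic:
  fixes f :: "complex \<Rightarrow> complex"
  assumes "\<And>z. f (z + w) = f z"
  shows "deriv f (z + w) = deriv f z"
  using assms by (simp add: deriv_def DERIV_shift)

lemma is_pole_periodic:
  fixes f :: "complex \<Rightarrow> complex"
  assumes "\<And>z. f (z + w) = f z"
  shows "is_pole f (z + w) \<longleftrightarrow> is_pole f z"
  using is_pole_shift_iff[of f w z] assms by (simp add: o_def add_ac)

lemma zorder_periodic:
  assumes "\<And>z. f (z + w) = f z"
  shows "zorder f (z + w) = zorder f z"
proof -
  have "zorder f (z + w) = zorder (\<lambda>u. f (u + z + w)) 0"
    by (subst zorder_shift) (simp add: add_ac)
  also have "\<dots> = zorder f z"
    by (subst (2) zorder_shift) (simp add: assms)
  finally show ?thesis .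
qed

lemma remove_sings_periodic:
  assumes "\<And>z. f (z + w) = f z"
  shows "remove_sings f (z + w) = remove_sings f z"
proof -
  have "filtermap (\<lambda>x. x + w) (at z) = at (z + w)"
    by (simp add: filtermap_at_shift[of "-w" z, simplified])
  from remove_sings_compose[OF this, of f] show ?thesis using assms by (simp add: o_def)
qed

lemma remove_sings_eq_continuous:
  assumes "continuous_on (ball q r) b" "\<And>z. z \<in> ball q r - {q} \<Longrightarrow> f z = b z" "z \<in> ball q r"
  shows "remove_sings f z = b z"
proof (rule remove_sings_eqI)
  have "isCont b z" using assms by (simp add: continuous_on_eq_continuous_at)
  then have "b \<midarrow>z\<rightarrow> b z" by (simp add: isCont_def)
  moreover have "eventually (\<lambda>w. f w = b w) (at z)"
  proof -
    have "eventually (\<lambda>w. w \<in> ball q r - {q} - {z}) (at z)"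
    proof (cases "z = q")
      case True
      then show ?thesis using assms(3) eventually_at_in_open[of "ball q r" z] by auto
    next
      case False
      then show ?thesis using assms(3) eventually_at_in_open[of "ball q r - {q}" z] by (auto simp: open_delete)
    qed
    then show ?thesis by eventually_elim (use assms in auto)
  qed
  ultimately show "f \<midarrow>z\<rightarrow> b z" by (subst filterlim_cong) auto
qed

text \<open>\<open>remove_sings\<close> supplies the values of the density at poles, where
  \<open>deriv\<close> and the function values say nothing. The three cases are exhaustive because
  \<open>gauss_maps_distinct_at\<close> forbids a common pole.\<close>

lemma gauss_primitive_local:
  assumes f: "f nicely_meromorphic_on UNIV" and g: "g nicely_meromorphic_on UNIV"
    and ne: "gauss_maps_distinct_at f g q"
  defines "b \<equiv> remove_sings (gauss_density f g)"
  shows "\<exists>r>0. \<exists>C. wirtinger_on (ball q r) C b \<and> (\<forall>z\<in>ball q r - {q}. gauss_primitive f g z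
      = C z + of_int (if is_pole f q then zorder f q else 0) / (z - q))" (is ?sing)
    and "\<not> is_pole f q \<Longrightarrow> \<not> is_pole g q \<Longrightarrow> b q = gauss_density f g q \<and>
           (\<exists>r>0. wirtinger_on (ball q r) (gauss_primitive f g) b)"
proof -
  have iso: "isolated_singularity_at f q" "isolated_singularity_at g q"
    using f g by (auto simp: nicely_meromorphic_on_def meromorphic_on_altdef)
  have an: "\<not> is_pole f q \<Longrightarrow> f analytic_on {q}" "\<not> is_pole g q \<Longrightarrow> g analytic_on {q}"
    using f g nicely_meromorphic_on_imp_analytic_at by auto
  have *: "wirtinger_on (ball q r) C b"
    if "wirtinger_on (ball q r) C b'" "\<And>z. z \<in> ball q r - {q} \<Longrightarrow> gauss_density f g z = b' z" for r C b'
    using that(1)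
  proof (rule wirtinger_on_cong)
    fix z assume "z \<in> ball q r"
    with remove_sings_eq_continuous[OF wirtinger_on_continuous_dbar[OF that(1)] that(2)]
    show "b' z = b z" by (simp add: b_def)
  qed auto
  have reg: "b q = gauss_density f g q \<and> (\<exists>r>0. wirtinger_on (ball q r) (gauss_primitive f g) b)"
    if np: "\<not> is_pole f q" "\<not> is_pole g q"
  proof -
    have "f q \<noteq> cnj (g q)" using ne np by (auto simp: gauss_maps_distinct_at_def)
    from gauss_primitive_regular[OF an(1)[OF np(1)] an(2)[OF np(2)] this]
    obtain r where r: "r > 0" "wirtinger_on (ball q r) (gauss_primitive f g) (gauss_density f g)"
      by metis
    have "b q = gauss_density f g q" unfolding b_def
      by (rule remove_sings_eq_continuous[OF wirtinger_on_continuous_dbar[OF r(2)]]) (use r in auto)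
    with *[OF r(2)] r(1) show ?thesis by auto
  qed
  then show "\<not> is_pole f q \<Longrightarrow> \<not> is_pole g q \<Longrightarrow> b q = gauss_density f g q \<and>
           (\<exists>r>0. wirtinger_on (ball q r) (gauss_primitive f g) b)" by blast
  consider "is_pole f q" "\<not> is_pole g q" | "\<not> is_pole f q" "is_pole g q" | "\<not> is_pole f q" "\<not> is_pole g q"
    using ne by (auto simp: gauss_maps_distinct_at_def)
  then show ?sing
  proof cases
    case 1
    from gauss_primitive_pole1[OF 1(1) iso(1) an(2)[OF 1(2)]] obtain r C b' where
      r: "r > 0" "wirtinger_on (ball q r) C b'"
      "\<And>z. z \<in> ball q r - {q} \<Longrightarrow> gauss_primitive f g z = C z + of_int (zorder f q) / (z - q)"
      "\<And>z. z \<in> ball q r - {q} \<Longrightarrow> gauss_density f g z = b' z" by metis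
    show ?thesis
      by (rule exI[of _ r], intro conjI r(1), rule exI[of _ C], intro conjI *[OF r(2)])
        (use r(3,4) 1 in auto)
  next
    case 2
    from gauss_primitive_pole2[OF 2(2) iso(2) an(1)[OF 2(1)]] obtain r C b' where
      r: "r > 0" "wirtinger_on (ball q r) C b'"
      "\<And>z. z \<in> ball q r - {q} \<Longrightarrow> gauss_primitive f g z = C z"
      "\<And>z. z \<in> ball q r - {q} \<Longrightarrow> gauss_density f g z = b' z" by metis
    show ?thesis
      by (rule exI[of _ r], intro conjI r(1), rule exI[of _ C], intro conjI *[OF r(2)])
        (use r(3,4) 2 in auto)
  next
    case 3
    then show ?thesis using reg[OF 3] by auto
  qed
qed

lemma continuous_on_gauss_density:
  assumes f: "f nicely_meromorphic_on UNIV" and g: "g nicely_meromorphic_on UNIV"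
    and ne: "\<And>z. gauss_maps_distinct_at f g z"
  shows "continuous_on UNIV (remove_sings (gauss_density f g))"
proof -
  let ?b = "remove_sings (gauss_density f g)"
  have "isCont ?b q" for q
  proof -
    obtain r C where "r > 0" "wirtinger_on (ball q r) C ?b"
      using gauss_primitive_local(1)[OF f g ne] by blast
    then show ?thesis
      using wirtinger_on_continuous_dbar[of "ball q r" C ?b] by (simp add: continuous_on_eq_continuous_at)
  qed
  then show ?thesis by (auto intro: continuous_at_imp_continuous_on)
qed

text \<open>Each point of \<open>S\<close> rules out at most two values of each coordinate of the
  corner, and an interval is uncountable. The entire lines through the sides avoid \<open>S\<close>.
  Keeping the coordinates in \<open>{0..1}\<close> makes \<open>integral_shift_periodic\<close>
  applicable.\<close>

lemma exists_base_point:
  assumes J: "Im (cnj w1 * w2) > 0" and S: "countable S"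
  obtains \<alpha> \<beta> where "\<alpha> \<in> {0..1}" "\<beta> \<in> {0..1}"
    "\<And>s t. para (of_real \<alpha> * w1 + of_real \<beta> * w2) w1 w2 s t \<in> S \<Longrightarrow> s \<notin> {0, 1} \<and> t \<notin> {0, 1}"
proof -
  let ?J = "Im (cnj w1 * w2)"
  have ex: "\<exists>\<alpha>\<in>{0..1}. \<forall>q\<in>S. \<forall>k\<in>{0,1}. \<alpha> + k \<noteq> \<sigma> q" for \<sigma> :: "complex \<Rightarrow> real"
  proof -
    have "countable (\<sigma> ` S \<union> (\<lambda>q. \<sigma> q - 1) ` S)" using S by auto
    moreover have "uncountable {0..1::real}" by (simp add: uncountable_closed_interval)
    ultimately obtain \<alpha> where "\<alpha> \<in> {0..1}" "\<alpha> \<notin> \<sigma> ` S \<union> (\<lambda>q. \<sigma> q - 1) ` S"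
      using countable_subset[of "{0..1::real}" "\<sigma> ` S \<union> (\<lambda>q. \<sigma> q - 1) ` S"] by blast
    then show ?thesis by (intro bexI[of _ \<alpha>]) (auto simp: image_iff eq_diff_eq)
  qed
  obtain \<alpha> where \<alpha>: "\<alpha> \<in> {0..1}" "\<forall>q\<in>S. \<forall>k\<in>{0,1}. \<alpha> + k \<noteq> - Im (cnj w2 * q) / ?J"
    using ex[of "\<lambda>q. - Im (cnj w2 * q) / ?J"] by blast
  obtain \<beta> where \<beta>: "\<beta> \<in> {0..1}" "\<forall>q\<in>S. \<forall>k\<in>{0,1}. \<beta> + k \<noteq> Im (cnj w1 * q) / ?J"
    using ex[of "\<lambda>q. Im (cnj w1 * q) / ?J"] by blast
  show ?thesis
  proof (rule that[OF \<alpha>(1) \<beta>(1)])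
    fix s t assume *: "para (of_real \<alpha> * w1 + of_real \<beta> * w2) w1 w2 s t \<in> S" (is "?q \<in> S")
    have "- Im (cnj w2 * ?q) = (\<alpha> + s) * ?J" "Im (cnj w1 * ?q) = (\<beta> + t) * ?J"
      by (simp_all add: para_def algebra_simps)
    then have "- Im (cnj w2 * ?q) / ?J = \<alpha> + s" "Im (cnj w1 * ?q) / ?J = \<beta> + t"
      using J by (simp_all del: times_complex.simps)
    then show "s \<notin> {0, 1} \<and> t \<notin> {0, 1}"
      using \<alpha>(2) \<beta>(2) * by metis
  qed
qed

text \<open>Positive orientation of the basis makes the boundary of the parallelogram run
  counterclockwise. The opposite orientation is reduced to this one by exchanging \<open>w1\<close>
  and \<open>w2\<close>.\<close>

locale torus =
  fixes w1 w2 :: complex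
  assumes J: "Im (cnj w1 * w2) > 0"
begin

text \<open>The right side is \<open>pi\<close> times the number of poles of \<open>f\<close> with
  multiplicity, that is, its degree. \<open>torus_residue\<close> is applied to
  \<open>gauss_primitive f g\<close> on a parallelogram whose sides avoid all poles; by periodicity
  the density has the same integral over the parallelogram with corner 0.\<close>

lemma gauss_density_integral:
  assumes f: "f nicely_meromorphic_on UNIV" and g: "g nicely_meromorphic_on UNIV"
    and perf: "\<And>z. f (z + w1) = f z" "\<And>z. f (z + w2) = f z"
    and perg: "\<And>z. g (z + w1) = g z" "\<And>z. g (z + w2) = g z"
    and ne: "\<And>z. gauss_maps_distinct_at f g z"
    and \<alpha>: "\<alpha> \<in> {0..1}" "\<beta> \<in> {0..1}"
    and bd: "\<And>s t. is_pole f (para (of_real \<alpha> * w1 + of_real \<beta> * w2) w1 w2 s t)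
                \<or> is_pole g (para (of_real \<alpha> * w1 + of_real \<beta> * w2) w1 w2 s t) \<Longrightarrow> s \<notin> {0, 1} \<and> t \<notin> {0, 1}"
  defines "p \<equiv> of_real \<alpha> * w1 + of_real \<beta> * w2"
  shows "(LINT z:fundamental_parallelogram w1 w2|lborel. Re (remove_sings (gauss_density f g) z))
    = - pi * real_of_int (\<Sum>q | is_pole f q \<and> q \<in> closed_para p w1 w2. zorder f q)"
proof -
  define b where "b = remove_sings (gauss_density f g)"
  define S where "S = {z. is_pole f z} \<union> {z. is_pole g z}"
  have S: "S sparse_in UNIV"
    unfolding S_def using f g by (intro sparse_in_union' sparse_poles) (auto simp: nicely_meromorphic_on_def)
  have perA: "gauss_primitive f g (z + w) = gauss_primitive f g z"
      "gauss_density f g (z + w) = gauss_density f g z" if "w \<in> {w1, w2}" for z w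
    using that deriv_periodic[of f w1] deriv_periodic[of f w2] deriv_periodic[of g w1] deriv_periodic[of g w2] perf perg
    by (auto simp: gauss_primitive_def gauss_density_def)
  have perb: "b (z + w) = b z" if "w \<in> {w1, w2}" for z w
    unfolding b_def by (rule remove_sings_periodic) (rule perA(2)[OF that])
  note loc = gauss_primitive_local[OF f g ne, folded b_def]
  define \<rho> where "\<rho> q = complex_of_int (if is_pole f q then zorder f q else 0)" for q
  have cb: "continuous_on UNIV b"
    unfolding b_def by (rule continuous_on_gauss_density[OF f g ne])
  have "of_real (Im (cnj w1 * w2)) * integral {0..1} (\<lambda>s. integral {0..1} (\<lambda>t. b (para p w1 w2 s t)))
    = - (pi * (\<Sum>q\<in>S \<inter> closed_para p w1 w2. \<rho> q))"
  proof (rule torus_residue[OF J S, where A = "gauss_primitive f g"])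
    show "\<exists>r>0. \<exists>C. wirtinger_on (ball q r) C b \<and>
             (\<forall>z\<in>ball q r - {q}. gauss_primitive f g z = C z + \<rho> q / (z - q))" for q
      using loc(1) unfolding \<rho>_def .
    show "\<exists>r>0. wirtinger_on (ball q r) (gauss_primitive f g) b" if "q \<notin> S" for q
      using loc(2) that by (auto simp: S_def)
    show "s \<notin> {0, 1} \<and> t \<notin> {0, 1}" if "para p w1 w2 s t \<in> S" for s t
      using bd that unfolding S_def p_def by blast
  qed (use perA in auto)
  \<comment> \<open>Points where only \<open>g\<close> has a pole have \<open>\<rho> q = 0\<close>
    and drop out of the sum.\<close>
  also have "(\<Sum>q\<in>S \<inter> closed_para p w1 w2. \<rho> q) = (\<Sum>q\<in>{q. is_pole f q \<and> q \<in> closed_para p w1 w2}. \<rho> q)"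
  proof (rule sum.mono_neutral_right)
    show "finite (S \<inter> closed_para p w1 w2)"
      using sparse_in_compact_finite[of S "closed_para p w1 w2"] S compact_closed_para sparse_in_subset
      by (metis inf_commute subset_UNIV)
  qed (auto simp: S_def \<rho>_def)
  also have "\<dots> = of_int (\<Sum>q | is_pole f q \<and> q \<in> closed_para p w1 w2. zorder f q)"
    by (simp add: \<rho>_def)
  finally have main: "of_real (Im (cnj w1 * w2)) * integral {0..1} (\<lambda>s. integral {0..1} (\<lambda>t. b (para p w1 w2 s t)))
    = - (complex_of_real pi * complex_of_int (\<Sum>q | is_pole f q \<and> q \<in> closed_para p w1 w2. zorder f q))" .
  have cZ: "continuous_on A (\<lambda>x. b (para a w1 w2 (u x) (v x)))"
    if "continuous_on A u" "continuous_on A v" for A :: "'x::topological_space set" and a u v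
    by (rule continuous_on_compose2[OF cb]) (auto intro!: continuous_intros that)
  have Re: "Re (integral {0..1} (\<lambda>s. integral {0..1} (\<lambda>t. b (para p w1 w2 s t))))
      = integral {0..1} (\<lambda>s. integral {0..1} (\<lambda>t. Re (b (para p w1 w2 s t))))"
  proof -
    have "continuous_on (cbox (0,0) (1,1)) (\<lambda>x. b (para p w1 w2 (fst x) (snd x)))"
      by (intro cZ continuous_intros)
    from integral_integrable_2dim[OF this]
    have "(\<lambda>s. integral {0..1} (\<lambda>t. b (para p w1 w2 s t))) integrable_on {0..1}" by simp
    from integral_linear[OF this bounded_linear_Re]
    have "Re (integral {0..1} (\<lambda>s. integral {0..1} (\<lambda>t. b (para p w1 w2 s t))))
      = integral {0..1} (\<lambda>s. Re (integral {0..1} (\<lambda>t. b (para p w1 w2 s t))))"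
      by (simp add: o_def)
    moreover have "Re (integral {0..1} (\<lambda>t. b (para p w1 w2 s t))) = integral {0..1} (\<lambda>t. Re (b (para p w1 w2 s t)))" for s
      using integral_linear[OF integrable_continuous_interval bounded_linear_Re, OF cZ, of 0 1 "\<lambda>_. s" "\<lambda>t. t" p]
      by (simp add: o_def)
    ultimately show ?thesis by simp
  qed
  have per: "b (para a w1 w2 (s + 1) t) = b (para a w1 w2 s t)" "b (para a w1 w2 s (t + 1)) = b (para a w1 w2 s t)"
    for a s t
    using perb[of w1 "para a w1 w2 s t"] perb[of w2 "para a w1 w2 s t"] by (auto simp: para_def algebra_simps)
  have "integral {0..1} (\<lambda>s. integral {0..1} (\<lambda>t. Re (b (para p w1 w2 s t))))
    = integral {0..1} (\<lambda>s. integral {0..1} (\<lambda>t. Re (b (para 0 w1 w2 (\<alpha> + s) (\<beta> + t)))))"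
    by (simp add: para_def p_def algebra_simps)
  also have "\<dots> = integral {0..1} (\<lambda>s. integral {0..1} (\<lambda>t. Re (b (para 0 w1 w2 (\<alpha> + s) t))))"
    by (intro integral_cong integral_shift_periodic[where f = "\<lambda>t. Re (b (para 0 w1 w2 (\<alpha> + _) t))"])
      (use \<alpha> in \<open>auto simp: per intro!: cZ continuous_intros\<close>)
  also have "\<dots> = integral {0..1} (\<lambda>s. integral {0..1} (\<lambda>t. Re (b (para 0 w1 w2 s t))))"
  proof (rule integral_shift_periodic[where f = "\<lambda>s. integral {0..1} (\<lambda>t. Re (b (para 0 w1 w2 s t)))"])
    have "continuous_on (UNIV \<times> cbox 0 1) (\<lambda>(s, t). Re (b (para 0 w1 w2 s t)))"
      unfolding case_prod_unfold by (intro continuous_intros cZ)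
    from integral_continuous_on_param[OF this]
    show "continuous_on UNIV (\<lambda>s. integral {0..1} (\<lambda>t. Re (b (para 0 w1 w2 s t))))" by simp
  qed (use \<alpha> in \<open>auto simp: per\<close>)
  finally have shift: "integral {0..1} (\<lambda>s. integral {0..1} (\<lambda>t. Re (b (para p w1 w2 s t))))
     = integral {0..1} (\<lambda>s. integral {0..1} (\<lambda>t. Re (b (para 0 w1 w2 s t))))" .
  have "(LINT z:fundamental_parallelogram w1 w2|lborel. Re (b z))
     = Im (cnj w1 * w2) * integral {0..1} (\<lambda>s. integral {0..1} (\<lambda>t. Re (b (para 0 w1 w2 s t))))"
    by (rule set_integral_fundamental_parallelogram[OF J]) (intro continuous_intros cb)
  also have "\<dots> = Re (of_real (Im (cnj w1 * w2)) * integral {0..1} (\<lambda>s. integral {0..1} (\<lambda>t. b (para p w1 w2 s t))))"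
    unfolding Re_complex_of_real[symmetric] shift[symmetric] Re[symmetric] by (simp only: times_complex.simps) simp
  also have "\<dots> = - pi * real_of_int (\<Sum>q | is_pole f q \<and> q \<in> closed_para p w1 w2. zorder f q)"
    unfolding main by simp
  finally show ?thesis unfolding b_def .
qed

text \<open>This is \<open>torus_residue\<close> for the logarithmic derivative, holomorphic off
  \<open>S\<close>, with \<open>b = 0\<close>: the residues are the orders, so zeros and poles
  balance. \<open>S\<close> may contain further points, where the order is 0.\<close>

lemma sum_zorder_eq_0:
  assumes f: "f meromorphic_on UNIV" and per: "\<And>z. f (z + w1) = f z" "\<And>z. f (z + w2) = f z"
    and nz: "\<And>z. \<exists>\<^sub>F w in at z. f w \<noteq> 0"
    and S: "S sparse_in UNIV" "\<And>z. z \<notin> S \<Longrightarrow> f analytic_on {z} \<and> f z \<noteq> 0"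
    and bd: "\<And>s t. para p w1 w2 s t \<in> S \<Longrightarrow> s \<notin> {0, 1} \<and> t \<notin> {0, 1}"
  shows "(\<Sum>q\<in>S \<inter> closed_para p w1 w2. zorder f q) = 0"
proof -
  have "of_real (Im (cnj w1 * w2)) * integral {0..1} (\<lambda>s. integral {0..1} (\<lambda>t. (\<lambda>_. 0) (para p w1 w2 s t)))
    = - (pi * (\<Sum>q\<in>S \<inter> closed_para p w1 w2. complex_of_int (zorder f q)))"
  proof (rule torus_residue[OF J S(1), where A = "\<lambda>z. deriv f z / f z"])
    fix q
    have "isolated_singularity_at f q" "not_essential f q"
      using f by (auto simp: meromorphic_on_altdef)
    from log_deriv_singularity[OF this nz] obtain r H where r: "r > 0" "H holomorphic_on ball q r"
      "\<And>z. z \<in> ball q r - {q} \<Longrightarrow> f z \<noteq> 0 \<and> deriv f z / f z = H z + of_int (zorder f q) / (z - q)"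
      by metis
    then show "\<exists>r>0. \<exists>C. wirtinger_on (ball q r) C (\<lambda>_. 0) \<and>
             (\<forall>z\<in>ball q r - {q}. deriv f z / f z = C z + complex_of_int (zorder f q) / (z - q))"
      using wirtinger_on_holomorphic[OF r(2)] by blast
  next
    fix q assume "q \<notin> S"
    then have "f analytic_on {q}" "f q \<noteq> 0" using S by auto
    then obtain r1 where r1: "r1 > 0" "f holomorphic_on ball q r1" by (auto elim!: analytic_atE)
    then obtain r where r: "r > 0" "r \<le> r1" "\<And>z. z \<in> ball q r \<Longrightarrow> f z \<noteq> 0"
      using \<open>f q \<noteq> 0\<close> by (metis continuous_ne_ball holomorphic_on_imp_continuous_on)
    have "f holomorphic_on ball q r" using r1 r by (auto intro: holomorphic_on_subset)
    then have "(\<lambda>z. deriv f z / f z) holomorphic_on ball q r"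
      using r by (intro holomorphic_intros) auto
    then show "\<exists>r>0. wirtinger_on (ball q r) (\<lambda>z. deriv f z / f z) (\<lambda>_. 0)"
      using r(1) wirtinger_on_holomorphic by blast
  qed (use per bd in \<open>auto simp: deriv_periodic\<close>)
  then have "(\<Sum>q\<in>S \<inter> closed_para p w1 w2. complex_of_int (zorder f q)) = 0" by simp
  then show ?thesis by (simp flip: of_int_sum)
qed

end

section \<open>The curvature density\<close>

lemma pd_eqI: "(f has_derivative D) (at z) \<Longrightarrow> pd i f z = D (if i = 1 then 1 else \<i>)"
  unfolding pd_def using frechet_derivative_at by metis

lemma pd_cong:
  assumes "open U" "z \<in> U" "\<And>w. w \<in> U \<Longrightarrow> f w = g w"
  shows "pd i f z = pd i g z"
proof -
  have "(f has_derivative D) (at z) \<longleftrightarrow> (g has_derivative D) (at z)" for D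
    using has_derivative_transform_within_open[of f D z UNIV U g]
      has_derivative_transform_within_open[of g D z UNIV U f] assms by auto
  then show ?thesis by (simp add: pd_def frechet_derivative_def)
qed

lemma matrix_inv_scalar_2:
  fixes e :: real
  assumes "e \<noteq> 0"
  shows "matrix_inv (\<chi> i j. if i = j then e else 0 :: real^2^2) = (\<chi> i j. if i = j then 1 / e else 0)"
  (is "matrix_inv ?A = ?B")
proof -
  have AB: "?A ** ?B = mat 1" "?B ** ?A = mat 1"
    using assms by (auto simp: matrix_matrix_mult_def mat_def vec_eq_iff sum_2 forall_2)
  have "?A ** matrix_inv ?A = mat 1 \<and> matrix_inv ?A ** ?A = mat 1"
    unfolding matrix_inv_def by (rule someI[of _ ?B]) (use AB in blast)
  then have "matrix_inv ?A ** ?A = mat 1" by (rule conjunct2)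
  then have "matrix_inv ?A ** (?A ** ?B) = mat 1 ** ?B" by (subst matrix_mul_assoc) (rule arg_cong)
  then show ?thesis by (simp only: AB(1) matrix_mul_lid matrix_mul_rid)
qed

text \<open>The real part of the density is therefore symmetric in the two Gauss maps, which is why
  the one total curvature determines the degree of each of them.\<close>

lemma gauss_density_swap: "gauss_density g f z = cnj (gauss_density f g z)"
proof -
  have "(g z - cnj (f z))\<^sup>2 = (cnj (f z) - g z)\<^sup>2" by (simp add: power2_commute)
  then show ?thesis by (simp add: gauss_density_def mult.commute)
qed

lemma vector_4 [simp]:
  "(vector [x, y, z, w] :: 'a::zero ^ 4) $ 1 = x" "(vector [x, y, z, w] :: 'a::zero ^ 4) $ 2 = y"
  "(vector [x, y, z, w] :: 'a::zero ^ 4) $ 3 = z" "(vector [x, y, z, w] :: 'a::zero ^ 4) $ 4 = w"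
  unfolding vector_def by simp_all

text \<open>The coefficient vector is isotropic for the complex bilinear Lorentz form, so in the
  product of two real parts only the hermitian term survives, and the hermitian Lorentz square of
  the vector is \<open>2 * |a - cnj b|^2\<close>. With \<open>v\<close> and \<open>w\<close> ranging
  over \<open>1\<close> and \<open>\<i>\<close> this yields conformality and the conformal factor
  together.\<close>

lemma isotropic_first_form:
  fixes a b h v w :: complex
  defines "Y \<equiv> \<lambda>v. (\<chi> j. 2 * Re ((vector [a + b, - \<i> * (a - b), 1 - a * b, 1 + a * b] :: complex ^ 4) $ j * h * v)) :: real ^ 4"
  shows "lorentz (Y v) (Y w) = 4 * (cmod ((a - cnj b) * h))\<^sup>2 * Re (v * cnj w)"
proof -
  let ?c = "\<lambda>j. (vector [a + b, - \<i> * (a - b), 1 - a * b, 1 + a * b] :: complex ^ 4) $ j"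
  have RR: "2 * (Re (x * p) * Re (y * q)) = Re (x * y * (p * q)) + Re (x * cnj y * (p * cnj q))" for x y p q
    by (simp add: algebra_simps)
  have R: "2 * Re (x * p) * (2 * Re (x * q)) = 2 * Re (x\<^sup>2 * (p * q)) + 2 * (cmod x)\<^sup>2 * Re (p * cnj q)" for x p q
  proof -
    have "Re (x * cnj x * (p * cnj q)) = (cmod x)\<^sup>2 * Re (p * cnj q)"
      unfolding complex_norm_square[symmetric] by simp
    with RR[of x p x q] show ?thesis by (simp only: power2_eq_square)
  qed
  let ?p = "h * v" and ?q = "h * w"
  have "lorentz (Y v) (Y w) = 2 * Re (((?c 1)\<^sup>2 + (?c 2)\<^sup>2 + (?c 3)\<^sup>2 - (?c 4)\<^sup>2) * (?p * ?q))
    + 2 * ((cmod (?c 1))\<^sup>2 + (cmod (?c 2))\<^sup>2 + (cmod (?c 3))\<^sup>2 - (cmod (?c 4))\<^sup>2) * Re (?p * cnj ?q)"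
  proof -
    have *: "2 * Re (c1\<^sup>2 * s) + 2 * n1 * r + (2 * Re (c2\<^sup>2 * s) + 2 * n2 * r)
        + (2 * Re (c3\<^sup>2 * s) + 2 * n3 * r) - (2 * Re (c4\<^sup>2 * s) + 2 * n4 * r)
      = 2 * Re ((c1\<^sup>2 + c2\<^sup>2 + c3\<^sup>2 - c4\<^sup>2) * s) + 2 * (n1 + n2 + n3 - n4) * r"
      for c1 c2 c3 c4 s :: complex and n1 n2 n3 n4 r :: real
      unfolding ring_distribs plus_complex.sel minus_complex.sel by linarith
    show ?thesis
      unfolding lorentz_def Y_def vec_lambda_beta mult.assoc[of _ h] R by (rule *)
  qed
  also have "(?c 1)\<^sup>2 + (?c 2)\<^sup>2 + (?c 3)\<^sup>2 - (?c 4)\<^sup>2 = 0"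
    by (simp add: power2_eq_square algebra_simps)
  also have "(cmod (?c 1))\<^sup>2 + (cmod (?c 2))\<^sup>2 + (cmod (?c 3))\<^sup>2 - (cmod (?c 4))\<^sup>2 = 2 * (cmod (a - cnj b))\<^sup>2"
    by (simp add: norm_mult cmod_power2) (simp add: power2_eq_square algebra_simps)
  also have "Re (?p * cnj ?q) = (cmod h)\<^sup>2 * Re (v * cnj w)"
    by (simp add: cmod_power2) (simp add: power2_eq_square algebra_simps)
  finally show ?thesis by (simp add: norm_mult power_mult_distrib)
qed

text \<open>For a metric \<open>E * (du^2 + dv^2)\<close> the density is minus half the Laplacian of
  \<open>ln E\<close>. Here \<open>E = 4 * |\<phi> - cnj \<psi>|^2 * |h|^2\<close>, and
  \<open>ln |h|^2\<close> is harmonic, so \<open>h\<close> disappears from the result.\<close>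

lemma curvature_density:
  fixes X :: "complex \<Rightarrow> real ^ 4"
  assumes U: "open U" and hol: "\<phi> holomorphic_on U" "\<psi> holomorphic_on U" "h holomorphic_on U"
    and ne: "\<And>z. z \<in> U \<Longrightarrow> \<phi> z \<noteq> cnj (\<psi> z)" "\<And>z. z \<in> U \<Longrightarrow> h z \<noteq> 0"
    and X: "\<And>z. z \<in> U \<Longrightarrow> (X has_derivative (\<lambda>v. \<chi> j. 2 * Re ((vector [\<phi> z + \<psi> z,
        - \<i> * (\<phi> z - \<psi> z), 1 - \<phi> z * \<psi> z, 1 + \<phi> z * \<psi> z] :: complex ^ 4) $ j * h z * v))) (at z)"
    and z: "z \<in> U"
  shows "gauss_curvature X z * sqrt (det (first_form X z)) = - 4 * Re (gauss_density \<phi> \<psi> z)"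
proof -
  define \<omega> :: "2 \<Rightarrow> complex" where "\<omega> i = (if i = 1 then 1 else \<i>)" for i
  define N where "N z = (\<phi> z - cnj (\<psi> z)) * h z" for z
  define E where "E z = 4 * (cmod (N z))\<^sup>2" for z
  \<comment> \<open>The derivative of \<open>ln E\<close> with respect to \<open>z\<close>: the two
    primitives come from \<open>\<phi> - cnj \<psi>\<close> and from its conjugate.\<close>
  define A where "A z = gauss_primitive \<phi> \<psi> z + (gauss_primitive \<psi> \<phi> z + deriv h z / h z)" for z
  \<comment> \<open>\<open>G i\<close> is the \<open>i\<close>-th partial derivative of \<open>ln E / 2\<close>.\<close>
  define G where "G i z = Re (A z * \<omega> i)" for i z
  have Epos: "E w > 0" if "w \<in> U" for w using ne that by (simp add: E_def N_def)
  have ff: "first_form X w = (\<chi> i j. if i = j then E w else 0)" if w: "w \<in> U" for w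
    unfolding first_form_def pd_eqI[OF X[OF w]] isotropic_first_form
    by (auto simp: vec_eq_iff forall_2 E_def N_def)
  have dE: "(E has_derivative (\<lambda>v. 2 * E w * Re (A w * v))) (at w)" if w: "w \<in> U" for w
  proof -
    have d: "(f has_derivative (\<lambda>v. deriv f w * v)) (at w)" if "f holomorphic_on U" for f
      using holomorphic_derivI[OF that U w, of UNIV] by (simp add: has_field_derivative_def)
    note ds = hol[THEN d]
    have "(N has_derivative (\<lambda>v. (\<phi> w - cnj (\<psi> w)) * (deriv h w * v)
        + (deriv \<phi> w * v - cnj (deriv \<psi> w * v)) * h w)) (at w)" (is "(_ has_derivative ?dN) _")
      unfolding N_def[abs_def] by (intro derivative_intros ds)
    then have "((\<lambda>z. 4 * (N z \<bullet> N z)) has_derivative (\<lambda>v. 4 * (N w \<bullet> ?dN v + ?dN v \<bullet> N w))) (at w)"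
      by (intro derivative_intros)
    also have "(\<lambda>z. 4 * (N z \<bullet> N z)) = E" by (simp add: E_def[abs_def] power2_norm_eq_inner)
    also have "(\<lambda>v. 4 * (N w \<bullet> ?dN v + ?dN v \<bullet> N w)) = (\<lambda>v. 2 * E w * Re (A w * v))"
    proof
      fix v
      define D where "D = \<phi> w - cnj (\<psi> w)"
      have nz: "D \<noteq> 0" "h w \<noteq> 0" using ne w by (auto simp: D_def)
      have "4 * (N w \<bullet> ?dN v + ?dN v \<bullet> N w) = 8 * Re (cnj (N w) * ?dN v)"
        by (simp add: inner_complex_def algebra_simps)
      also have "cnj (N w) * ?dN v = of_real ((cmod (N w))\<^sup>2) * (deriv \<phi> w * v / D - cnj (deriv \<psi> w * v) / D + deriv h w * v / h w)"
      proof -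
        have "D * h w * (x / D - y / D + k / h w) = D * k + (x - y) * h w" for x y k
          using nz by (simp add: field_simps)
        then have "?dN v = N w * (deriv \<phi> w * v / D - cnj (deriv \<psi> w * v) / D + deriv h w * v / h w)"
          unfolding N_def D_def[symmetric] by (simp only:)
        then show ?thesis unfolding complex_norm_square by (simp only: mult_ac)
      qed
      also have "8 * Re \<dots> = 2 * E w * Re (deriv \<phi> w * v / D - cnj (deriv \<psi> w * v) / D + deriv h w * v / h w)"
        by (simp only: E_def Re_complex_of_real Im_complex_of_real times_complex.sel) simp
      also have "Re (deriv \<phi> w * v / D - cnj (deriv \<psi> w * v) / D + deriv h w * v / h w)
        = Re (deriv \<phi> w * v / D) - Re (cnj (deriv \<psi> w * v / cnj D)) + Re (deriv h w * v / h w)"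
        by simp
      also have "\<dots> = Re (deriv \<phi> w * v / D - deriv \<psi> w * v / cnj D + deriv h w * v / h w)"
        by (simp only: cnj.sel minus_complex.sel plus_complex.sel)
      also have "deriv \<phi> w * v / D - deriv \<psi> w * v / cnj D + deriv h w * v / h w = A w * v"
      proof -
        have "\<psi> w - cnj (\<phi> w) = - cnj D" by (simp add: D_def)
        then show ?thesis
          unfolding A_def gauss_primitive_def D_def[symmetric] by (simp add: ring_distribs mult.commute[of v])
      qed
      finally show "4 * (N w \<bullet> ?dN v + ?dN v \<bullet> N w) = 2 * E w * Re (A w * v)" .
    qed
    finally show ?thesis .
  qed
  \<comment> \<open>The Christoffel symbols of a conformal metric, in terms of the gradient
    \<open>G\<close> of \<open>ln E / 2\<close>.\<close>
  have chr: "christoffel X k i j w = (if j = k then G i w else 0) + (if i = k then G j w else 0)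
      - (if i = j then G k w else 0)" if w: "w \<in> U" for k i j w
  proof -
    have pdE: "pd i E w / (2 * E w) = G i w" for i
      using Epos[OF w] by (simp add: pd_eqI[OF dE[OF w]] G_def \<omega>_def)
    have "pd i (\<lambda>w. first_form X w $ j $ l) w = (if j = l then pd i E w else 0)" for i j l
    proof (cases "j = l")
      case True
      then show ?thesis using pd_cong[OF U w, of "\<lambda>w. first_form X w $ j $ l" E i] by (simp add: ff)
    next
      case False
      then have "pd i (\<lambda>w. first_form X w $ j $ l) w = pd i (\<lambda>_. 0) w"
        by (intro pd_cong[OF U w]) (simp add: ff)
      also have "\<dots> = 0" using pd_eqI[OF has_derivative_const, of i "0::real" w] by simp
      finally show ?thesis using False by simp
    qed
    then have "christoffel X k i j w = (1/2) * (1 / E w) *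
       ((if j = k then pd i E w else 0) + (if i = k then pd j E w else 0) - (if i = j then pd k E w else 0))"
      unfolding christoffel_def ff[OF w] matrix_inv_scalar_2[OF less_imp_neq[OF Epos[OF w], symmetric]]
      by (simp add: if_distrib[of "\<lambda>x. x * _"] cong: if_cong)
    also have "\<dots> = (if j = k then pd i E w / (2 * E w) else 0) + (if i = k then pd j E w / (2 * E w) else 0)
       - (if i = j then pd k E w / (2 * E w) else 0)"
      by (simp add: diff_divide_distrib add_divide_distrib)
    finally show ?thesis unfolding pdE .
  qed
  let ?F = "gauss_density \<phi> \<psi> z"
  have an: "\<phi> analytic_on {z}" "\<psi> analytic_on {z}"
    using hol U z by (auto simp: analytic_at)
  obtain r1 where r1: "r1 > 0" "wirtinger_on (ball z r1) (gauss_primitive \<phi> \<psi>) (gauss_density \<phi> \<psi>)"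
    using gauss_primitive_regular[OF an] ne z by metis
  have "\<psi> z \<noteq> cnj (\<phi> z)" using ne z by (metis complex_cnj_cnj)
  then obtain r2 where r2: "r2 > 0" "wirtinger_on (ball z r2) (gauss_primitive \<psi> \<phi>) (gauss_density \<psi> \<phi>)"
    using gauss_primitive_regular[OF an(2,1)] by metis
  define V where "V = U \<inter> ball z (min r1 r2)"
  have V: "open V" "z \<in> V" using U z r1 r2 by (auto simp: V_def)
  have "wirtinger_on V A (\<lambda>w. gauss_density \<phi> \<psi> w + (gauss_density \<psi> \<phi> w + 0))"
    unfolding A_def[abs_def] using V hol ne
    by (intro wirtinger_on_add wirtinger_on_subset[OF r1(2)] wirtinger_on_subset[OF r2(2)]
        wirtinger_on_holomorphic holomorphic_intros) (auto simp: V_def intro: holomorphic_on_subset)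
  then obtain a where a: "(A has_derivative (\<lambda>v. a z * v + (?F + (gauss_density \<psi> \<phi> z + 0)) * cnj v)) (at z)"
    using V unfolding wirtinger_on_def by blast
  \<comment> \<open>The conjugate derivative of \<open>A\<close> is real, being the sum of the
    density and its conjugate; \<open>h\<close> contributes 0.\<close>
  define \<beta> where "\<beta> = 2 * Re ?F"
  have "?F + (gauss_density \<psi> \<phi> z + 0) = of_real \<beta>"
    by (subst (2) gauss_density_swap) (simp add: complex_add_cnj \<beta>_def)
  with a have dA: "(A has_derivative (\<lambda>v. a z * v + of_real \<beta> * cnj v)) (at z)" by simp
  have pdG: "pd i (G j) z = Re ((a z * \<omega> i + of_real \<beta> * cnj (\<omega> i)) * \<omega> j)" for i j
  proof -
    have "((\<lambda>z. Re (A z * \<omega> j)) has_derivative (\<lambda>v. Re ((a z * v + of_real \<beta> * cnj v) * \<omega> j))) (at z)"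
      by (intro derivative_intros dA)
    from pd_eqI[OF this, of i] show ?thesis by (simp add: G_def[abs_def] \<omega>_def)
  qed
  have pdchr: "pd i (christoffel X 1 2 2) z = - pd i (G 1) z" "pd i (christoffel X 1 1 2) z = pd i (G 2) z" for i
  proof -
    have "pd i (christoffel X 1 2 2) z = pd i (\<lambda>w. - G 1 w) z"
      by (rule pd_cong[OF U z]) (simp add: chr)
    also have "((\<lambda>z. - Re (A z * \<omega> 1)) has_derivative (\<lambda>v. - Re ((a z * v + of_real \<beta> * cnj v) * \<omega> 1))) (at z)"
      by (intro derivative_intros dA)
    then have "pd i (\<lambda>w. - G 1 w) z = - pd i (G 1) z"
      unfolding pdG by (subst pd_eqI[of "\<lambda>w. - G 1 w"]) (auto simp: G_def \<omega>_def)
    finally show "pd i (christoffel X 1 2 2) z = - pd i (G 1) z" .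
    show "pd i (christoffel X 1 1 2) z = pd i (G 2) z"
      by (rule pd_cong[OF U z]) (simp add: chr)
  qed
  \<comment> \<open>In this component the products of Christoffel symbols cancel, leaving minus the
    divergence of \<open>G\<close>.\<close>
  have "riemann X 1 1 2 2 z = - pd 1 (G 1) z - pd 2 (G 2) z"
    unfolding riemann_def pdchr by (simp add: sum_2 chr[OF z])
  \<comment> \<open>The terms with \<open>a z\<close> cancel because \<open>1 + \<i>^2 = 0\<close>,
    and each of the two directions contributes \<open>- \<beta>\<close>.\<close>
  also have "\<dots> = - 4 * Re ?F"
    unfolding pdG by (simp add: \<omega>_def \<beta>_def)
  finally have R: "riemann X 1 1 2 2 z = - 4 * Re ?F" .
  have det: "det (first_form X z) = E z * E z"
    by (simp add: ff[OF z] det_2)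
  have "gauss_curvature X z = E z * riemann X 1 1 2 2 z / (E z * E z)"
    unfolding gauss_curvature_def det by (simp add: ff[OF z] sum_2)
  then show ?thesis
    using Epos[OF z] unfolding det R by simp
qed

text \<open>On a ball each form has a primitive \<open>G\<close>, and the component of
  \<open>X\<close> differs from \<open>2 * Re G\<close> by a constant, as the representation along
  straight segments shows. \<open>remove_sings\<close> changes nothing here, the coefficients being
  holomorphic.\<close>

lemma surface_has_derivative:
  fixes X :: "complex \<Rightarrow> real ^ 4"
  assumes rep: "weierstrass_represents M \<phi> \<psi> h X" and U: "ball q r \<subseteq> M"
    and hol: "\<phi> holomorphic_on ball q r" "\<psi> holomorphic_on ball q r" "h holomorphic_on ball q r"
    and z: "z \<in> ball q r"
  shows "(X has_derivative (\<lambda>v. \<chi> j. 2 * Re ((vector [\<phi> z + \<psi> z,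
        - \<i> * (\<phi> z - \<psi> z), 1 - \<phi> z * \<psi> z, 1 + \<phi> z * \<psi> z] :: complex ^ 4) $ j * h z * v))) (at z)"
proof -
  define g where "g j z = (vector [\<phi> z + \<psi> z,
        - \<i> * (\<phi> z - \<psi> z), 1 - \<phi> z * \<psi> z, 1 + \<phi> z * \<psi> z] :: complex ^ 4) $ j * h z" for j z
  have holg: "g j holomorphic_on ball q r" for j
    using exhaust_4[of j] by (auto simp: g_def[abs_def] intro!: holomorphic_intros hol)
  have W: "weierstrass_form \<phi> \<psi> h j w = g j w" if "w \<in> ball q r" for j w
  proof -
    have "g j analytic_on {w}" using holg that by (auto simp: analytic_at)
    then show ?thesis unfolding weierstrass_form_def g_def[abs_def] by (rule remove_sings_at_analytic)
  qed
  have comp: "((\<lambda>w. X w $ j) has_derivative (\<lambda>v. 2 * Re (g j z * v))) (at z)" for j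
  proof -
    obtain G where G: "\<And>w. w \<in> ball q r \<Longrightarrow> (G has_field_derivative g j w) (at w within ball q r)"
      using holomorphic_convex_primitive[OF convex_ball finite.emptyI holomorphic_on_imp_continuous_on[OF holg]] holg
      by (metis Diff_empty holomorphic_on_imp_differentiable_at interior_open open_ball)
    have XG: "X w $ j = X z $ j + 2 * Re (G w - G z)" if w: "w \<in> ball q r" for w
    proof -
      have seg: "closed_segment z w \<subseteq> ball q r" using z w by (simp add: closed_segment_subset)
      have "(g j has_contour_integral (G w - G z)) (linepath z w)"
        using contour_integral_primitive[of "ball q r" G "g j" "linepath z w"] G seg by simp
      then have "(weierstrass_form \<phi> \<psi> h j has_contour_integral (G w - G z)) (linepath z w)"
        by (rule has_contour_integral_eq) (use W seg in auto)
      then have "contour_integral (linepath z w) (weierstrass_form \<phi> \<psi> h j) = G w - G z"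
        by (rule contour_integral_unique)
      moreover have "valid_path (linepath z w)" "path_image (linepath z w) \<subseteq> M" using seg U by auto
      ultimately have "X (pathfinish (linepath z w)) $ j - X (pathstart (linepath z w)) $ j = 2 * Re (G w - G z)"
        using rep unfolding weierstrass_represents_def by metis
      then show ?thesis by simp
    qed
    have "(G has_derivative (\<lambda>v. g j z * v)) (at z)"
      using G[OF z] unfolding at_within_open[OF z open_ball] has_field_derivative_def .
    then have "((\<lambda>w. X z $ j + 2 * Re (G w - G z)) has_derivative (\<lambda>v. 2 * Re (g j z * v))) (at z)"
      by (intro derivative_eq_intros) (auto simp: fun_eq_iff)
    then show ?thesis
      by (rule has_derivative_transform_within_open[OF _ open_ball z]) (rule XG[symmetric])
  qed
  show ?thesis
    unfolding has_derivative_componentwise_within[of X] Basis_vec_def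
    using comp by (auto simp: inner_axis g_def)
qed

lemma total_curvature_eq:
  assumes M: "open M" "countable (- M)" and data: "weierstrass_data L M \<phi> \<psi> h"
    and alg: "algebraic_data \<phi> \<psi> h"
    and rep: "weierstrass_represents M \<phi> \<psi> h X"
    and F: "fundamental_parallelogram w1 w2 \<in> sets borel"
    and tc: "total_curvature w1 w2 M X \<noteq> 0"
    and cont: "continuous_on UNIV (remove_sings (gauss_density \<phi> \<psi>))"
  shows "total_curvature w1 w2 M X
    = - 4 * (LINT z:fundamental_parallelogram w1 w2|lborel. Re (remove_sings (gauss_density \<phi> \<psi>) z))"
proof -
  let ?b = "remove_sings (gauss_density \<phi> \<psi>)" and ?K = "\<lambda>z. gauss_curvature X z * sqrt (det (first_form X z))"
  let ?F = "fundamental_parallelogram w1 w2"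
  note mero = alg[unfolded algebraic_data_def]
  have sp: "{z. is_pole \<phi> z} sparse_in UNIV" "{z. is_pole \<psi> z} sparse_in UNIV"
    using mero by (auto simp: nicely_meromorphic_on_def intro: sparse_poles)
  have eq: "?K z = - 4 * Re (?b z)" if z: "z \<in> M" "\<not> is_pole \<phi> z" "\<not> is_pole \<psi> z" for z
  proof -
    have dist: "gauss_maps_distinct_at \<phi> \<psi> z" using data z by (simp add: weierstrass_data_def)
    then have ne: "\<phi> z \<noteq> cnj (\<psi> z)" using z by (auto simp: gauss_maps_distinct_at_def)
    have an: "\<phi> analytic_on {z}" "\<psi> analytic_on {z}" "h analytic_on {z}"
      using mero z nicely_meromorphic_on_imp_analytic_at data analytic_on_subset[of h M "{z}"]
      by (auto simp: weierstrass_data_def)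
    obtain r1 where r1: "r1 > 0" "\<phi> holomorphic_on ball z r1" "\<psi> holomorphic_on ball z r1"
      "\<And>w. w \<in> ball z r1 \<Longrightarrow> \<phi> w \<noteq> cnj (\<psi> w)" "wirtinger_on (ball z r1) (gauss_primitive \<phi> \<psi>) (gauss_density \<phi> \<psi>)"
      using gauss_primitive_regular[OF an(1,2) ne] by metis
    obtain r2 where r2: "r2 > 0" "h holomorphic_on ball z r2" using an(3) by (auto elim!: analytic_atE)
    have "h z \<noteq> 0" using data z by (auto simp: weierstrass_data_def)
    then obtain r3 where r3: "r3 > 0" "r3 \<le> r2" "\<And>w. w \<in> ball z r3 \<Longrightarrow> h w \<noteq> 0"
      using r2 by (metis continuous_ne_ball holomorphic_on_imp_continuous_on)
    obtain r4 where r4: "r4 > 0" "ball z r4 \<subseteq> M" using M(1) z(1) by (auto simp: open_contains_ball)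
    define r where "r = Min {r1, r3, r4}"
    have r: "r > 0" "r \<le> r1" "r \<le> r3" "r \<le> r4" using r1 r3 r4 by (auto simp: r_def)
    have hol: "\<phi> holomorphic_on ball z r" "\<psi> holomorphic_on ball z r" "h holomorphic_on ball z r"
      using r r1 r2 r3 by (auto intro: holomorphic_on_subset)
    have "?K z = - 4 * Re (gauss_density \<phi> \<psi> z)"
    proof (rule curvature_density[OF open_ball hol])
      show "(X has_derivative (\<lambda>v. \<chi> j. 2 * Re ((vector [\<phi> w + \<psi> w,
        - \<i> * (\<phi> w - \<psi> w), 1 - \<phi> w * \<psi> w, 1 + \<phi> w * \<psi> w] :: complex ^ 4) $ j * h w * v))) (at w)"
        if "w \<in> ball z r" for w
        by (rule surface_has_derivative[OF rep _ hol that]) (use r r4 in auto)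
    qed (use r r1 r3 in auto)
    also have "gauss_density \<phi> \<psi> z = ?b z"
      using gauss_primitive_local(2)[of \<phi> \<psi> z] mero z dist by auto
    finally show ?thesis .
  qed
  \<comment> \<open>Outside this countable set the two integrands agree pointwise.\<close>
  define N where "N = - M \<union> {z. is_pole \<phi> z} \<union> {z. is_pole \<psi> z}"
  have "countable N"
    using M(2) sp[THEN sparse_imp_countable[OF open_UNIV]] by (auto simp: N_def)
  then have N: "N \<in> null_sets lborel" by (rule countable_imp_null_set_lborel)
  have AE: "AE z in lborel. indicator (?F \<inter> M) z *\<^sub>R ?K z = indicator ?F z *\<^sub>R (- 4 * Re (?b z))"
    by (rule AE_I'[OF N]) (use eq in \<open>auto simp: N_def indicator_def\<close>)
  \<comment> \<open>A non-integrable integrand would give total curvature 0, so \<open>tc\<close>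
    supplies integrability, and with it the measurability used in comparing the integrals almost
    everywhere.\<close>
  have "integrable lborel (\<lambda>z. indicator (?F \<inter> M) z *\<^sub>R ?K z)"
    using tc not_integrable_integral_eq unfolding total_curvature_def set_lebesgue_integral_def by blast
  then have meas: "(\<lambda>z. indicator (?F \<inter> M) z *\<^sub>R ?K z) \<in> borel_measurable lborel" by simp
  have meas2: "(\<lambda>z. indicator ?F z *\<^sub>R (- 4 * Re (?b z))) \<in> borel_measurable lborel"
  proof -
    have "(\<lambda>z. - 4 * Re (?b z)) \<in> borel_measurable borel"
      by (intro borel_measurable_continuous_onI continuous_intros cont)
    then show ?thesis using F by measurable
  qed
  have "total_curvature w1 w2 M X = (LINT z:?F|lborel. - 4 * Re (?b z))"
    unfolding total_curvature_def set_lebesgue_integral_def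
    by (rule integral_cong_AE[OF meas meas2 AE])
  also have "\<dots> = - 4 * (LINT z:?F|lborel. Re (?b z))" by (rule set_integral_mult_right)
  finally show ?thesis .
qed

section \<open>Elliptic functions\<close>

lemma filtermap_reflect_at: "filtermap (\<lambda>z. c - z) (at z) = at (c - z :: complex)"
proof -
  have "filtermap (\<lambda>z. c - z) (at z) = filtermap (\<lambda>x. x + c) (filtermap uminus (at z))"
    by (simp add: filtermap_filtermap)
  also have "\<dots> = at (c - z)"
    by (simp add: filtermap_at_minus filtermap_at_shift[of "-c" "-z", simplified])
  finally show ?thesis .
qed

lemma eventually_reflect_at:
  "eventually P (at (c - z :: complex)) \<longleftrightarrow> eventually (\<lambda>z. P (c - z)) (at z)"
  unfolding filtermap_reflect_at[symmetric] eventually_filtermap ..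

lemma is_pole_reflect: "is_pole (\<lambda>z. f (c - z)) z \<longleftrightarrow> is_pole f (c - z :: complex)"
  unfolding is_pole_def filtermap_reflect_at[symmetric] by (simp add: filterlim_def filtermap_filtermap)

lemma meromorphic_reflect: "f meromorphic_on UNIV \<Longrightarrow> (\<lambda>z. f (c - z)) meromorphic_on UNIV"
  by (rule meromorphic_on_compose[of f UNIV]) (auto intro!: analytic_intros)

lemma nicely_meromorphic_reflect:
  assumes "f nicely_meromorphic_on UNIV"
  shows "(\<lambda>z. f (c - z)) nicely_meromorphic_on UNIV"
  unfolding nicely_meromorphic_on_def
proof (intro conjI ballI)
  show "(\<lambda>z. f (c - z)) meromorphic_on UNIV"
    using assms by (intro meromorphic_reflect) (simp add: nicely_meromorphic_on_def)
  fix z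
  have "is_pole f (c - z) \<and> f (c - z) = 0 \<or> f \<midarrow>c - z\<rightarrow> f (c - z)"
    using assms by (simp add: nicely_meromorphic_on_def)
  then show "is_pole (\<lambda>z. f (c - z)) z \<and> f (c - z) = 0 \<or> (\<lambda>z. f (c - z)) \<midarrow>z\<rightarrow> f (c - z)"
    unfolding is_pole_reflect filtermap_reflect_at[symmetric] by (simp add: filterlim_def filtermap_filtermap)
qed

lemma zorder_reflect:
  assumes "f meromorphic_on UNIV"
  shows "zorder (\<lambda>z. f (c - z)) z = zorder f (c - z)"
proof -
  let ?F = "\<lambda>u. f (u + (c - z))"
  have F: "?F meromorphic_on {-0}"
    by (rule meromorphic_on_compose[OF assms]) (auto intro!: analytic_intros)
  have "zorder (\<lambda>z. f (c - z)) z = zorder (\<lambda>u. ?F (- u)) 0"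
    by (subst zorder_shift) (simp add: algebra_simps)
  also have "\<dots> = zorder ?F 0" using zorder_uminus[OF F] by simp
  also have "\<dots> = zorder f (c - z)" by (rule zorder_shift[symmetric])
  finally show ?thesis .
qed

lemma remove_sings_reflect: "remove_sings (\<lambda>z. f (c - z)) z = remove_sings f (c - z)"
  using remove_sings_compose[OF filtermap_reflect_at[of c z], of f] by (simp add: o_def)

lemma nicely_meromorphic_eqI:
  assumes "f nicely_meromorphic_on UNIV" "g nicely_meromorphic_on UNIV"
    and "eventually (\<lambda>w. f w = g w) (at z)"
  shows "f z = g z"
proof -
  have *: "f z = remove_sings f z" if "f nicely_meromorphic_on UNIV" for f
  proof -
    have "is_pole f z \<and> f z = 0 \<or> f \<midarrow>z\<rightarrow> f z"
      using that by (simp add: nicely_meromorphic_on_def)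
    then show ?thesis by (auto simp: remove_sings_eqI)
  qed
  have "remove_sings f z = remove_sings g z" by (rule remove_sings_cong[OF assms(3) refl])
  with assms *[of f] *[of g] show ?thesis by simp
qed

lemma eventually_not_sparse: "S sparse_in UNIV \<Longrightarrow> eventually (\<lambda>w. w \<notin> S) (at (z::complex))"
  using sparse_in_open[of UNIV S] by (auto simp: islimpt_iff_eventually)

lemma periodic_int:
  assumes "\<And>z::complex. f (z + w) = f z"
  shows "f (z + of_int m * w) = f z"
proof -
  have n: "f (z + of_nat n * w) = f z" for n z
    by (induction n arbitrary: z) (auto simp: assms algebra_simps simp flip: add.assoc)
  show ?thesis
  proof (cases "m \<ge> 0")
    case True
    then show ?thesis using n[of z "nat m"] by (simp add: of_nat_nat)
  next
    case False
    then show ?thesis using n[of "z + of_int m * w" "nat (-m)"] by (simp add: of_nat_nat)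
  qed
qed

lemma periodic_lattice:
  assumes "\<And>z::complex. f (z + w1) = f z" "\<And>z. f (z + w2) = f z" "w \<in> period_lattice w1 w2"
  shows "f (z + w) = f z"
proof -
  obtain m n where w: "w = of_int m * w1 + of_int n * w2" using assms(3) by (auto simp: period_lattice_def)
  have "f (z + of_int m * w1 + of_int n * w2) = f z"
    using periodic_int[of f w1] periodic_int[of f w2] assms(1,2) by metis
  then show ?thesis by (simp add: w add.assoc)
qed

lemma period_lattice_simps:
  "0 \<in> period_lattice w1 w2" "w1 \<in> period_lattice w1 w2" "w2 \<in> period_lattice w1 w2"
  "w \<in> period_lattice w1 w2 \<Longrightarrow> - w \<in> period_lattice w1 w2"
  "w \<in> period_lattice w1 w2 \<Longrightarrow> w' \<in> period_lattice w1 w2 \<Longrightarrow> w + w' \<in> period_lattice w1 w2"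
  "w \<in> period_lattice w1 w2 \<Longrightarrow> w' \<in> period_lattice w1 w2 \<Longrightarrow> w - w' \<in> period_lattice w1 w2"
proof -
  have I: "of_int m * w1 + of_int n * w2 \<in> period_lattice w1 w2" for m n
    by (auto simp: period_lattice_def)
  show "0 \<in> period_lattice w1 w2" "w1 \<in> period_lattice w1 w2" "w2 \<in> period_lattice w1 w2"
    using I[of 0 0] I[of 1 0] I[of 0 1] by simp_all
  show "w \<in> period_lattice w1 w2 \<Longrightarrow> - w \<in> period_lattice w1 w2"
  proof -
    assume "w \<in> period_lattice w1 w2"
    then obtain m n where "w = of_int m * w1 + of_int n * w2" by (auto simp: period_lattice_def)
    then show ?thesis using I[of "-m" "-n"] by simp
  qed
  show "w + w' \<in> period_lattice w1 w2" "w - w' \<in> period_lattice w1 w2"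
    if "w \<in> period_lattice w1 w2" "w' \<in> period_lattice w1 w2"
  proof -
    obtain m n m' n' where "w = of_int m * w1 + of_int n * w2" "w' = of_int m' * w1 + of_int n' * w2"
      using \<open>w \<in> _\<close> \<open>w' \<in> _\<close> by (auto simp: period_lattice_def)
    then show "w + w' \<in> period_lattice w1 w2" "w - w' \<in> period_lattice w1 w2"
      using I[of "m + m'" "n + n'"] I[of "m - m'" "n - n'"] by (simp_all add: algebra_simps)
  qed
qed

section \<open>Liouville's theorem on the torus and functions with a single double pole\<close>

context torus
begin

abbreviation "L \<equiv> period_lattice w1 w2"

lemma translate_into_closed_para:
  obtains w where "w \<in> L" "z + w \<in> closed_para p w1 w2"
proof -
  let ?J = "Im (cnj w1 * w2)"
  define s where "s = - Im (cnj w2 * (z - p)) / ?J"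
  define t where "t = Im (cnj w1 * (z - p)) / ?J"
  have "(z - p) * of_real ?J = of_real (- Im (cnj w2 * (z - p))) * w1 + of_real (Im (cnj w1 * (z - p))) * w2"
    by (simp add: complex_eq_iff algebra_simps)
  moreover have "x = of_real (a / j) * w1 + of_real (b / j) * w2"
    if "x * of_real j = of_real a * w1 + of_real b * w2" "j \<noteq> 0" for x a b j
    using that by (simp add: field_simps)
  ultimately have st: "z - p = of_real s * w1 + of_real t * w2"
    using J unfolding s_def t_def by (metis less_irrefl)
  show ?thesis
  proof (rule that)
    show "of_int (- \<lfloor>s\<rfloor>) * w1 + of_int (- \<lfloor>t\<rfloor>) * w2 \<in> L" unfolding period_lattice_def by blast
    have "z + (of_int (- \<lfloor>s\<rfloor>) * w1 + of_int (- \<lfloor>t\<rfloor>) * w2) = para p w1 w2 (frac s) (frac t)"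
      using st by (simp add: para_def frac_def algebra_simps)
    moreover have "frac s \<in> {0..1}" "frac t \<in> {0..1}" by (auto simp: less_imp_le[OF frac_lt_1])
    ultimately show "z + (of_int (- \<lfloor>s\<rfloor>) * w1 + of_int (- \<lfloor>t\<rfloor>) * w2) \<in> closed_para p w1 w2"
      by (auto simp: closed_para_def)
  qed
qed

text \<open>All values are already taken on a compact parallelogram, so the function is bounded and
  Liouville's theorem applies.\<close>

lemma elliptic_entire_constant:
  assumes "f holomorphic_on UNIV" and per: "\<And>z. f (z + w1) = f z" "\<And>z. f (z + w2) = f z"
  obtains K where "\<And>z. f z = K"
proof -
  have "range f \<subseteq> f ` closed_para 0 w1 w2"
  proof safe
    fix z
    obtain w where "w \<in> L" "z + w \<in> closed_para 0 w1 w2" by (rule translate_into_closed_para)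
    with periodic_lattice[OF per] show "f z \<in> f ` closed_para 0 w1 w2" by (metis image_eqI)
  qed
  moreover have "compact (f ` closed_para 0 w1 w2)"
    using assms(1) compact_closed_para
    by (intro compact_continuous_image) (auto intro: holomorphic_on_imp_continuous_on holomorphic_on_subset)
  ultimately have "bounded (range f)" using compact_imp_bounded bounded_subset by blast
  from Liouville_theorem[OF assms(1) this] show ?thesis using that by (auto simp: constant_on_def)
qed

text \<open>The difference \<open>d\<close> of \<open>f\<close> and its reflection is odd about
  \<open>P\<close>, so the leading term of order -2 cancels and at most a simple pole is left.
  Modulo \<open>L\<close> there is no other pole, so the residue vanishes, \<open>d\<close> extends
  to a constant, and an odd constant is 0.\<close>

lemma even_of_double_pole:
  assumes f: "f nicely_meromorphic_on UNIV" and per: "\<And>z. f (z + w1) = f z" "\<And>z. f (z + w2) = f z"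
    and P: "is_pole f P" "zorder f P = -2" and poles: "\<And>z. is_pole f z \<Longrightarrow> z - P \<in> L"
  shows "f (2 * P - z) = f z"
proof -
  define S where "S = {z. is_pole f z}"
  have mero: "f meromorphic_on UNIV" using f by (simp add: nicely_meromorphic_on_def)
  have S: "S sparse_in UNIV" unfolding S_def using mero by (rule sparse_poles)
  have perL: "f (z + w) = f z" if "w \<in> L" for w z using periodic_lattice[OF per that] .
  have Sper: "z + w \<in> S \<longleftrightarrow> z \<in> S" if "w \<in> L" for z w
    unfolding S_def mem_Collect_eq by (rule is_pole_periodic) (rule perL[OF that])
  have SL: "z \<in> S \<longleftrightarrow> z - P \<in> L" for z
    using poles[of z] P(1) Sper[of "z - P" P] by (auto simp: S_def)
  have Srefl: "2 * P - z \<in> S \<longleftrightarrow> z \<in> S" for z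
    unfolding SL using period_lattice_simps(4)[of "z - P" w1 w2] period_lattice_simps(4)[of "P - z" w1 w2] by auto
  define d where "d z = f z - f (2 * P - z)" for z
  have perd: "d (z + w) = d z" if "w \<in> L" for z w
    using perL[OF that, of z] perL[OF period_lattice_simps(4)[OF that], of "2 * P - z"]
    by (simp add: d_def algebra_simps)
  have an: "f analytic_on {z}" if "z \<notin> S" for z
    using that f nicely_meromorphic_on_imp_analytic_at by (auto simp: S_def)
  have and': "d analytic_on {z}" if "z \<notin> S" for z
  proof -
    have "2 * P - z \<notin> S" using that Srefl by simp
    then have "f analytic_on (\<lambda>z. 2 * P - z) ` {z}" using an by simp
    then have "(f \<circ> (\<lambda>z. 2 * P - z)) analytic_on {z}"
      by (intro analytic_on_compose) (intro analytic_intros)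
    then have "(\<lambda>z. f (2 * P - z)) analytic_on {z}" by (simp add: o_def)
    then show ?thesis unfolding d_def[abs_def] using an[OF that] by (intro analytic_intros)
  qed
  obtain r H \<rho> where H: "r > 0" "H holomorphic_on ball P r"
    "\<And>z. z \<in> ball P r - {P} \<Longrightarrow> d z = H z + \<rho> / (z - P)"
  proof -
    have "isolated_singularity_at f P" "not_essential f P" "\<exists>\<^sub>F w in at P. f w \<noteq> 0"
      using mero P(1) non_zero_neighbour_pole[of f P] by (auto simp: meromorphic_on_altdef intro: eventually_frequently)
    from zorder_exist[OF this] obtain g r where g: "r > 0" "g holomorphic_on cball P r"
      "\<And>w. w \<in> cball P r - {P} \<Longrightarrow> f w = g w * (w - P) powi (-2)"
      unfolding P(2) by blast
    have hg: "g holomorphic_on ball P r" using g(2) by (rule holomorphic_on_subset) auto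
    \<comment> \<open>Near \<open>P\<close>, \<open>d\<close> is \<open>k\<close> divided by the
      square of \<open>z - P\<close>. As \<open>k P = 0\<close>, one factor is divided out of
      \<open>k\<close> to give \<open>m\<close>; dividing out the second one leaves the residue
      \<open>m P\<close>.\<close>
    define k where "k z = g z - g (2 * P - z)" for z
    have refl: "2 * P - z \<in> ball P r \<longleftrightarrow> z \<in> ball P r" for z
      by (simp add: dist_norm norm_minus_commute)
    have hk: "k holomorphic_on ball P r"
      unfolding k_def[abs_def] using refl
      by (intro holomorphic_intros hg holomorphic_on_compose_gen[OF _ hg, unfolded o_def]) auto
    define m where "m z = (if z = P then deriv k P else (k z - k P) / (z - P))" for z
    have hm: "m holomorphic_on ball P r" unfolding m_def[abs_def] by (rule pole_lemma_open[OF hk open_ball])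
    define H where "H z = (if z = P then deriv m P else (m z - m P) / (z - P))" for z
    have hH: "H holomorphic_on ball P r" unfolding H_def[abs_def] by (rule pole_lemma_open[OF hm open_ball])
    show ?thesis
    proof (rule that[OF g(1) hH])
      fix z assume z: "z \<in> ball P r - {P}"
      have "2 * P - z - P = - (z - P)" by simp
      moreover have "2 * P - z \<in> cball P r - {P}" using z by (auto simp: dist_norm norm_minus_commute)
      ultimately have "f (2 * P - z) = g (2 * P - z) / (z - P)\<^sup>2"
        using g(3)[of "2 * P - z"] by (simp add: power_int_minus divide_inverse power2_commute)
      moreover have "f z = g z / (z - P)\<^sup>2"
        using g(3)[of z] z by (simp add: power_int_minus divide_inverse)
      ultimately have "d z = k z / (z - P)\<^sup>2" by (simp add: d_def k_def diff_divide_distrib)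
      also have "k z = m z * (z - P)" using z by (simp add: m_def k_def)
      also have "\<dots> / (z - P)\<^sup>2 = m z / (z - P)" using z by (simp add: power2_eq_square)
      also have "\<dots> = H z + m P / (z - P)" using z by (simp add: H_def diff_divide_distrib)
      finally show "d z = H z + m P / (z - P)" .
    qed
  qed
  \<comment> \<open>The expansion at \<open>P\<close> is carried to the other points of
    \<open>S\<close> by periodicity, with the same residue.\<close>
  have locd: "\<exists>C. C holomorphic_on ball q r \<and> (\<forall>z\<in>ball q r - {q}. d z = C z + \<rho> / (z - q))" if "q \<in> S" for q
  proof -
    have qL: "P - q \<in> L" using that SL period_lattice_simps(4)[of "q - P" w1 w2] by simp
    have "(\<lambda>z. H (z + (P - q))) holomorphic_on ball q r"
      by (intro holomorphic_intros holomorphic_on_compose_gen[OF _ H(2), unfolded o_def])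
        (auto simp: dist_norm algebra_simps)
    moreover have "d z = H (z + (P - q)) + \<rho> / (z - q)" if "z \<in> ball q r - {q}" for z
      using H(3)[of "z + (P - q)"] that perd[OF qL, of z] by (auto simp: dist_norm algebra_simps)
    ultimately show ?thesis by blast
  qed
  \<comment> \<open>\<open>d\<close> has at most one pole modulo \<open>L\<close>, and the residues of an elliptic function add up to 0.\<close>
  have "\<rho> = 0"
  proof -
    have "countable S" using S sparse_imp_countable[OF open_UNIV] by auto
    from exists_base_point[OF J this] obtain p where
      p: "\<And>s t. para p w1 w2 s t \<in> S \<Longrightarrow> s \<notin> {0, 1} \<and> t \<notin> {0, 1}" by metis
    have "of_real (Im (cnj w1 * w2)) * integral {0..1} (\<lambda>s. integral {0..1} (\<lambda>t. (\<lambda>_. 0) (para p w1 w2 s t)))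
      = - (pi * (\<Sum>q\<in>S \<inter> closed_para p w1 w2. \<rho>))"
    proof (rule torus_residue[OF J S, where A = d])
      show "\<exists>r>0. \<exists>C. wirtinger_on (ball q r) C (\<lambda>_. 0) \<and> (\<forall>z\<in>ball q r - {q}. d z = C z + \<rho> / (z - q))"
        if "q \<in> S" for q
        using locd[OF that] H(1) wirtinger_on_holomorphic by blast
      show "\<exists>r>0. wirtinger_on (ball q r) d (\<lambda>_. 0)" if "q \<notin> S" for q
        using and'[OF that] by (metis analytic_atE wirtinger_on_holomorphic open_ball)
    qed (use p perd period_lattice_simps in auto)
    moreover have "finite (S \<inter> closed_para p w1 w2)"
      using sparse_in_compact_finite[of S "closed_para p w1 w2"] S compact_closed_para sparse_in_subset
      by (metis inf_commute subset_UNIV)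
    moreover have "S \<inter> closed_para p w1 w2 \<noteq> {}"
    proof -
      obtain w where "w \<in> L" "P + w \<in> closed_para p w1 w2" by (rule translate_into_closed_para)
      then show ?thesis using SL[of "P + w"] by auto
    qed
    ultimately show ?thesis by simp
  qed
  have e_an: "remove_sings d analytic_on {z}" for z
  proof (cases "z \<in> S")
    case False
    then show ?thesis using and' by (intro remove_sings_analytic_on)
  next
    case True
    from locd[OF this] obtain C where C: "C holomorphic_on ball z r" "\<forall>w\<in>ball z r - {z}. d w = C w"
      using \<open>\<rho> = 0\<close> by auto
    have "remove_sings d w = C w" if "w \<in> ball z r" for w
      using remove_sings_eq_continuous[OF holomorphic_on_imp_continuous_on[OF C(1)] _ that] C(2) by auto
    with C(1) have "remove_sings d holomorphic_on ball z r"
      by (rule holomorphic_transform[OF _ sym])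
    then show ?thesis
      unfolding analytic_at using H(1) by (intro exI[of _ "ball z r"]) auto
  qed
  then have "remove_sings d holomorphic_on UNIV"
    by (metis analytic_imp_holomorphic analytic_on_analytic_at)
  moreover have "remove_sings d (z + w) = remove_sings d z" if "w \<in> L" for z w
    by (rule remove_sings_periodic) (rule perd[OF that])
  ultimately obtain K where K: "\<And>z. remove_sings d z = K"
    using elliptic_entire_constant[of "remove_sings d"] period_lattice_simps by metis
  have dK: "d z = K" if "z \<notin> S" for z using K[of z] and'[OF that] by simp
  obtain z0 where z0: "z0 \<notin> S"
    using eventually_happens[OF eventually_not_sparse[OF S, of P]] by auto
  have "d (2 * P - z0) = - d z0" by (simp add: d_def)
  with dK z0 Srefl have "K = 0" by simp
  show ?thesis
  proof (cases "z \<in> S")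
    case True
    \<comment> \<open>A nicely meromorphic function has the value 0 at its poles, so the identity
      holds there as well.\<close>
    then have "f z = 0" "f (2 * P - z) = 0"
      using f is_pole_zero_at_nicely_mero Srefl unfolding S_def by blast+
    then show ?thesis by simp
  next
    case False
    then show ?thesis using dK \<open>K = 0\<close> by (simp add: d_def)
  qed
qed

end

text \<open>Used for the orders at the poles or zeros in a parallelogram: the order at one point
  already exhausts the total, so there is no room for another point.\<close>

lemma singleton_of_sum_eq:
  fixes c :: "'a \<Rightarrow> int"
  assumes "finite K" "\<And>q. q \<in> K \<Longrightarrow> c q \<ge> 1" "x \<in> K" "sum c K = c x"
  shows "K = {x}"
proof -
  have "sum c K = c x + sum c (K - {x})" using assms by (simp add: sum.remove)
  then have "sum c (K - {x}) = 0" using assms by simp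
  moreover have "c q > 0" if "q \<in> K - {x}" for q using assms(2)[of q] that by simp
  ultimately have "K - {x} = {}" using assms(1) sum_pos[of "K - {x}" c] by force
  then show ?thesis using assms(3) by auto
qed

context torus
begin

text \<open>The multiplicity at \<open>P\<close> equals the degree, so \<open>f\<close> takes its
  value at \<open>P\<close> only at \<open>P\<close> modulo \<open>L\<close>. If that value is
  finite, the zeros of \<open>u = f - f P\<close> are first counted through its poles, and then
  \<open>1 / u\<close> is the function with the double pole.\<close>

lemma even_of_multiplicity_2:
  assumes f: "f nicely_meromorphic_on UNIV" and per: "\<And>z. f (z + w1) = f z" "\<And>z. f (z + w2) = f z"
    and mult: "has_multiplicity_at f P 2"
    and bd: "\<And>s t. is_pole f (para p w1 w2 s t) \<or> f (para p w1 w2 s t) = f P \<Longrightarrow> s \<notin> {0, 1} \<and> t \<notin> {0, 1}"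
    and deg: "(\<Sum>q | is_pole f q \<and> q \<in> closed_para p w1 w2. zorder f q) = -2"
  shows "f (2 * P - z) = f z"
proof -
  have mero: "f meromorphic_on UNIV" using f by (simp add: nicely_meromorphic_on_def)
  have iso: "isolated_singularity_at f z" and ness: "not_essential f z" for z
    using mero by (auto simp: meromorphic_on_altdef)
  have perL: "f (z + w) = f z" if "w \<in> L" for w z using periodic_lattice[OF per that] .
  have poleper: "is_pole f (z + w) \<longleftrightarrow> is_pole f z" if "w \<in> L" for z w
    by (rule is_pole_periodic) (rule perL[OF that])
  have zoper: "zorder f (z + w) = zorder f z" if "w \<in> L" for z w
    by (rule zorder_periodic) (rule perL[OF that])
  have fin: "finite (S \<inter> closed_para p w1 w2)" if "S sparse_in UNIV" for S
    using sparse_in_compact_finite[of S "closed_para p w1 w2"] that compact_closed_para sparse_in_subset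
    by (metis inf_commute subset_UNIV)
  obtain w0 where w0: "w0 \<in> L" "P + w0 \<in> closed_para p w1 w2" by (rule translate_into_closed_para)
  have only: "z - P \<in> L"
    if T: "T \<inter> closed_para p w1 w2 = {P + w0}" "\<And>w z. w \<in> L \<Longrightarrow> z + w \<in> T \<longleftrightarrow> z \<in> T" "z \<in> T" for T z
  proof -
    obtain w where w: "w \<in> L" "z + w \<in> closed_para p w1 w2" by (rule translate_into_closed_para)
    then have "z + w = P + w0" using T by blast
    then have "z - P = w0 - w" by (simp add: algebra_simps)
    then show ?thesis using period_lattice_simps(6)[OF w0(1) w(1)] by simp
  qed
  define A where "A = {z. is_pole f z}"
  have A: "A sparse_in UNIV" unfolding A_def using mero by (rule sparse_poles)
  have KA: "{q. is_pole f q \<and> q \<in> closed_para p w1 w2} = A \<inter> closed_para p w1 w2" by (auto simp: A_def)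
  show ?thesis
  proof (cases "is_pole f P")
    case True
    then have zP: "zorder f P = -2" using mult by (simp add: has_multiplicity_at_def)
    have "A \<inter> closed_para p w1 w2 = {P + w0}"
    proof (rule singleton_of_sum_eq[where c = "\<lambda>q. - zorder f q"])
      show "- zorder f q \<ge> 1" if "q \<in> A \<inter> closed_para p w1 w2" for q
        using isolated_pole_imp_neg_zorder[OF iso, of q] that by (simp add: A_def)
      show "P + w0 \<in> A \<inter> closed_para p w1 w2" using w0 True poleper by (simp add: A_def)
      show "(\<Sum>q\<in>A \<inter> closed_para p w1 w2. - zorder f q) = - zorder f (P + w0)"
        using deg zP zoper[OF w0(1)] by (simp add: KA sum_negf)
    qed (rule fin[OF A])
    then have "z - P \<in> L" if "is_pole f z" for z
      using only[of A z] poleper that by (auto simp: A_def)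
    then show ?thesis using even_of_double_pole[OF f per True zP] by blast
  next
    case False
    define c where "c = f P"
    define u where "u z = f z - c" for z
    have multP: "\<exists>\<^sub>F w in at P. f w \<noteq> c" "zorder u P = 2"
      using mult False unfolding has_multiplicity_at_def c_def u_def[abs_def] by auto
    have nz: "eventually (\<lambda>w. u w \<noteq> 0) (at z)" for z
    proof (rule ccontr)
      assume "\<not> eventually (\<lambda>w. u w \<noteq> 0) (at z)"
      then have "\<exists>\<^sub>F w in at z. f w = c" by (simp add: u_def frequently_def)
      from frequently_eq_meromorphic_imp_constant[OF this f]
      have "f w = c" for w by auto
      with multP(1) show False by simp
    qed
    then have nzf: "\<exists>\<^sub>F w in at z. u w \<noteq> 0" for z by (simp add: eventually_frequently)
    have um: "u meromorphic_on UNIV" unfolding u_def[abs_def] by (intro meromorphic_intros mero)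
    have uiso: "isolated_singularity_at u z" and uness: "not_essential u z" for z
      using um by (auto simp: meromorphic_on_altdef)
    have upole: "is_pole u z \<longleftrightarrow> is_pole f z" for z
      unfolding u_def[abs_def] by (rule is_pole_minus_const_iff)
    have uper: "u (z + w) = u z" if "w \<in> L" for z w using perL[OF that] by (simp add: u_def)
    have uan: "u analytic_on {z}" if "\<not> is_pole f z" for z
      unfolding u_def[abs_def] using nicely_meromorphic_on_imp_analytic_at[OF f _ that] by (intro analytic_intros) auto
    define Z where "Z = {z. \<not> is_pole f z \<and> f z = c}"
    have Zzero: "z \<in> Z \<longleftrightarrow> isolated_zero u z" for z
    proof
      assume "z \<in> Z"
      then show "isolated_zero u z"
        using uan[of z] nz[of z] isolated_zero_analytic_iff[of u z] by (auto simp: Z_def u_def)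
    next
      assume "isolated_zero u z"
      moreover from this have "\<not> is_pole f z" using pole_is_not_zero upole by blast
      ultimately show "z \<in> Z" using uan[of z] zero_isolated_zero_analytic[of u z] by (auto simp: Z_def u_def)
    qed
    have Zper: "z + w \<in> Z \<longleftrightarrow> z \<in> Z" if "w \<in> L" for z w
      using poleper[OF that] perL[OF that] by (simp add: Z_def)
    have Zs: "Z sparse_in UNIV"
    proof -
      have "{z. isolated_zero u z} sparse_in UNIV"
        using meromorphic_on_imp_not_zero_cosparse[OF um] by (simp add: eventually_cosparse)
      moreover have "Z = {z. isolated_zero u z}" using Zzero by auto
      ultimately show ?thesis by simp
    qed
    have S: "A \<union> Z sparse_in UNIV" using A Zs by (rule sparse_in_union')
    have "(\<Sum>q\<in>(A \<union> Z) \<inter> closed_para p w1 w2. zorder u q) = 0"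
    proof (rule sum_zorder_eq_0[OF um _ _ nzf S])
      show "u analytic_on {z} \<and> u z \<noteq> 0" if "z \<notin> A \<union> Z" for z
        using that uan by (auto simp: A_def Z_def u_def)
      show "s \<notin> {0, 1} \<and> t \<notin> {0, 1}" if "para p w1 w2 s t \<in> A \<union> Z" for s t
        using bd[of s t] that by (auto simp: A_def Z_def c_def)
    qed (use uper period_lattice_simps in auto)
    also have "(A \<union> Z) \<inter> closed_para p w1 w2 = (A \<inter> closed_para p w1 w2) \<union> (Z \<inter> closed_para p w1 w2)" by auto
    also have "(\<Sum>q\<in>\<dots>. zorder u q) = (\<Sum>q\<in>A \<inter> closed_para p w1 w2. zorder u q) + (\<Sum>q\<in>Z \<inter> closed_para p w1 w2. zorder u q)"
      by (rule sum.union_disjoint[OF fin[OF A] fin[OF Zs]]) (auto simp: A_def Z_def)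
    also have "(\<Sum>q\<in>A \<inter> closed_para p w1 w2. zorder u q) = (\<Sum>q\<in>A \<inter> closed_para p w1 w2. zorder f q)"
    proof (rule sum.cong[OF refl])
      fix q assume "q \<in> A \<inter> closed_para p w1 w2"
      then have q: "is_pole f q" by (simp add: A_def)
      show "zorder u q = zorder f q"
      proof (cases "c = 0")
        case False
        have "zorder (\<lambda>_. c) q = 0" using False by (intro zorder_eq_0I) auto
        then have "zorder f q < zorder (\<lambda>_. c) q" using isolated_pole_imp_neg_zorder[OF iso q] by simp
        moreover have "\<exists>\<^sub>F w in at q. f w \<noteq> 0" using non_zero_neighbour_pole[OF q] by (simp add: eventually_frequently)
        ultimately show ?thesis
          unfolding u_def[abs_def] using False mero
          by (intro zorder_diff1) (auto intro: meromorphic_on_subset meromorphic_intros)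
      qed (simp add: u_def[abs_def])
    qed
    also have "\<dots> = -2" using deg by (simp add: KA)
    finally have sumZ: "(\<Sum>q\<in>Z \<inter> closed_para p w1 w2. zorder u q) = 2" by simp
    have PZ: "P \<in> Z" using False by (simp add: Z_def c_def)
    have "Z \<inter> closed_para p w1 w2 = {P + w0}"
    proof (rule singleton_of_sum_eq[where c = "zorder u"])
      show "zorder u q \<ge> 1" if "q \<in> Z \<inter> closed_para p w1 w2" for q
        using zorder_isolated_zero_pos'[of u q] that Zzero uiso by force
      show "P + w0 \<in> Z \<inter> closed_para p w1 w2" using w0 PZ Zper by simp
      have "zorder u (P + w0) = zorder u P" by (rule zorder_periodic) (rule uper[OF w0(1)])
      then show "(\<Sum>q\<in>Z \<inter> closed_para p w1 w2. zorder u q) = zorder u (P + w0)"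
        using multP(2) sumZ by simp
    qed (rule fin[OF Zs])
    then have ZL: "z - P \<in> L" if "z \<in> Z" for z using only[OF _ Zper that] by blast
    \<comment> \<open>At a pole of \<open>f\<close>, where the stored value is 0,
      \<open>inverse (u z)\<close> is \<open>- inverse c\<close> instead of the limit 0;
      \<open>remove_sings\<close> corrects this.\<close>
    define k where "k = remove_sings (\<lambda>z. inverse (u z))"
    have im: "(\<lambda>z. inverse (u z)) meromorphic_on UNIV" by (intro meromorphic_intros um)
    have iiso: "isolated_singularity_at (\<lambda>z. inverse (u z)) z" for z
      using im by (auto simp: meromorphic_on_altdef)
    have kn: "k nicely_meromorphic_on UNIV" unfolding k_def by (rule remove_sings_nicely_meromorphic[OF im])
    have kpole: "is_pole k z \<longleftrightarrow> z \<in> Z" for z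
      unfolding k_def is_pole_remove_sings_iff[OF iiso] is_pole_inverse_iff Zzero ..
    have kper: "k (z + w) = k z" if "w \<in> L" for z w
      unfolding k_def by (rule remove_sings_periodic) (simp add: uper[OF that])
    have kz: "zorder k P = -2"
      unfolding k_def zorder_remove_sings[OF iiso] zorder_inverse[OF uiso uness nzf] multP(2) by simp
    have keven: "k (2 * P - z) = k z" for z
      by (rule even_of_double_pole[OF kn kper kper _ kz]) (use kpole PZ ZL period_lattice_simps in auto)
    have kval: "k z = inverse (u z)" if "z \<notin> A \<union> Z" for z
    proof -
      have "u analytic_on {z}" "u z \<noteq> 0" using that uan by (auto simp: A_def Z_def u_def)
      then have "(\<lambda>z. inverse (u z)) analytic_on {z}" by (intro analytic_intros) auto
      then show ?thesis unfolding k_def by (rule remove_sings_at_analytic)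
    qed
    \<comment> \<open>Off the exceptional points the evenness of \<open>1 / u\<close> gives that of
      \<open>f\<close>; it extends to every point because nicely meromorphic functions are
      determined by nearby values.\<close>
    show ?thesis
    proof (rule nicely_meromorphic_eqI[OF nicely_meromorphic_reflect[OF f] f])
      have "eventually (\<lambda>w. w \<notin> A \<union> Z) (at (2 * P - z))" by (rule eventually_not_sparse[OF S])
      then have "eventually (\<lambda>w. 2 * P - w \<notin> A \<union> Z) (at z)" unfolding eventually_reflect_at .
      moreover have "eventually (\<lambda>w. w \<notin> A \<union> Z) (at z)" by (rule eventually_not_sparse[OF S])
      ultimately show "eventually (\<lambda>w. f (2 * P - w) = f w) (at z)"
      proof eventually_elim
        case (elim w)
        then have "inverse (u (2 * P - w)) = inverse (u w)" using keven[of w] kval by metis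
        then show ?case by (simp add: u_def)
      qed
    qed
  qed
qed

text \<open>The quotient of the reflected function and \<open>h\<close> has order 0 everywhere, so
  it extends to an entire elliptic function and is constant. Reflecting twice gives the identity,
  hence \<open>K * K = 1\<close>.\<close>

lemma even_or_odd_of_zorder:
  assumes mero: "h meromorphic_on UNIV" and per: "\<And>z. h (z + w1) = h z" "\<And>z. h (z + w2) = h z"
    and nz: "\<And>z. eventually (\<lambda>w. h w \<noteq> 0) (at z)"
    and ord: "\<And>z. zorder h (c - z) = zorder h z"
  obtains K :: complex where "K = 1 \<or> K = -1" "\<And>z. eventually (\<lambda>w. h (c - w) = K * h w) (at z)"
proof -
  define q where "q z = h (c - z) / h z" for z
  have perL: "h (z + w) = h z" if "w \<in> L" for w z using periodic_lattice[OF per that] .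
  have qm: "q meromorphic_on UNIV"
    unfolding q_def[abs_def] by (intro meromorphic_intros meromorphic_reflect mero)
  have qiso: "isolated_singularity_at q z" and qness: "not_essential q z" for z
    using qm by (auto simp: meromorphic_on_altdef)
  have nzr: "eventually (\<lambda>w. h (c - w) \<noteq> 0) (at z)" for z
    using nz[of "c - z"] unfolding eventually_reflect_at .
  have "zorder q z = 0" for z
  proof -
    have "zorder q z = zorder (\<lambda>z. h (c - z)) z - zorder h z"
      unfolding q_def[abs_def] using nz[of z] nzr[of z] mero
      by (intro zorder_divide) (auto intro: meromorphic_on_subset[OF meromorphic_reflect] meromorphic_on_subset simp: eventually_frequently)
    then show ?thesis using zorder_reflect[OF mero] ord by simp
  qed
  then have "\<not> is_pole q z" for z using isolated_pole_imp_neg_zorder[OF qiso, of z] by auto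
  then have "\<exists>x. q \<midarrow>z\<rightarrow> x" for z using qness[of z] by (auto simp: not_essential_def)
  then have "remove_sings q analytic_on {z}" for z
    using remove_sings_analytic_at[OF qiso] by blast
  then have "remove_sings q holomorphic_on UNIV"
    by (metis analytic_imp_holomorphic analytic_on_analytic_at)
  moreover have "remove_sings q (z + w) = remove_sings q z" if "w \<in> L" for z w
  proof (rule remove_sings_periodic)
    show "q (z + w) = q z" for z
      using perL[OF that, of z] perL[OF period_lattice_simps(4)[OF that], of "c - z"]
      by (simp add: q_def algebra_simps)
  qed
  ultimately obtain K where K: "\<And>z. remove_sings q z = K"
    using elliptic_entire_constant[of "remove_sings q"] period_lattice_simps by metis
  have ev: "eventually (\<lambda>w. h (c - w) = K * h w) (at z)" for z
    using eventually_remove_sings_eq_at[OF qiso] nz[of z]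
    by eventually_elim (auto simp: K q_def)
  \<comment> \<open>The relation is used at \<open>w\<close> and at \<open>c - w\<close>
    simultaneously, for a \<open>w\<close> where \<open>h\<close> does not vanish.\<close>
  have "eventually (\<lambda>w. h (c - w) = K * h w \<and> h (c - (c - w)) = K * h (c - w) \<and> h w \<noteq> 0) (at 0)"
    using ev[of 0] ev[of "c - 0", unfolded eventually_reflect_at] nz[of 0] by eventually_elim auto
  from eventually_happens'[OF at_neq_bot this]
  obtain w where w: "h (c - w) = K * h w" "h w = K * h (c - w)" "h w \<noteq> 0" by auto
  then have "h w * 1 = h w * (K * K)" using w(1,2) by (metis mult.assoc mult.commute mult.right_neutral)
  then have "K * K = 1" using w(3) by (metis mult_left_cancel)
  then have "K = 1 \<or> K = -1" by (simp add: square_eq_1_iff)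
  then show ?thesis using that ev by blast
qed

end

section \<open>Non-embeddedness\<close>

lemma remove_sings_cnj: "remove_sings (\<lambda>z. cnj (f z)) z = cnj (remove_sings f z)"
proof (cases "\<exists>c. f \<midarrow>z\<rightarrow> c")
  case True
  then obtain c where c: "f \<midarrow>z\<rightarrow> c" by blast
  then have "(\<lambda>z. cnj (f z)) \<midarrow>z\<rightarrow> cnj c" by (rule tendsto_cnj)
  with c show ?thesis by (simp add: remove_sings_eqI)
next
  case False
  moreover have "\<not> (\<exists>c. (\<lambda>z. cnj (f z)) \<midarrow>z\<rightarrow> c)"
    using False tendsto_cnj[of "\<lambda>z. cnj (f z)"] by fastforce
  ultimately show ?thesis by (simp add: remove_sings_def)
qed

lemma remove_sings_uminus: "remove_sings (\<lambda>z. - f z) z = - remove_sings f z"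
proof (cases "\<exists>c. f \<midarrow>z\<rightarrow> c")
  case True
  then obtain c where c: "f \<midarrow>z\<rightarrow> c" by blast
  then have "(\<lambda>z. - f z) \<midarrow>z\<rightarrow> - c" by (rule tendsto_minus)
  with c show ?thesis by (simp add: remove_sings_eqI)
next
  case False
  moreover have "\<not> (\<exists>c. (\<lambda>z. - f z) \<midarrow>z\<rightarrow> c)"
    using False tendsto_minus[of "\<lambda>z. - f z"] by fastforce
  ultimately show ?thesis by (simp add: remove_sings_def)
qed

text \<open>The multiplicity excludes a constant \<open>f\<close>, since it requires values
  different from \<open>f P\<close> near \<open>P\<close> when \<open>P\<close> is not a pole. The
  identity theorem then makes the level set discrete.\<close>

lemma sparse_level_set:
  assumes f: "f nicely_meromorphic_on UNIV" and mult: "has_multiplicity_at f P n"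
  shows "{z. f z = f P} sparse_in UNIV"
proof -
  have "eventually (\<lambda>w. f w \<noteq> f P) (at z)" for z
  proof (rule ccontr)
    assume "\<not> eventually (\<lambda>w. f w \<noteq> f P) (at z)"
    then have "\<exists>\<^sub>F w in at z. f w = f P" by (simp add: frequently_def)
    from frequently_eq_meromorphic_imp_constant[OF this f]
    have const: "f w = f P" for w by auto
    then have "f \<midarrow>P\<rightarrow> f P" by (intro tendsto_eventually always_eventually) simp
    then have "\<not> is_pole f P" by (auto simp: is_pole_def dest: not_tendsto_and_filterlim_at_infinity[rotated])
    with mult have "\<exists>\<^sub>F w in at P. f w \<noteq> f P" by (simp add: has_multiplicity_at_def)
    with const show False by (simp only: not_True_eq_False simp_thms frequently_const_iff)
  qed
  then show ?thesis by (simp add: sparse_in_open islimpt_iff_eventually)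
qed

lemma gauss_maps_distinct_at_swap: "gauss_maps_distinct_at f g z \<longleftrightarrow> gauss_maps_distinct_at g f z"
  unfolding gauss_maps_distinct_at_def by (metis complex_cnj_cnj)

lemma nicely_meromorphic_translate:
  assumes "f nicely_meromorphic_on UNIV"
  shows "(\<lambda>z. f (z + w)) nicely_meromorphic_on UNIV"
  using nicely_meromorphic_reflect[OF nicely_meromorphic_reflect[OF assms, of w], of 0]
  by (simp add: add.commute)

context torus
begin

lemma lattice_coords:
  assumes "of_real s * w1 + of_real t * w2 \<in> L"
  shows "s \<in> \<int>" "t \<in> \<int>"
proof -
  obtain m n where "of_real s * w1 + of_real t * w2 = of_int m * w1 + of_int n * w2"
    using assms by (auto simp: period_lattice_def)
  then have "para 0 w1 w2 s t = para 0 w1 w2 (of_int m) (of_int n)" by (simp add: para_def)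
  from para_coords_eq[OF J this] show "s \<in> \<int>" "t \<in> \<int>" by auto
qed

lemma sparse_lattice: "- punctured L P sparse_in UNIV"
proof -
  let ?J = "Im (cnj w1 * w2)"
  have "eventually (\<lambda>w. w \<in> punctured L P) (at z)" for z
  proof -
    \<comment> \<open>A neighbourhood so small that the coordinates of a difference of two of its
      points lie strictly between -1 and 1; it contains at most one translate of \<open>P\<close> by
      \<open>L\<close>.\<close>
    define V where "V = {w. \<bar>Im (cnj w2 * (w - z))\<bar> < ?J / 2 \<and> \<bar>Im (cnj w1 * (w - z))\<bar> < ?J / 2}"
    have "open V" unfolding V_def by (intro open_Collect_conj open_Collect_less continuous_intros)
    moreover have "z \<in> V" using J by (simp add: V_def)
    ultimately have "eventually (\<lambda>w. w \<in> V) (at z)" by (meson eventually_at_topological)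
    moreover have one: "x = y" if "x \<in> V" "y \<in> V" "x - P \<in> L" "y - P \<in> L" for x y
    proof -
      have "x - y \<in> L" using period_lattice_simps(6)[OF that(3,4)] by simp
      then obtain m n where mn: "x - y = of_int m * w1 + of_int n * w2" by (auto simp: period_lattice_def)
      have "Im (cnj w2 * (x - z)) - Im (cnj w2 * (y - z)) = Im (cnj w2 * (x - y))"
           "Im (cnj w1 * (x - z)) - Im (cnj w1 * (y - z)) = Im (cnj w1 * (x - y))"
        by (simp_all add: algebra_simps)
      moreover have "Im (cnj w2 * (x - y)) = - of_int m * ?J" "Im (cnj w1 * (x - y)) = of_int n * ?J"
        unfolding mn by (simp_all add: algebra_simps)
      ultimately have "\<bar>of_int m * ?J\<bar> < ?J" "\<bar>of_int n * ?J\<bar> < ?J"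
        using that(1,2) unfolding V_def mem_Collect_eq by linarith+
      then have "\<bar>of_int m :: real\<bar> < 1" "\<bar>of_int n :: real\<bar> < 1"
        using J by (simp_all add: abs_mult del: times_complex.simps)
      then have "m = 0" "n = 0" by linarith+
      with mn show ?thesis by simp
    qed
    moreover have "\<exists>x. \<forall>w\<in>V. w - P \<in> L \<longrightarrow> w = x" using one by blast
    then obtain x where "\<forall>w\<in>V. w - P \<in> L \<longrightarrow> w = x" by blast
    moreover have "eventually (\<lambda>w. w \<noteq> x) (at z)" by (rule eventually_neq_at_within)
    ultimately show ?thesis
      by (auto simp: punctured_def elim: eventually_elim2)
  qed
  then show ?thesis by (simp add: sparse_in_open islimpt_iff_eventually)
qed

lemma weierstrass_form_reflect:
  assumes ev: "\<And>z. \<phi> (2 * P - z) = \<phi> z" "\<And>z. \<psi> (2 * P - z) = \<psi> z"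
    and h: "\<And>z. eventually (\<lambda>w. h (2 * P - w) = K * h w) (at z)" and K: "K = 1 \<or> K = -1"
  shows "weierstrass_form \<phi> \<psi> h j (2 * P - z) = K * weierstrass_form \<phi> \<psi> h j z"
proof -
  define G where "G z = (vector [\<phi> z + \<psi> z, - \<i> * (\<phi> z - \<psi> z), 1 - \<phi> z * \<psi> z, 1 + \<phi> z * \<psi> z]
                        :: complex ^ 4) $ j * h z" for z
  have "remove_sings G (2 * P - z) = remove_sings (\<lambda>z. G (2 * P - z)) z"
    by (rule remove_sings_reflect[symmetric])
  also have "\<dots> = remove_sings (\<lambda>z. K * G z) z"
    by (rule remove_sings_cong) (use h[of z] in \<open>auto simp: G_def ev elim: eventually_mono\<close>)
  also have "\<dots> = K * remove_sings G z" using K remove_sings_uminus[of G] by auto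
  finally show ?thesis unfolding weierstrass_form_def G_def[abs_def] .
qed

text \<open>The reflection reverses the direction of the path, which adds a sign to the factor
  \<open>K\<close> of the forms. So \<open>K = 1\<close> negates increments of \<open>X\<close>, and
  \<open>K = -1\<close> preserves them.\<close>

lemma surface_reflect:
  assumes rep: "weierstrass_represents M \<phi> \<psi> h X"
    and W: "\<And>j z. weierstrass_form \<phi> \<psi> h j (2 * P - z) = of_real K * weierstrass_form \<phi> \<psi> h j z"
    and seg: "closed_segment a b \<subseteq> M" "closed_segment (2 * P - a) (2 * P - b) \<subseteq> M"
  shows "X (2 * P - b) - X (2 * P - a) = - K *\<^sub>R (X b - X a)"
proof -
  have diff: "X y $ j - X x $ j = 2 * Re (contour_integral (linepath x y) (weierstrass_form \<phi> \<psi> h j))"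
    if "closed_segment x y \<subseteq> M" for x y j
  proof -
    have "valid_path (linepath x y)" "path_image (linepath x y) \<subseteq> M" using that by auto
    then have "X (pathfinish (linepath x y)) $ j - X (pathstart (linepath x y)) $ j
        = 2 * Re (contour_integral (linepath x y) (weierstrass_form \<phi> \<psi> h j))"
      using rep unfolding weierstrass_represents_def by metis
    then show ?thesis by simp
  qed
  have "(X (2 * P - b) - X (2 * P - a)) $ j = (- K *\<^sub>R (X b - X a)) $ j" for j
  proof -
    let ?W = "weierstrass_form \<phi> \<psi> h j"
    have "contour_integral (linepath (2 * P - a) (2 * P - b)) ?W
      = (a - b) * integral {0..1} (\<lambda>x. ?W (2 * P - (a + of_real x * (b - a))))"
      unfolding contour_integral_linepath_integral by (simp add: algebra_simps)
    also have "\<dots> = (a - b) * (of_real K * integral {0..1} (\<lambda>x. ?W (a + of_real x * (b - a))))"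
      unfolding W by (simp only: integral_mult_right)
    also have "\<dots> = - of_real K * contour_integral (linepath a b) ?W"
      unfolding contour_integral_linepath_integral by (simp add: algebra_simps)
    finally have "contour_integral (linepath (2 * P - a) (2 * P - b)) ?W
       = of_real (- K) * contour_integral (linepath a b) ?W" by simp
    then show ?thesis
      using diff[OF seg(1), of j] diff[OF seg(2), of j] by simp
  qed
  then show ?thesis by (simp add: vec_eq_iff)
qed

theorem not_embedded:
  assumes perX: "periodic_on L (punctured L P) X"
    and data: "weierstrass_data L (punctured L P) \<phi> \<psi> h"
    and rep: "weierstrass_represents (punctured L P) \<phi> \<psi> h X"
    and alg: "algebraic_data \<phi> \<psi> h"
    and reg: "gauss_maps_distinct_at \<phi> \<psi> P"
    and tc: "- total_curvature w1 w2 (punctured L P) X = 8 * pi"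
    and mult: "has_multiplicity_at \<phi> P 2" "has_multiplicity_at \<psi> P 2"
  shows "\<not> embedded_surface L (punctured L P) X"
proof -
  define M where "M = punctured L P"
  have Ms: "- M sparse_in UNIV" unfolding M_def by (rule sparse_lattice)
  have oM: "open M" using sparse_in_UNIV_imp_closed[OF Ms] by (simp add: closed_def)
  have cM: "countable (- M)" using sparse_imp_countable[OF open_UNIV Ms] by simp
  have evM: "eventually (\<lambda>w. w \<in> M) (at z)" for z using eventually_not_sparse[OF Ms, of z] by simp
  have nm: "\<phi> nicely_meromorphic_on UNIV" "\<psi> nicely_meromorphic_on UNIV" "h nicely_meromorphic_on UNIV"
    using alg by (auto simp: algebraic_data_def)
  note D = data[folded M_def, unfolded weierstrass_data_def]
  \<comment> \<open>Periodicity is given only on \<open>M\<close>; nice meromorphy carries it to the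
    lattice translates of \<open>P\<close>.\<close>
  have per: "f (z + w) = f z"
    if "f nicely_meromorphic_on UNIV" "periodic_on L M f" "w \<in> L" for f z w
  proof (rule nicely_meromorphic_eqI[OF nicely_meromorphic_translate[OF that(1)] that(1)])
    show "eventually (\<lambda>x. f (x + w) = f x) (at z)"
      using evM[of z] by eventually_elim (use that in \<open>auto simp: periodic_on_def\<close>)
  qed
  have perL: "\<phi> (z + w) = \<phi> z" "\<psi> (z + w) = \<psi> z" "h (z + w) = h z" if "w \<in> L" for z w
    using per nm D that by blast+
  have lat: "w1 \<in> L" "w2 \<in> L" by (rule period_lattice_simps)+
  have dist: "gauss_maps_distinct_at \<phi> \<psi> z" for z
  proof (cases "z \<in> M")
    case True
    then show ?thesis using D by blast
  next
    case False
    then have zP: "z - P \<in> L" by (simp add: M_def punctured_def)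
    have "is_pole \<phi> (P + (z - P)) \<longleftrightarrow> is_pole \<phi> P" "is_pole \<psi> (P + (z - P)) \<longleftrightarrow> is_pole \<psi> P"
      by (rule is_pole_periodic, rule perL[OF zP])+
    with reg perL[OF zP, of P] show ?thesis by (simp add: gauss_maps_distinct_at_def)
  qed
  then have dist': "gauss_maps_distinct_at \<psi> \<phi> z" for z
    using gauss_maps_distinct_at_swap by blast
  have cont: "continuous_on UNIV (remove_sings (gauss_density \<phi> \<psi>))"
    by (rule continuous_on_gauss_density[OF nm(1,2) dist])
  have "total_curvature w1 w2 M X
    = - 4 * (LINT z:fundamental_parallelogram w1 w2|lborel. Re (remove_sings (gauss_density \<phi> \<psi>) z))"
    by (rule total_curvature_eq[OF oM cM _ alg _ borel_fundamental_parallelogram[OF J] _ cont])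
      (use data rep tc in \<open>auto simp: M_def\<close>)
  then have I1: "(LINT z:fundamental_parallelogram w1 w2|lborel. Re (remove_sings (gauss_density \<phi> \<psi>) z)) = 2 * pi"
    using tc by (simp add: M_def)
  have "Re (remove_sings (gauss_density \<psi> \<phi>) z) = Re (remove_sings (gauss_density \<phi> \<psi>) z)" for z
    unfolding gauss_density_swap[of \<psi> \<phi>, abs_def] remove_sings_cnj by simp
  with I1 have I2: "(LINT z:fundamental_parallelogram w1 w2|lborel. Re (remove_sings (gauss_density \<psi> \<phi>) z)) = 2 * pi"
    by simp
  \<comment> \<open>The sides must also avoid the fibres through \<open>P\<close>, whose points are
    counted as zeros in \<open>even_of_multiplicity_2\<close>.\<close>
  define S where "S = {z. is_pole \<phi> z} \<union> {z. is_pole \<psi> z} \<union> {z. \<phi> z = \<phi> P} \<union> {z. \<psi> z = \<psi> P}"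
  have "S sparse_in UNIV"
    unfolding S_def using nm mult
    by (intro sparse_in_union' sparse_poles sparse_level_set) (auto simp: nicely_meromorphic_on_def)
  then have "countable S" using sparse_imp_countable[OF open_UNIV] by auto
  from exists_base_point[OF J this] obtain \<alpha> \<beta> where \<alpha>: "\<alpha> \<in> {0..1}" "\<beta> \<in> {0..1}"
    and bd: "\<And>s t. para (of_real \<alpha> * w1 + of_real \<beta> * w2) w1 w2 s t \<in> S \<Longrightarrow> s \<notin> {0, 1} \<and> t \<notin> {0, 1}"
    by metis
  define p where "p = of_real \<alpha> * w1 + of_real \<beta> * w2"
  have "2 * pi = - pi * real_of_int (\<Sum>q | is_pole \<phi> q \<and> q \<in> closed_para p w1 w2. zorder \<phi> q)"
    unfolding I1[symmetric] p_def
    by (rule gauss_density_integral[OF nm(1,2) _ _ _ _ dist \<alpha>])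
      ((rule perL lat)+, (use bd in \<open>unfold S_def, blast\<close>))
  then have "pi * (2 + real_of_int (\<Sum>q | is_pole \<phi> q \<and> q \<in> closed_para p w1 w2. zorder \<phi> q)) = 0"
    by (simp add: algebra_simps)
  then have deg1: "(\<Sum>q | is_pole \<phi> q \<and> q \<in> closed_para p w1 w2. zorder \<phi> q) = -2"
    by (simp only: mult_eq_0_iff pi_neq_zero simp_thms)
  have "2 * pi = - pi * real_of_int (\<Sum>q | is_pole \<psi> q \<and> q \<in> closed_para p w1 w2. zorder \<psi> q)"
    unfolding I2[symmetric] p_def
    by (rule gauss_density_integral[OF nm(2,1) _ _ _ _ dist' \<alpha>])
      ((rule perL lat)+, (use bd in \<open>unfold S_def, blast\<close>))
  then have "pi * (2 + real_of_int (\<Sum>q | is_pole \<psi> q \<and> q \<in> closed_para p w1 w2. zorder \<psi> q)) = 0"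
    by (simp add: algebra_simps)
  then have deg2: "(\<Sum>q | is_pole \<psi> q \<and> q \<in> closed_para p w1 w2. zorder \<psi> q) = -2"
    by (simp only: mult_eq_0_iff pi_neq_zero simp_thms)
  have even1: "\<phi> (2 * P - z) = \<phi> z" for z
    by (rule even_of_multiplicity_2[OF nm(1) _ _ mult(1) _ deg1])
      ((rule perL lat)+, (use bd in \<open>unfold S_def p_def, blast\<close>))
  have even2: "\<psi> (2 * P - z) = \<psi> z" for z
    by (rule even_of_multiplicity_2[OF nm(2) _ _ mult(2) _ deg2])
      ((rule perL lat)+, (use bd in \<open>unfold S_def p_def, blast\<close>))
  have Mrefl: "2 * P - z \<in> M" if "z \<in> M" for z
    using that period_lattice_simps(4)[of "P - z" w1 w2] by (auto simp: M_def punctured_def)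
  have mero: "\<phi> meromorphic_on UNIV" "\<psi> meromorphic_on UNIV" "h meromorphic_on UNIV"
    using nm by (auto simp: nicely_meromorphic_on_def)
  have pole: "is_pole \<phi> (2 * P - z) \<longleftrightarrow> is_pole \<phi> z" "is_pole \<psi> (2 * P - z) \<longleftrightarrow> is_pole \<psi> z" for z
    using is_pole_reflect[of \<phi> "2 * P" z] is_pole_reflect[of \<psi> "2 * P" z] even1 even2 by simp_all
  have zo: "zorder \<phi> (2 * P - z) = zorder \<phi> z" "zorder \<psi> (2 * P - z) = zorder \<psi> z" for z
    using zorder_reflect[OF mero(1), of "2 * P" z] zorder_reflect[OF mero(2), of "2 * P" z] even1 even2 by simp_all
  \<comment> \<open>On \<open>M\<close> the order of \<open>h\<close> is dictated by the poles of
    the even functions \<open>\<phi>\<close> and \<open>\<psi>\<close>. At the remaining points both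
    \<open>z\<close> and its reflection are congruent to \<open>P\<close>, and periodicity suffices
    whatever the order of \<open>h\<close> is there.\<close>
  have zoh: "zorder h (2 * P - z) = zorder h z" for z
  proof (cases "z \<in> M")
    case True
    note zM = True Mrefl[OF True]
    consider "is_pole \<phi> z" | "is_pole \<psi> z" | "\<not> is_pole \<phi> z" "\<not> is_pole \<psi> z" by blast
    then show ?thesis
    proof cases
      case 3
      have "zorder h x = 0" if "x \<in> M" "\<not> is_pole \<phi> x" "\<not> is_pole \<psi> x" for x
        using D that by (intro zorder_eq_0I) (auto intro: analytic_on_subset)
      then show ?thesis using zM 3 pole by metis
    qed (use D zM pole zo in metis)+
  next
    case False
    then have zP: "z - P \<in> L" by (simp add: M_def punctured_def)
    have "zorder h (P + (z - P)) = zorder h P" "zorder h (P + - (z - P)) = zorder h P"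
      by (rule zorder_periodic, rule perL, use zP period_lattice_simps(4) in blast)+
    then show ?thesis by (simp add: algebra_simps)
  qed
  \<comment> \<open>If the zeros of \<open>h\<close> accumulated, \<open>h\<close> would vanish
    identically, and every point of \<open>M\<close> would be a pole of a Gauss map.\<close>
  have hnz: "eventually (\<lambda>w. h w \<noteq> 0) (at z)" for z
  proof (rule ccontr)
    assume "\<not> eventually (\<lambda>w. h w \<noteq> 0) (at z)"
    then have "\<exists>\<^sub>F w in at z. h w = 0" by (simp add: frequently_def)
    from frequently_eq_meromorphic_imp_constant[OF this nm(3)]
    have "h w = 0" for w by auto
    then have "w \<in> M \<Longrightarrow> is_pole \<phi> w \<or> is_pole \<psi> w" for w using D by blast
    moreover have "eventually (\<lambda>w. w \<in> M \<and> \<not> is_pole \<phi> w \<and> \<not> is_pole \<psi> w) (at z)"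
      using evM[of z] eventually_not_sparse[OF sparse_poles[OF mero(1)], of z]
        eventually_not_sparse[OF sparse_poles[OF mero(2)], of z]
      by eventually_elim auto
    ultimately show False using eventually_happens'[OF at_neq_bot] by blast
  qed
  obtain K :: complex where K: "K = 1 \<or> K = -1" "\<And>z. eventually (\<lambda>w. h (2 * P - w) = K * h w) (at z)"
    using even_or_odd_of_zorder[OF mero(3) _ _ hnz zoh] perL lat by metis
  have W: "weierstrass_form \<phi> \<psi> h j (2 * P - z) = K * weierstrass_form \<phi> \<psi> h j z" for j z
    by (rule weierstrass_form_reflect) (fact even1 even2 K)+
  have segM: "closed_segment a b \<subseteq> M" if *: "\<And>x. x \<in> {0..1} \<Longrightarrow> a + of_real x * (b - a) \<in> M" for a b
  proof
    fix y assume "y \<in> closed_segment a b"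
    then obtain u where u: "u \<in> {0..1}" "y = (1 - u) *\<^sub>R a + u *\<^sub>R b" by (auto simp: closed_segment_def)
    then have "y = a + of_real u * (b - a)" by (simp add: scaleR_conv_of_real algebra_simps)
    with *[OF u(1)] show "y \<in> M" by simp
  qed
  have seg: "closed_segment a b \<subseteq> M \<and> closed_segment (2 * P - a) (2 * P - b) \<subseteq> M"
    if *: "\<And>x. x \<in> {0..1} \<Longrightarrow> a + of_real x * (b - a) \<in> M" for a b
  proof
    show "closed_segment a b \<subseteq> M" using * by (rule segM)
    show "closed_segment (2 * P - a) (2 * P - b) \<subseteq> M"
    proof (rule segM)
      fix x :: real assume "x \<in> {0..1}"
      from Mrefl[OF *[OF this]]
      show "2 * P - a + of_real x * (2 * P - b - (2 * P - a)) \<in> M" by (simp add: algebra_simps)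
    qed
  qed
  have inM: "P + (of_real s * w1 + of_real t * w2) \<in> M" if "s \<notin> \<int> \<or> t \<notin> \<int>" for s t
    using that lattice_coords[of s t] by (auto simp: M_def punctured_def)
  have notZ: "x \<notin> \<int>" if "0 < x" "x < 1" for x :: real
    using that by (auto elim!: Ints_cases)
  have perXM: "X (z + w) = X z" if "z \<in> M" "w \<in> L" for z w
    using perX that by (auto simp: periodic_on_def M_def)
  have wit: "\<exists>a\<in>M. \<exists>b\<in>M. X a = X b \<and> a - b \<notin> L"
    using K(1)
  proof
    assume K1: "K = 1"
    \<comment> \<open>Half periods are fixed by the reflection modulo \<open>L\<close>, so
      \<open>X\<close> agrees at \<open>a\<close> and \<open>2 * P - a\<close>, and likewise for
      \<open>b\<close>. The increment of \<open>X\<close> from \<open>a\<close> to \<open>b\<close>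
      is then its own negative.\<close>
    define a where "a = P + (of_real (1/2) * w1 + of_real 0 * w2)"
    define b where "b = P + (of_real 0 * w1 + of_real (1/2) * w2)"
    have ab: "a \<in> M" "b \<in> M" unfolding a_def b_def by (intro inM; use notZ[of "1/2"] in simp)+
    have "a + of_real x * (b - a) \<in> M" if "x \<in> {0..1}" for x
    proof -
      have "a + of_real x * (b - a) = P + (of_real ((1 - x) / 2) * w1 + of_real (x / 2) * w2)"
        by (simp add: a_def b_def field_simps)
      \<comment> \<open>At \<open>x = 0\<close> the second coordinate is an integer, but the first
        one is 1/2; so the segment misses every translate of \<open>P\<close>.\<close>
      moreover have "(1 - x) / 2 \<notin> \<int> \<or> x / 2 \<notin> \<int>"
        using notZ[of "(1 - x) / 2"] notZ[of "x / 2"] that by (cases "x = 0") auto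
      ultimately show ?thesis using inM[of "(1 - x) / 2" "x / 2"] by metis
    qed
    from surface_reflect[OF rep, folded M_def, of P 1, OF _ conjunct1[OF seg[OF this]] conjunct2[OF seg[OF this]]]
    have "X (2 * P - b) - X (2 * P - a) = - (X b - X a)" using W K1 by simp
    moreover have "X (2 * P - a) = X a" "X (2 * P - b) = X b"
      using perXM[OF ab(1), of "- w1"] perXM[OF ab(2), of "- w2"] lat period_lattice_simps(4)
      by (simp_all add: a_def b_def algebra_simps)
    ultimately have "X b - X a = - (X b - X a)" by simp
    then have "X a = X b" by (simp add: vec_eq_iff)
    moreover have "a - b \<notin> L"
      using lattice_coords(1)[of "1/2" "-1/2"] notZ[of "1/2"] by (auto simp: a_def b_def)
    ultimately show ?thesis using ab by blast
  next
    assume K1: "K = -1"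
    \<comment> \<open>The half period \<open>a\<close> anchors the comparison, since the reflection
      fixes it modulo \<open>L\<close>. The factor 1/3 in \<open>b\<close> makes the reflection move
      it: \<open>2 * P - b\<close> and \<open>b\<close> differ by two thirds of \<open>w1\<close>,
      which is not in \<open>L\<close>.\<close>
    define a where "a = P + (of_real (1/2) * w1 + of_real 0 * w2)"
    define b where "b = P + (of_real (1/3) * w1 + of_real 0 * w2)"
    have ab: "a \<in> M" "b \<in> M" unfolding a_def b_def by (intro inM; use notZ[of "1/2"] notZ[of "1/3"] in simp)+
    have "a + of_real x * (b - a) \<in> M" if "x \<in> {0..1}" for x
    proof -
      have "a + of_real x * (b - a) = P + (of_real (1 / 2 - x / 6) * w1 + of_real 0 * w2)"
        by (simp add: a_def b_def field_simps)
      moreover have "1 / 2 - x / 6 \<notin> \<int>"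
        using notZ[of "1 / 2 - x / 6"] that by auto
      ultimately show ?thesis using inM[of "1 / 2 - x / 6" 0] by metis
    qed
    from surface_reflect[OF rep, folded M_def, of P "-1", OF _ conjunct1[OF seg[OF this]] conjunct2[OF seg[OF this]]]
    have "X (2 * P - b) - X (2 * P - a) = X b - X a" using W K1 by simp
    moreover have "X (2 * P - a) = X a"
      using perXM[OF ab(1), of "- w1"] lat period_lattice_simps(4) by (simp add: a_def algebra_simps)
    ultimately have "X (2 * P - b) = X b" by simp
    moreover have "2 * P - b - b \<notin> L"
    proof
      assume "2 * P - b - b \<in> L"
      then have "- (2 * P - b - b) \<in> L" by (rule period_lattice_simps(4))
      also have "- (2 * P - b - b) = of_real (2/3) * w1 + of_real 0 * w2" by (simp add: b_def)
      finally show False using lattice_coords(1)[of "2/3" 0] notZ[of "2/3"] by simp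
    qed
    ultimately show ?thesis using Mrefl[OF ab(2)] ab(2) by blast
  qed
  then show ?thesis unfolding embedded_surface_def M_def by blast
qed

end

lemma period_lattice_commute: "period_lattice w1 w2 = period_lattice w2 w1"
  unfolding period_lattice_def by (metis (no_types, opaque_lifting) add.commute)

lemma fundamental_parallelogram_commute: "fundamental_parallelogram w1 w2 = fundamental_parallelogram w2 w1"
  unfolding fundamental_parallelogram_def by (metis (no_types, opaque_lifting) add.commute)

theorem theoremD:
  fixes w1 w2 P :: complex
    and X :: "complex \<Rightarrow> real ^ 4"
    and \<phi> \<psi> h :: "complex \<Rightarrow> complex"
  defines "L \<equiv> period_lattice w1 w2"
  defines "M \<equiv> punctured L P"
  assumes torus: "Im (w2 / w1) \<noteq> 0"
    and stationary: "stationary_surface L M X"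
    and complete: "complete_surface L M X"
    and data: "weierstrass_data L M \<phi> \<psi> h"
    and representation: "weierstrass_represents M \<phi> \<psi> h X"
    and algebraic: "algebraic_data \<phi> \<psi> h"
    and regular_end: "gauss_maps_distinct_at \<phi> \<psi> P"
    and total_curvature: "- total_curvature w1 w2 M X = 8 * pi"
    and order_phi: "has_multiplicity_at \<phi> P 2"
    and order_psi: "has_multiplicity_at \<psi> P 2"
  shows "\<not> embedded_surface L M X"
proof -
  have "Im (w2 / w1) = Im (cnj w1 * w2) / (cmod w1)\<^sup>2"
    by (simp add: Im_divide cmod_power2 algebra_simps)
  with torus have J: "Im (cnj w1 * w2) \<noteq> 0" by auto
  have per: "periodic_on L M X" using stationary by (simp add: stationary_surface_def)
  show ?thesis
  proof (cases "Im (cnj w1 * w2) > 0")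
    case True
    then interpret torus w1 w2 by unfold_locales
    show ?thesis
      using not_embedded[of P X \<phi> \<psi> h] per data representation algebraic regular_end
        total_curvature order_phi order_psi unfolding L_def M_def by blast
  next
    case False
    \<comment> \<open>Exchanging the periods reverses the orientation but changes neither the
      lattice nor the fundamental parallelogram.\<close>
    have "Im (cnj w2 * w1) = - Im (cnj w1 * w2)" by simp
    with False J have "Im (cnj w2 * w1) > 0" by linarith
    then interpret torus w2 w1 by unfold_locales
    have tc: "- total_curvature w2 w1 M X = 8 * pi"
      using total_curvature unfolding total_curvature_def fundamental_parallelogram_commute[of w1 w2] .
    show ?thesis
      using not_embedded[of P X \<phi> \<psi> h] per data representation algebraic regular_end
        tc order_phi order_psi unfolding L_def M_def period_lattice_commute[of w1 w2] by blast
  qed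
qed

end
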